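(* Let $\Omega\subset\mathbb{R}^{3}$ be a bounded domain with smooth boundary, let $N=3$, and let $p>1$. Assume that $K\in L^{\infty}(\Omega)$ with $K(x)\ge 0$ for all $x\in\Omega$, and that $h\in L^{\infty}(\Omega)$ with $h(x)>0$ for all $x\in\Omega$. Then there exists $m>0$ such that if $\|h\|_{L^{N}(\Omega)}\le m$, the Schrödinger–Maxwell system $$-\Delta u+K(x)\phi u=|u|^{p-1}u+h(x)\ \text{in }\Omega,\qquad -\Delta\phi=K(x)u^{2}\ \text{in }\Omega,\qquad \phi=u=0\ \text{on }\partial\Omega,$$ admits at least one nontrivial (weak) solution.
   Context: Let $E=H^{1}_{0}(\Omega)\cap L^{p+1}(\Omega)$ with norm $\|u\|=\|\nabla u\|_{2}+\|u\|_{p+1}$. For $u\in E$, $\phi_u\in H^1_0(\Omega)$ denotes the unique weak solution of $-\Delta\phi_u=K(x)u^2$ in $\Omega$, $\phi_u=0$ on $\partial\Omega$. A (weak) solution of the system is a pair $(u,\phi)$ with $u\in E$, $\phi=\phi_u$, and $\int_\Omega\nabla u\cdot\nabla\varphi\,dx+\int_\Omega K\phi_u u\varphi\,dx=\int_\Omega|u|^{p-1}u\varphi\,dx+\int_\Omega h\varphi\,dx$ for all test functions $\varphi\in E$; equivalently $u$ is a critical point of $I(u)=\frac12\int_\Omega|\nabla u|^2+\frac14\int_\Omega K\phi_u u^2-\frac1{p+1}\int_\Omega|u|^{p+1}-\int_\Omega hu$. Nontrivial means $u\not\equiv 0$. *)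

theory Defs
  imports "HOL-Analysis.Analysis"
begin

type_synonym R3 = "real^3"

fun Ck :: "nat \<Rightarrow> R3 set \<Rightarrow> (R3 \<Rightarrow> real) set" where
  "Ck 0 S = {f. continuous_on S f}"
| "Ck (Suc k) S = {f. (\<forall>x\<in>S. f differentiable (at x)) \<and>
      (\<forall>i::3. (\<lambda>x. frechet_derivative f (at x) (axis i 1)) \<in> Ck k S)}"

definition smooth_on :: "R3 set \<Rightarrow> (R3 \<Rightarrow> real) \<Rightarrow> bool" where
  "smooth_on S f \<longleftrightarrow> (\<forall>k. f \<in> Ck k S)"

definition cgrad :: "(R3 \<Rightarrow> real) \<Rightarrow> R3 \<Rightarrow> R3" where
  "cgrad f x = (\<chi> i. frechet_derivative f (at x) (axis i 1))"

definition smooth_bounded_domain :: "R3 set \<Rightarrow> bool" where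
  "smooth_bounded_domain \<Omega> \<longleftrightarrow> open \<Omega> \<and> connected \<Omega> \<and> \<Omega> \<noteq> {} \<and> bounded \<Omega> \<and>
     (\<forall>x\<in>frontier \<Omega>. \<exists>U \<rho>. open U \<and> x \<in> U \<and> smooth_on U \<rho> \<and>
        (\<forall>y\<in>U. cgrad \<rho> y \<noteq> 0) \<and> \<Omega> \<inter> U = {y\<in>U. \<rho> y < 0})"

definition test_fun :: "R3 set \<Rightarrow> (R3 \<Rightarrow> real) \<Rightarrow> bool" where
  "test_fun \<Omega> \<phi> \<longleftrightarrow> smooth_on UNIV \<phi> \<and> compact (closure {x. \<phi> x \<noteq> 0})
      \<and> closure {x. \<phi> x \<noteq> 0} \<subseteq> \<Omega>"

definition in_Lp :: "R3 set \<Rightarrow> real \<Rightarrow> (R3 \<Rightarrow> real) \<Rightarrow> bool" where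
  "in_Lp \<Omega> q u \<longleftrightarrow> set_borel_measurable lebesgue \<Omega> u \<and>
     set_integrable lebesgue \<Omega> (\<lambda>x. \<bar>u x\<bar> powr q)"

definition Lp_norm :: "R3 set \<Rightarrow> real \<Rightarrow> (R3 \<Rightarrow> real) \<Rightarrow> real" where
  "Lp_norm \<Omega> q u = (LINT x:\<Omega>|lebesgue. \<bar>u x\<bar> powr q) powr (1 / q)"

definition in_Linf :: "R3 set \<Rightarrow> (R3 \<Rightarrow> real) \<Rightarrow> bool" where
  "in_Linf \<Omega> K \<longleftrightarrow> set_borel_measurable lebesgue \<Omega> K \<and>
     (\<exists>C. AE x in lebesgue. x \<in> \<Omega> \<longrightarrow> \<bar>K x\<bar> \<le> C)"

definition weak_grad :: "R3 set \<Rightarrow> (R3 \<Rightarrow> real) \<Rightarrow> (R3 \<Rightarrow> R3) \<Rightarrow> bool" where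
  "weak_grad \<Omega> u g \<longleftrightarrow>
     (\<forall>C. compact C \<and> C \<subseteq> \<Omega> \<longrightarrow> set_integrable lebesgue C u \<and>
          (\<forall>i. set_integrable lebesgue C (\<lambda>x. g x $ i))) \<and>
     (\<forall>\<phi>. test_fun \<Omega> \<phi> \<longrightarrow> (\<forall>i.
        (LINT x:\<Omega>|lebesgue. u x * cgrad \<phi> x $ i) = - (LINT x:\<Omega>|lebesgue. g x $ i * \<phi> x)))"

text \<open>The weak gradient (determined almost everywhere; all uses are under integrals).\<close>
definition wgrad :: "R3 set \<Rightarrow> (R3 \<Rightarrow> real) \<Rightarrow> R3 \<Rightarrow> R3" where
  "wgrad \<Omega> u = (SOME g. weak_grad \<Omega> u g)"

definition H10 :: "R3 set \<Rightarrow> (R3 \<Rightarrow> real) \<Rightarrow> bool" where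
  "H10 \<Omega> u \<longleftrightarrow> in_Lp \<Omega> 2 u \<and>
     (\<exists>g. weak_grad \<Omega> u g \<and> in_Lp \<Omega> 2 (\<lambda>x. norm (g x)) \<and>
       (\<exists>\<phi>s. (\<forall>n. test_fun \<Omega> (\<phi>s n)) \<and>
          (\<lambda>n. Lp_norm \<Omega> 2 (\<lambda>x. \<phi>s n x - u x)) \<longlonglongrightarrow> 0 \<and>
          (\<lambda>n. Lp_norm \<Omega> 2 (\<lambda>x. norm (cgrad (\<phi>s n) x - g x))) \<longlonglongrightarrow> 0))"

definition E_space :: "R3 set \<Rightarrow> real \<Rightarrow> (R3 \<Rightarrow> real) \<Rightarrow> bool" where
  "E_space \<Omega> p u \<longleftrightarrow> H10 \<Omega> u \<and> in_Lp \<Omega> (p + 1) u"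

text \<open>phi is a weak solution in H^1_0 of -Delta phi = K u^2 (i.e. phi = phi_u, unique a.e.).\<close>
definition is_phi_u :: "R3 set \<Rightarrow> (R3 \<Rightarrow> real) \<Rightarrow> (R3 \<Rightarrow> real) \<Rightarrow> (R3 \<Rightarrow> real) \<Rightarrow> bool" where
  "is_phi_u \<Omega> K u \<phi> \<longleftrightarrow> H10 \<Omega> \<phi> \<and>
     (\<forall>\<psi>. H10 \<Omega> \<psi> \<longrightarrow>
        (LINT x:\<Omega>|lebesgue. wgrad \<Omega> \<phi> x \<bullet> wgrad \<Omega> \<psi> x) =
        (LINT x:\<Omega>|lebesgue. K x * (u x)\<^sup>2 * \<psi> x))"

definition SM_weak_solution ::
  "R3 set \<Rightarrow> real \<Rightarrow> (R3 \<Rightarrow> real) \<Rightarrow> (R3 \<Rightarrow> real) \<Rightarrow> (R3 \<Rightarrow> real) \<Rightarrow> (R3 \<Rightarrow> real) \<Rightarrow> bool" where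
  "SM_weak_solution \<Omega> p K h u \<phi> \<longleftrightarrow> E_space \<Omega> p u \<and> is_phi_u \<Omega> K u \<phi> \<and>
     (\<forall>\<psi>. E_space \<Omega> p \<psi> \<longrightarrow>
        (LINT x:\<Omega>|lebesgue. wgrad \<Omega> u x \<bullet> wgrad \<Omega> \<psi> x) +
        (LINT x:\<Omega>|lebesgue. K x * \<phi> x * u x * \<psi> x) =
        (LINT x:\<Omega>|lebesgue. \<bar>u x\<bar> powr (p - 1) * u x * \<psi> x) +
        (LINT x:\<Omega>|lebesgue. h x * \<psi> x))"

definition nontrivial_on :: "R3 set \<Rightarrow> (R3 \<Rightarrow> real) \<Rightarrow> bool" where
  "nontrivial_on \<Omega> u \<longleftrightarrow> \<not> (AE x in lebesgue. x \<in> \<Omega> \<longrightarrow> u x = 0)"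

end

theory Submission
  imports Defs
begin

text \<open>The solution is a fixed point of the map sending \<open>u\<close> to the solution \<open>w\<close> of
  \<open>- \<Delta> w = \<bar>u\<bar>\<^sup>p\<^sup>-\<^sup>1 u + h - K \<phi>\<^sub>u u\<close> in \<open>H10\<close>. On the set \<open>\<bar>u\<bar> \<le> r\<close> the nonlinear terms
  are superlinear, so for small \<open>r\<close> the map is a contraction in the \<open>L\<^sup>2\<close> norm, even when \<open>p\<close> is
  supercritical. The set is invariant because the Dirichlet problem maps \<open>L\<^sup>3\<close> boundedly into \<open>L\<^sup>\<infinity>\<close>. This
  bound is dual to an \<open>L\<close>-norm estimate with exponent \<open>3/2\<close> of the solution \<open>v\<close> for a datum of unit mass,
  which results from testing the equation for \<open>v\<close> with a bounded increasing function of \<open>v\<close> and from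
  Ladyzhenskaya's inequality.\<close>

section \<open>Smooth functions of three variables\<close>

text \<open>The hypothesis controls \<open>h\<close> only through its L^3 norm: its supremum may be
  arbitrarily large, while m is fixed beforehand. The sup bound must therefore see nothing of the
  datum but its L^3 norm, and this forces the duality argument. The other terms of the right-hand
  side are bounded outright on the ball |u| <= r.

  Two topologies are used. Invariance is measured in the supremum and contraction in L^2, where
  Poincare's inequality alone bounds the solution operator; the sup-ball is closed in L^2, so the
  limit of the iteration stays in it. The power has Lipschitz constant p r^(p-1), small because p >
  1, and the Maxwell term, cubic in u, contributes factors r^2.

  The radius r depends on the domain, p and K, and m is r divided by twice the sup constant:
  \<open>h\<close> takes up half of the ball, the nonlinear terms the other half. Nontriviality is
  not a matter of the iteration: u = 0 almost everywhere would make \<open>h\<close> orthogonal to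
  all test functions, which h > 0 excludes.\<close>

definition partial :: "3 \<Rightarrow> (R3 \<Rightarrow> real) \<Rightarrow> R3 \<Rightarrow> real" where
  "partial i f x = frechet_derivative f (at x) (axis i 1)"

lemma cgrad_nth [simp]: "cgrad f x $ i = partial i f x"
  by (simp add: cgrad_def partial_def)

lemma partial_eqI: "(f has_derivative f') (at x) \<Longrightarrow> partial i f x = f' (axis i 1)"
  unfolding partial_def by (metis frechet_derivative_at)

lemma Ck_Suc_iff:
  "f \<in> Ck (Suc k) UNIV \<longleftrightarrow> (\<forall>x. f differentiable (at x)) \<and> (\<forall>i. partial i f \<in> Ck k UNIV)"
  by (simp add: partial_def[abs_def])

lemma Ck_Suc_imp_Ck: "f \<in> Ck (Suc k) UNIV \<Longrightarrow> f \<in> Ck k UNIV"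
proof (induction k arbitrary: f)
  case 0
  then show ?case
    by (auto simp: continuous_on_eq_continuous_within differentiable_imp_continuous_within)
next
  case (Suc k)
  then show ?case
    using Suc.IH by (subst Ck_Suc_iff) (auto simp only: Ck_Suc_iff[of f])
qed

lemma partial_const: "partial i (\<lambda>x. c) = (\<lambda>x. 0)"
  by (rule ext, subst partial_eqI[OF has_derivative_const]) simp

lemma Ck_const: "(\<lambda>x. c) \<in> Ck k UNIV"
proof (induction k arbitrary: c)
  case (Suc k)
  then show ?case by (simp add: Ck_Suc_iff partial_const del: Ck.simps)
qed simp

lemma partial_add:
  assumes "f differentiable (at x)" "g differentiable (at x)"
  shows "partial i (\<lambda>x. f x + g x) x = partial i f x + partial i g x"
  using has_derivative_add[OF assms[THEN frechet_derivative_works[THEN iffD1]]]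
  by (subst partial_eqI) (auto simp: partial_def)

lemma partial_mult:
  assumes "f differentiable (at x)" "g differentiable (at x)"
  shows "partial i (\<lambda>x. f x * g x) x = f x * partial i g x + partial i f x * g x"
  using has_derivative_mult[OF assms[THEN frechet_derivative_works[THEN iffD1]]]
  by (subst partial_eqI) (auto simp: partial_def)

lemma partial_compose:
  assumes "f differentiable (at x)" "(F has_real_derivative F') (at (f x))"
  shows "partial i (\<lambda>x. F (f x)) x = F' * partial i f x"
    and "(\<lambda>x. F (f x)) differentiable (at x)"
proof -
  have "((\<lambda>x. F (f x)) has_derivative (\<lambda>h. F' * frechet_derivative f (at x) h)) (at x)"
    using has_derivative_compose[OF frechet_derivative_works[THEN iffD1, OF assms(1)], of F "\<lambda>h. F' * h"] assms(2)
    by (simp add: has_field_derivative_def)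
  then show "partial i (\<lambda>x. F (f x)) x = F' * partial i f x"
      "(\<lambda>x. F (f x)) differentiable (at x)"
    by (subst partial_eqI, auto simp: partial_def differentiable_def)
qed

lemma Ck_add: "f \<in> Ck k UNIV \<Longrightarrow> g \<in> Ck k UNIV \<Longrightarrow> (\<lambda>x. f x + g x) \<in> Ck k UNIV"
proof (induction k arbitrary: f g)
  case 0 then show ?case by (auto intro: continuous_intros)
next
  case (Suc k)
  then have "partial i (\<lambda>x. f x + g x) = (\<lambda>x. partial i f x + partial i g x)" for i
    by (auto simp: partial_add Ck_Suc_iff simp del: Ck.simps)
  with Suc show ?case by (simp add: Ck_Suc_iff differentiable_add del: Ck.simps)
qed

lemma Ck_mult: "f \<in> Ck k UNIV \<Longrightarrow> g \<in> Ck k UNIV \<Longrightarrow> (\<lambda>x. f x * g x) \<in> Ck k UNIV"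
proof (induction k arbitrary: f g)
  case 0 then show ?case by (auto intro: continuous_intros)
next
  case (Suc k)
  then have "partial i (\<lambda>x. f x * g x) = (\<lambda>x. f x * partial i g x + partial i f x * g x)" for i
    by (auto simp: partial_mult Ck_Suc_iff simp del: Ck.simps)
  moreover have fg: "f \<in> Ck k UNIV" "g \<in> Ck k UNIV" using Suc.prems Ck_Suc_imp_Ck by blast+
  moreover have "partial i f \<in> Ck k UNIV" "partial i g \<in> Ck k UNIV" for i
    using Suc.prems unfolding Ck_Suc_iff by auto
  moreover have "(\<lambda>x. f x * partial i g x + partial i f x * g x) \<in> Ck k UNIV" for i
    by (intro Ck_add Suc.IH fg calculation)
  ultimately show ?case using Suc.prems
    unfolding Ck_Suc_iff by (simp add: differentiable_mult)
qed

text \<open>Differentiating F i (f x) produces the outer function F (d i), so the induction needs a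
  whole family closed under differentiation. The domain \<open>D\<close> admits families such as
  real powers, which are differentiable only at positive arguments.\<close>

lemma Ck_compose:
  assumes F: "\<And>i t. t \<in> D \<Longrightarrow> (F i has_real_derivative F (d i) t) (at t)"
  shows "f \<in> Ck k UNIV \<Longrightarrow> (\<And>x. f x \<in> D) \<Longrightarrow> (\<lambda>x. F i (f x)) \<in> Ck k UNIV"
proof (induction k arbitrary: f i)
  case 0
  have "isCont (F i) t" if "t \<in> D" for t
    using F[OF that] by (rule DERIV_isCont)
  then have "continuous_on D (F i)" by (simp add: continuous_at_imp_continuous_on)
  then show ?case
    using 0 by (auto intro: continuous_on_compose2[where g="F i" and t=D])
next
  case (Suc k)
  then have d: "f differentiable (at x)" for x by (simp add: Ck_Suc_iff del: Ck.simps)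
  have "partial j (\<lambda>x. F i (f x)) = (\<lambda>x. F (d i) (f x) * partial j f x)" for j
    by (rule ext, rule partial_compose(1)[OF d F[OF Suc.prems(2)]])
  moreover have "(\<lambda>x. F i (f x)) differentiable (at x)" for x
    by (rule partial_compose(2)[OF d F[OF Suc.prems(2)]])
  moreover have "f \<in> Ck k UNIV" using Suc.prems Ck_Suc_imp_Ck by blast
  ultimately show ?case using Suc
    by (auto simp: Ck_Suc_iff intro!: Ck_mult simp del: Ck.simps)
qed

lemma has_derivative_component: "((\<lambda>x::R3. x $ i) has_derivative (\<lambda>h. h $ i)) (at x)"
  by (rule bounded_linear_imp_has_derivative) (rule bounded_linear_vec_nth)

lemma partial_component: "partial j (\<lambda>x. x $ i) = (\<lambda>x. if i = j then 1 else 0)"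
  by (rule ext, subst partial_eqI[OF has_derivative_component]) (auto simp: axis_def)

lemma Ck_component: "(\<lambda>x. x $ i) \<in> Ck k UNIV"
proof (cases k)
  case 0 then show ?thesis by (auto intro: continuous_intros)
next
  case (Suc m)
  then show ?thesis
    using has_derivative_component Ck_const
    by (auto simp: Ck_Suc_iff partial_component differentiable_def simp del: Ck.simps)
qed

lemma Ck_prod: "finite A \<Longrightarrow> (\<And>i. i \<in> A \<Longrightarrow> f i \<in> Ck k UNIV) \<Longrightarrow> (\<lambda>x. \<Prod>i\<in>A. f i x) \<in> Ck k UNIV"
proof (induction A rule: finite_induct)
  case empty then show ?case by (simp add: Ck_const)
next
  case (insert a A) then show ?case by (simp add: Ck_mult)
qed

lemma Ck_powr:
  assumes "f \<in> Ck k UNIV" "\<And>x. f x > 0"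
  shows "(\<lambda>x. f x powr a) \<in> Ck k UNIV"
proof -
  \<comment> \<open>The pair (c, a) encodes c t^a, a family closed under differentiation; the goal
    is the member (1, a).\<close>
  define F where "F = (\<lambda>i t::real. fst i * t powr snd i :: real)"
  have "(F i has_real_derivative F (fst i * snd i, snd i - 1) t) (at t)" if "t \<in> {0<..}" for i t
    using that by (auto simp: F_def intro!: derivative_eq_intros)
  then have "(\<lambda>x. F (1, a) (f x)) \<in> Ck k UNIV"
    by (rule Ck_compose[where D="{0<..}" and d="\<lambda>i. (fst i * snd i, snd i - 1)"]) (use assms in auto)
  then show ?thesis by (simp add: F_def)
qed

text \<open>A family closed under differentiation; \<open>P = 1\<close> gives the standard smooth cutoff.\<close>
definition exp_inv_poly :: "real poly \<Rightarrow> real \<Rightarrow> real" where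
  "exp_inv_poly P t = (if t > 0 then poly P (1 / t) * exp (- (1 / t)) else 0)"

lemma tendsto_poly_times_exp_minus: "((\<lambda>x::real. poly P x * exp (- x)) \<longlongrightarrow> 0) at_top"
proof -
  have "((\<lambda>x. \<Sum>i\<le>degree P. coeff P i * (x ^ i / exp x)) \<longlongrightarrow> (\<Sum>i\<le>degree P. coeff P i * 0)) at_top"
    by (intro tendsto_sum tendsto_mult tendsto_const tendsto_power_div_exp_0)
  then show ?thesis
    by (simp add: poly_altdef exp_minus field_simps sum_divide_distrib)
qed

text \<open>With s = 1/t one has d/dt = -s^2 d/ds, which turns P(s) exp(-s) into s^2 (P - P')(s)
  exp(-s); \<open>[:0,0,1:]\<close> is s^2. At t = 0 the difference quotient is itself a member of
  the family, with polynomial s P(s), and tends to 0 because the exponential beats every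
  polynomial.\<close>

lemma exp_inv_poly_deriv:
  "(exp_inv_poly P has_real_derivative exp_inv_poly ([:0,0,1:] * (P - pderiv P)) t) (at t)"
proof -
  consider "t > 0" | "t < 0" | "t = 0" by linarith
  then show ?thesis
  proof cases
    case 1
    have "((\<lambda>t. poly P (1 / t) * exp (- (1 / t))) has_real_derivative
        exp_inv_poly ([:0,0,1:] * (P - pderiv P)) t) (at t)"
      using 1 unfolding exp_inv_poly_def
      by (auto intro!: derivative_eq_intros poly_DERIV[THEN DERIV_chain2] simp: field_simps power2_eq_square)
    moreover have "eventually (\<lambda>t. exp_inv_poly P t = poly P (1 / t) * exp (- (1 / t))) (nhds t)"
      using eventually_nhds_in_open[of "{0<..}" t] 1 by (auto elim!: eventually_mono simp: exp_inv_poly_def)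
    ultimately show ?thesis by (subst DERIV_cong_ev[OF refl _ refl])
  next
    case 2
    have "eventually (\<lambda>t. exp_inv_poly P t = 0) (nhds t)"
      using eventually_nhds_in_open[of "{..<0}" t] 2 by (auto elim!: eventually_mono simp: exp_inv_poly_def)
    then show ?thesis using 2 by (subst DERIV_cong_ev[OF refl _ refl]) (auto simp: exp_inv_poly_def)
  next
    case 3
    have "((\<lambda>h. exp_inv_poly ([:0,1:] * P) h) \<longlongrightarrow> 0) (at_right 0)"
    proof -
      have "((\<lambda>h::real. poly ([:0,1:] * P) (inverse h) * exp (- inverse h)) \<longlongrightarrow> 0) (at_right 0)"
        by (rule filterlim_compose[OF tendsto_poly_times_exp_minus filterlim_inverse_at_top_right])
      moreover have "eventually (\<lambda>h::real. poly ([:0,1:] * P) (inverse h) * exp (- inverse h) =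
          exp_inv_poly ([:0,1:] * P) h) (at_right 0)"
        using eventually_at_right_less[of "0::real"]
        by (rule eventually_mono) (simp add: exp_inv_poly_def inverse_eq_divide)
      ultimately show ?thesis by (rule Lim_transform_eventually)
    qed
    moreover have "((\<lambda>h. exp_inv_poly ([:0,1:] * P) h) \<longlongrightarrow> 0) (at_left 0)"
      by (rule tendsto_eventually)
        (auto simp: exp_inv_poly_def eventually_at_left_field intro!: exI[of _ "-1"])
    ultimately have "((\<lambda>h. exp_inv_poly ([:0,1:] * P) h) \<longlongrightarrow> 0) (at 0)"
      by (simp add: filterlim_at_split)
    then have "((\<lambda>h. (exp_inv_poly P (0 + h) - exp_inv_poly P 0) / h) \<longlongrightarrow> 0) (at 0)"
      by (rule Lim_transform_eventually)
        (auto simp: exp_inv_poly_def eventually_at_filter)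
    then show ?thesis using 3 by (simp add: DERIV_def exp_inv_poly_def)
  qed
qed

lemma Ck_exp_inv_poly: "f \<in> Ck k UNIV \<Longrightarrow> (\<lambda>x. exp_inv_poly P (f x)) \<in> Ck k UNIV"
  by (rule Ck_compose[where D=UNIV and F=exp_inv_poly and d="\<lambda>P. [:0,0,1:] * (P - pderiv P)"])
    (auto simp only: exp_inv_poly_deriv)

section \<open>Test functions: supports, closure properties, bumps on boxes\<close>

lemma test_funI:
  assumes "\<And>k. f \<in> Ck k UNIV" "compact S" "S \<subseteq> \<Omega>" "\<And>x. x \<notin> S \<Longrightarrow> f x = 0"
  shows "test_fun \<Omega> f"
proof -
  have "closure {x. f x \<noteq> 0} \<subseteq> S"
    using assms(2,4) by (intro closure_minimal) (auto simp: compact_imp_closed)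
  moreover then have "compact (closure {x. f x \<noteq> 0})"
    using assms(2) by (metis closed_closure compact_Int_closed inf.absorb_iff2)
  ultimately show ?thesis using assms by (auto simp: test_fun_def smooth_on_def)
qed

lemma test_funE:
  assumes "test_fun \<Omega> f"
  obtains S where "compact S" "S \<subseteq> \<Omega>" "\<And>x. x \<notin> S \<Longrightarrow> f x = 0" "\<And>x i. x \<notin> S \<Longrightarrow> partial i f x = 0"
proof
  let ?S = "closure {x. f x \<noteq> 0}"
  show "compact ?S" "?S \<subseteq> \<Omega>" using assms by (auto simp: test_fun_def)
  show z: "f x = 0" if "x \<notin> ?S" for x using that closure_subset[of "{x. f x \<noteq> 0}"] by auto
  show "partial i f x = 0" if "x \<notin> ?S" for x i
  proof -
    have "(f has_derivative (\<lambda>h. 0)) (at x)"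
    proof (rule has_derivative_transform_within_open[of "\<lambda>x. 0" _ x UNIV "- ?S"])
      show "((\<lambda>x. 0) has_derivative (\<lambda>h. 0)) (at x)" by simp
      show "open (- ?S)" by (intro open_Compl closed_closure)
      show "x \<in> - ?S" using that by simp
      show "0 = f y" if "y \<in> - ?S" for y using z[of y] that by simp
    qed
    then show ?thesis by (simp add: partial_eqI)
  qed
qed

lemma test_fun_Ck: "test_fun \<Omega> f \<Longrightarrow> f \<in> Ck k UNIV"
  by (auto simp: test_fun_def smooth_on_def)

lemma test_fun_differentiable: "test_fun \<Omega> f \<Longrightarrow> f differentiable (at x)"
  using test_fun_Ck[of \<Omega> f 1] by (simp add: Ck_Suc_iff[of _ 0, simplified])

lemma test_fun_continuous: "test_fun \<Omega> f \<Longrightarrow> continuous_on A f"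
  using test_fun_Ck[of \<Omega> f 0] continuous_on_subset by auto

lemma test_fun_partial: 
  assumes "test_fun \<Omega> f" shows "test_fun \<Omega> (partial i f)"
proof -
  from assms obtain S where S: "compact S" "S \<subseteq> \<Omega>" "\<And>x. x \<notin> S \<Longrightarrow> f x = 0" "\<And>x i. x \<notin> S \<Longrightarrow> partial i f x = 0"
    using test_funE[of \<Omega> f] by metis
  show ?thesis
    using test_fun_Ck[OF assms, of "Suc _"]
    by (intro test_funI[OF _ S(1,2,4)]) (auto simp: Ck_Suc_iff simp del: Ck.simps)
qed

lemma test_fun_mult:
  assumes "test_fun \<Omega> f" "\<And>k. g \<in> Ck k UNIV" shows "test_fun \<Omega> (\<lambda>x. f x * g x)"
proof -
  from assms(1) obtain S where S: "compact S" "S \<subseteq> \<Omega>" "\<And>x. x \<notin> S \<Longrightarrow> f x = 0" "\<And>x i. x \<notin> S \<Longrightarrow> partial i f x = 0"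
    using test_funE[of \<Omega> f] by metis
  show ?thesis
    by (rule test_funI[OF _ S(1,2)]) (auto intro!: Ck_mult test_fun_Ck[OF assms(1)] assms(2) simp: S)
qed

lemma test_fun_add:
  assumes "test_fun \<Omega> f" "test_fun \<Omega> g" shows "test_fun \<Omega> (\<lambda>x. f x + g x)"
proof -
  from assms(1) obtain S where S: "compact S" "S \<subseteq> \<Omega>" "\<And>x. x \<notin> S \<Longrightarrow> f x = 0" "\<And>x i. x \<notin> S \<Longrightarrow> partial i f x = 0"
    using test_funE[of \<Omega> f] by metis
  from assms(2) obtain T where T: "compact T" "T \<subseteq> \<Omega>" "\<And>x. x \<notin> T \<Longrightarrow> g x = 0" "\<And>x i. x \<notin> T \<Longrightarrow> partial i g x = 0"
    using test_funE[of \<Omega> g] by metis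
  show ?thesis
    by (rule test_funI[of _ "S \<union> T"]) (use S T in \<open>auto intro!: Ck_add test_fun_Ck[OF assms(1)] test_fun_Ck[OF assms(2)]\<close>)
qed

lemma test_fun_cmult: "test_fun \<Omega> f \<Longrightarrow> test_fun \<Omega> (\<lambda>x. c * f x)"
  using test_fun_mult[of \<Omega> f "\<lambda>x. c"] by (simp add: Ck_const mult.commute)

lemma test_fun_zero: "test_fun \<Omega> (\<lambda>x. 0)"
  by (rule test_funI[of _ "{}"]) (auto intro: Ck_const)

lemma cgrad_add:
  "test_fun \<Omega> f \<Longrightarrow> test_fun \<Omega> g \<Longrightarrow> cgrad (\<lambda>x. f x + g x) x = cgrad f x + cgrad g x"
  by (simp add: vec_eq_iff partial_add test_fun_differentiable)

lemma cgrad_cmult: "test_fun \<Omega> f \<Longrightarrow> cgrad (\<lambda>x. c * f x) x = c *\<^sub>R cgrad f x"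
  by (simp add: vec_eq_iff partial_mult test_fun_differentiable partial_const)

text \<open>The growing factor drives each cutoff exp(-1/((n+1) s)) to 1 for s > 0, so the bumps
  tend to the indicator of the open box while all of them vanish off the same closed box.\<close>

definition box_bump :: "R3 \<Rightarrow> R3 \<Rightarrow> nat \<Rightarrow> R3 \<Rightarrow> real" where
  "box_bump a b n x = (\<Prod>i\<in>UNIV. exp_inv_poly 1 (real (Suc n) * (x $ i - a $ i)) *
      exp_inv_poly 1 (real (Suc n) * (b $ i - x $ i)))"

lemma test_fun_box_bump:
  assumes "cbox a b \<subseteq> \<Omega>" shows "test_fun \<Omega> (box_bump a b n)"
proof (rule test_funI[OF _ compact_cbox assms])
  have *: "(\<lambda>x. c * (x $ i) + e) \<in> Ck k UNIV" for c e :: real and i :: 3 and k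
    by (intro Ck_add Ck_mult Ck_const Ck_component)
  have "(\<lambda>x. real (Suc n) * (x $ i - a $ i)) \<in> Ck k UNIV"
       "(\<lambda>x. real (Suc n) * (b $ i - x $ i)) \<in> Ck k UNIV" for i k
    using *[of "real (Suc n)" i "- real (Suc n) * a $ i" k] *[of "- real (Suc n)" i "real (Suc n) * b $ i" k]
    by (simp_all add: algebra_simps)
  then show "box_bump a b n \<in> Ck k UNIV" for k
    unfolding box_bump_def[abs_def]
    by - (rule Ck_prod[OF finite], rule Ck_mult[OF Ck_exp_inv_poly Ck_exp_inv_poly])
  fix x assume "x \<notin> cbox a b"
  then obtain i where "x $ i < a $ i \<or> b $ i < x $ i"
    by (auto simp: mem_box_cart not_le)
  then have "exp_inv_poly 1 (real (Suc n) * (x $ i - a $ i)) *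
      exp_inv_poly 1 (real (Suc n) * (b $ i - x $ i)) = 0"
    by (auto simp: exp_inv_poly_def zero_less_mult_iff)
  then show "box_bump a b n x = 0" 
    unfolding box_bump_def by (intro prod_zero) (auto intro: bexI[of _ i])
qed

lemma exp_inv_poly_1_bounds: "0 \<le> exp_inv_poly 1 t" "exp_inv_poly 1 t \<le> 1"
  by (auto simp: exp_inv_poly_def)

lemma box_bump_bounds: "0 \<le> box_bump a b n x" "box_bump a b n x \<le> 1"
  unfolding box_bump_def
  by (auto intro!: prod_nonneg prod_le_1 mult_nonneg_nonneg mult_le_one exp_inv_poly_1_bounds)

lemma box_bump_pos: "x \<in> box a b \<Longrightarrow> 0 < box_bump a b n x"
  unfolding box_bump_def by (auto intro!: prod_pos simp: exp_inv_poly_def mem_box_cart)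

lemma box_bump_tendsto: "(\<lambda>n. box_bump a b n x) \<longlonglongrightarrow> indicator (box a b) x"
proof -
  have e: "(\<lambda>n. exp_inv_poly 1 (real (Suc n) * t)) \<longlonglongrightarrow> (if t > 0 then 1 else 0)" for t
  proof (cases "t > 0")
    case True
    have "(\<lambda>n. exp (- ((1 / t) * (1 / real (Suc n))))) \<longlonglongrightarrow> exp (- ((1 / t) * 0))"
      by (intro tendsto_intros LIMSEQ_Suc lim_1_over_n)
    moreover have "exp_inv_poly 1 (real (Suc n) * t) = exp (- ((1 / t) * (1 / real (Suc n))))" for n
      using True by (simp add: exp_inv_poly_def mult.commute del: of_nat_Suc)
    ultimately show ?thesis using True by simp
  next
    case False
    then show ?thesis by (auto simp: exp_inv_poly_def zero_less_mult_iff not_less)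
  qed
  have "(\<lambda>n. box_bump a b n x) \<longlonglongrightarrow> (\<Prod>i\<in>UNIV. (if x $ i - a $ i > 0 then 1 else 0) * (if b $ i - x $ i > 0 then 1 else 0))"
    unfolding box_bump_def by (intro tendsto_intros e)
  also have "(\<Prod>i\<in>UNIV. (if x $ i - a $ i > 0 then 1 else 0) * (if b $ i - x $ i > 0 then 1 else 0)) = (indicator (box a b) x :: real)"
    by (auto simp: indicator_def mem_box_cart intro!: prod.neutral prod_zero)
  finally show ?thesis .
qed

section \<open>Integral inequalities for test functions\<close>

lemma test_fun_bound:
  assumes "test_fun \<Omega> f"
  obtains B where "\<And>x. \<bar>f x\<bar> \<le> B"
proof -
  obtain S where S: "compact S" "\<And>x. x \<notin> S \<Longrightarrow> f x = 0"
    using test_funE[OF assms] by metis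
  have "bounded (f ` S)"
    by (intro compact_imp_bounded compact_continuous_image test_fun_continuous[OF assms] S)
  then obtain B where "\<And>x. x \<in> S \<Longrightarrow> \<bar>f x\<bar> \<le> B" by (auto simp: bounded_iff)
  then have "\<bar>f x\<bar> \<le> max B 0" for x using S(2)[of x] by (cases "x \<in> S") (auto simp: le_max_iff_disj)
  then show ?thesis using that by blast
qed

lemma test_fun_borel [measurable]: "test_fun \<Omega> f \<Longrightarrow> f \<in> borel_measurable borel"
  by (intro borel_measurable_continuous_onI test_fun_continuous)

lemma test_fun_integrable:
  assumes "test_fun \<Omega> f" shows "integrable lborel f"
proof -
  obtain S where S: "compact S" "\<And>x. x \<notin> S \<Longrightarrow> f x = 0"
    using test_funE[OF assms] by metis
  have "integrable lborel (\<lambda>x. indicator S x *\<^sub>R f x)"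
    by (intro borel_integrable_compact S test_fun_continuous[OF assms])
  also have "(\<lambda>x. indicator S x *\<^sub>R f x) = f"
    using S(2) by (auto simp: fun_eq_iff indicator_def)
  finally show ?thesis .
qed

lemma has_derivative_along_axis:
  assumes "test_fun \<Omega> f"
  shows "((\<lambda>s. f (a + s *\<^sub>R axis i 1)) has_real_derivative partial i f (a + s *\<^sub>R axis i 1)) (at s)"
proof -
  let ?f' = "frechet_derivative f (at (a + s *\<^sub>R axis i 1))"
  have f': "(f has_derivative ?f') (at (a + s *\<^sub>R axis i 1))"
    using test_fun_differentiable[OF assms] frechet_derivative_works by blast
  have "((\<lambda>s. a + s *\<^sub>R axis i 1) has_derivative (\<lambda>h. h *\<^sub>R axis i (1::real))) (at s)"
    by (auto intro!: derivative_eq_intros)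
  from has_derivative_compose[OF this f']
  have "((\<lambda>s. f (a + s *\<^sub>R axis i 1)) has_derivative (\<lambda>h. ?f' (h *\<^sub>R axis i 1))) (at s)" .
  moreover have "?f' (h *\<^sub>R axis i 1) = partial i f (a + s *\<^sub>R axis i 1) * h" for h
    using linear_scale[OF has_derivative_linear[OF f'], of h "axis i 1"]
    by (simp add: partial_def mult.commute)
  ultimately show ?thesis by (simp add: has_field_derivative_def)
qed

lemma lborel_integral_translation:
  fixes f :: "'a::euclidean_space \<Rightarrow> real"
  assumes "f \<in> borel_measurable borel"
  shows "(\<integral>x. f (x + c) \<partial>lborel) = (\<integral>x. f x \<partial>lborel)"
proof -
  have "(\<integral>x. f x \<partial>lborel) = (\<integral>x. f x \<partial>distr lborel borel ((+) c))"
    by (simp add: lborel_distr_plus)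
  also have "\<dots> = (\<integral>x. f (c + x) \<partial>lborel)"
    using assms by (subst integral_distr) auto
  finally show ?thesis by (simp add: add.commute)
qed

lemma lborel_integrable_translation:
  fixes f :: "'a::euclidean_space \<Rightarrow> real"
  assumes "integrable lborel f"
  shows "integrable lborel (\<lambda>x. f (x + c))"
proof -
  have "integrable (distr lborel borel ((+) c)) f" using assms by (simp add: lborel_distr_plus)
  then show ?thesis using assms by (subst (asm) integrable_distr_eq) (auto simp: add.commute)
qed

text \<open>Difference quotients have integral zero by translation invariance.\<close>
lemma integral_partial_eq_0:
  assumes f: "test_fun \<Omega> f"
  shows "(\<integral>x. partial i f x \<partial>lborel) = 0"
proof -
  define e :: R3 where "e = axis i 1"
  define t where "t = (\<lambda>n. 1 / real (Suc n))"
  have t: "0 < t n" "t n \<le> 1" for n by (auto simp: t_def)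
  have t0: "t \<longlonglongrightarrow> 0" unfolding t_def by (rule LIMSEQ_Suc[OF lim_1_over_n])
  obtain S where S: "compact S" "\<And>x. x \<notin> S \<Longrightarrow> f x = 0"
    using test_funE[OF f] by metis
  obtain R where R: "\<And>x. x \<in> S \<Longrightarrow> norm x \<le> R"
    using compact_imp_bounded[OF S(1)] by (auto simp: bounded_iff)
  obtain B where B: "\<And>x. \<bar>partial i f x\<bar> \<le> B"
    using test_fun_bound[OF test_fun_partial[OF f]] by metis
  have d: "((\<lambda>s. f (x + s *\<^sub>R e)) has_real_derivative partial i f (x + s *\<^sub>R e)) (at s)" for x s
    unfolding e_def by (rule has_derivative_along_axis[OF f])
  define s where "s = (\<lambda>n x. (f (x + t n *\<^sub>R e) - f x) / t n)"
  \<comment> \<open>By the mean value theorem the quotients are bounded by \<open>B\<close>, and as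
    the increments are at most 1 they vanish outside the ball of radius R + 1; this gives the
    integrable majorant.\<close>
  have "(\<lambda>n. \<integral>x. s n x \<partial>lborel) \<longlonglongrightarrow> (\<integral>x. partial i f x \<partial>lborel)"
  proof (rule integral_dominated_convergence[where w="\<lambda>x. indicator (cball 0 (R + 1)) x * B"])
    show "partial i f \<in> borel_measurable lborel" using test_fun_borel[OF test_fun_partial[OF f]] by simp
    show "s n \<in> borel_measurable lborel" for n
      using test_fun_borel[OF f] unfolding s_def by measurable
    show "integrable lborel (\<lambda>x::R3. indicator (cball 0 (R + 1)) x * B)"
      using emeasure_compact_finite[OF compact_cball]
      by (intro integrable_mult_left integrable_real_indicator) auto
    show "AE x in lborel. (\<lambda>n. s n x) \<longlonglongrightarrow> partial i f x"
    proof (rule AE_I2)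
      fix x
      have "((\<lambda>h. (f (x + h *\<^sub>R e) - f x) / h) \<longlongrightarrow> partial i f x) (at 0)"
        using d[of x 0] by (simp add: DERIV_def)
      moreover have "filterlim t (at 0) sequentially"
        using t0 t(1) by (auto simp: filterlim_at intro!: always_eventually) (metis less_irrefl)
      ultimately show "(\<lambda>n. s n x) \<longlonglongrightarrow> partial i f x"
        unfolding s_def by (rule filterlim_compose)
    qed
    show "AE x in lborel. norm (s n x) \<le> indicator (cball 0 (R + 1)) x * B" for n
    proof (rule AE_I2)
      fix x
      obtain z where z: "f (x + t n *\<^sub>R e) - f (x + 0 *\<^sub>R e) = (t n - 0) * partial i f (x + z *\<^sub>R e)"
        using MVT2[OF t(1)[of n] d[of x]] by blast
      then have *: "\<bar>s n x\<bar> \<le> B" using t(1)[of n] B by (simp add: s_def)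
      show "norm (s n x) \<le> indicator (cball 0 (R + 1)) x * B"
      proof (cases "norm x \<le> R + 1")
        case False
        then have "x \<notin> S" using R[of x] by auto
        moreover have "norm x \<le> norm (x + t n *\<^sub>R e) + norm (t n *\<^sub>R e)"
          by (metis add_diff_cancel_right' norm_triangle_ineq4)
        then have "norm (x + t n *\<^sub>R e) > R" using False t[of n] by (simp add: e_def)
        then have "x + t n *\<^sub>R e \<notin> S" using R by force
        ultimately show ?thesis using S(2) False by (simp add: s_def)
      qed (use * in simp)
    qed
  qed
  moreover have "(\<integral>x. s n x \<partial>lborel) = 0" for n
    using test_fun_integrable[OF f] lborel_integrable_translation[OF test_fun_integrable[OF f], of "t n *\<^sub>R e"]
      lborel_integral_translation[OF test_fun_borel[OF f], of "t n *\<^sub>R e"]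
    by (simp add: s_def)
  ultimately show ?thesis by (simp add: LIMSEQ_const_iff)
qed

lemma test_fun_power: "test_fun \<Omega> f \<Longrightarrow> test_fun \<Omega> (\<lambda>x. f x ^ Suc n)"
  by (induction n) (auto intro: test_fun_mult[of \<Omega> f "\<lambda>x. _ x", simplified] test_fun_Ck test_fun_mult)

lemma test_fun_square: "test_fun \<Omega> f \<Longrightarrow> test_fun \<Omega> (\<lambda>x. (f x)\<^sup>2)"
  using test_fun_power[of \<Omega> f 1] by (simp add: numeral_2_eq_2)

lemma cgrad_norm_sq: "(norm (cgrad f x))\<^sup>2 = (\<Sum>i\<in>UNIV. (partial i f x)\<^sup>2)"
  by (simp add: norm_vec_def L2_set_def sum_nonneg)

lemma test_fun_cgrad_norm_sq: 
  assumes "test_fun \<Omega> f" shows "test_fun \<Omega> (\<lambda>x. (norm (cgrad f x))\<^sup>2)"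
proof -
  show ?thesis unfolding cgrad_norm_sq sum_3
    by (intro test_fun_add test_fun_square test_fun_partial assms)
qed

text \<open>Integrate the first partial derivative of \<open>x\<^sub>1 f\<^sup>2\<close>.\<close>
lemma poincare_test_fun:
  assumes f: "test_fun \<Omega> f" and R: "\<And>x. x \<in> \<Omega> \<Longrightarrow> norm x \<le> R"
  shows "(\<integral>x. (f x)\<^sup>2 \<partial>lborel) \<le> 4 * R\<^sup>2 * (\<integral>x. (norm (cgrad f x))\<^sup>2 \<partial>lborel)"
proof -
  have f2: "test_fun \<Omega> (\<lambda>x. (f x)\<^sup>2)" by (rule test_fun_square[OF f])
  have g: "test_fun \<Omega> (\<lambda>x. (f x)\<^sup>2 * x $ 1)"
    by (rule test_fun_mult[OF f2 Ck_component])
  have d: "partial 1 (\<lambda>x. (f x)\<^sup>2 * x $ 1) x = (f x)\<^sup>2 + 2 * f x * partial 1 f x * x $ 1" for x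
  proof -
    have fd: "f differentiable (at x)" by (rule test_fun_differentiable[OF f])
    have c: "(\<lambda>x::R3. x $ 1) differentiable (at x)" 
      using has_derivative_component by (auto simp: differentiable_def)
    show ?thesis
      using fd c by (simp add: partial_mult power2_eq_square differentiable_mult partial_component)
  qed
  \<comment> \<open>Young's inequality -2 f x_1 D_1 f <= f^2/2 + 2 x_1^2 (D_1 f)^2 leaves half of
    f^2 to be absorbed on the left, which produces the final factor 4 R^2.\<close>
  have ineq: "(f x)\<^sup>2 \<le> partial 1 (\<lambda>x. (f x)\<^sup>2 * x $ 1) x + ((f x)\<^sup>2 / 2 + 2 * R\<^sup>2 * (norm (cgrad f x))\<^sup>2)" for x
  proof (cases "x \<in> \<Omega>")
    case True
    have "\<bar>x $ 1\<bar> \<le> R" using R[OF True] component_le_norm_cart[of x 1] by linarith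
    then have "(x $ 1)\<^sup>2 \<le> R\<^sup>2" by (metis abs_ge_zero power2_abs power_mono)
    moreover have "(partial 1 f x)\<^sup>2 \<le> (norm (cgrad f x))\<^sup>2" unfolding cgrad_norm_sq sum_3 by simp
    ultimately have "(x $ 1)\<^sup>2 * (partial 1 f x)\<^sup>2 \<le> R\<^sup>2 * (norm (cgrad f x))\<^sup>2"
      by (intro mult_mono) auto
    moreover have "0 \<le> (f x / 2 + 1 * (x $ 1 * partial 1 f x))\<^sup>2" by simp
    ultimately show ?thesis unfolding d by (simp add: power2_eq_square algebra_simps)
  next
    case False
    then have "f x = 0" using test_funE[OF f] by (metis subsetD)
    then show ?thesis unfolding d by simp
  qed
  have i: "integrable lborel (\<lambda>x. (f x)\<^sup>2)" "integrable lborel (\<lambda>x. (norm (cgrad f x))\<^sup>2)"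
    "integrable lborel (partial 1 (\<lambda>x. (f x)\<^sup>2 * x $ 1))"
    using test_fun_integrable[OF f2] test_fun_integrable[OF test_fun_cgrad_norm_sq[OF f]]
      test_fun_integrable[OF test_fun_partial[OF g]] by auto
  have "(\<integral>x. (f x)\<^sup>2 \<partial>lborel) \<le> (\<integral>x. partial 1 (\<lambda>x. (f x)\<^sup>2 * x $ 1) x + ((f x)\<^sup>2 / 2 + 2 * R\<^sup>2 * (norm (cgrad f x))\<^sup>2) \<partial>lborel)"
    by (rule integral_mono) (use i ineq in auto)
  also have "\<dots> = (\<integral>x. (f x)\<^sup>2 \<partial>lborel) / 2 + 2 * R\<^sup>2 * (\<integral>x. (norm (cgrad f x))\<^sup>2 \<partial>lborel)"
    using i integral_partial_eq_0[OF g, of 1] by (subst Bochner_Integration.integral_add) auto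
  finally show ?thesis by simp
qed

section \<open>Fubini in coordinates and the L^4 estimate\<close>

definition vec3 :: "real \<Rightarrow> real \<Rightarrow> real \<Rightarrow> R3" where
  "vec3 x y z = x *\<^sub>R axis 1 1 + y *\<^sub>R axis 2 1 + z *\<^sub>R axis 3 1"

lemma vec3_nth [simp]: "vec3 x y z $ 1 = x" "vec3 x y z $ 2 = y" "vec3 x y z $ 3 = z"
  by (auto simp: vec3_def axis_def)

lemma measurable_vec3 [measurable]:
  assumes [measurable]: "f \<in> borel_measurable M" "g \<in> borel_measurable M" "h \<in> borel_measurable M"
  shows "(\<lambda>x. vec3 (f x) (g x) (h x)) \<in> borel_measurable M"
  unfolding vec3_def by measurable

text \<open>Lebesgue measure is determined by the volumes of boxes. The triple is ordered (z, y, x)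
  so that iterated integrals have z outermost, ready for slicing by planes z = const.\<close>

lemma lborel_R3_eq_distr:
  "(lborel :: R3 measure) = distr (lborel \<Otimes>\<^sub>M (lborel \<Otimes>\<^sub>M lborel)) borel (\<lambda>(z, y, x). vec3 x y z)"
proof (rule lborel_eqI)
  fix l u :: R3
  assume "\<And>b. b \<in> Basis \<Longrightarrow> l \<bullet> b \<le> u \<bullet> b"
  then have lu: "l $ i \<le> u $ i" for i
    by (simp add: Basis_vec_def inner_axis) (metis inner_axis inner_real_def mult.right_neutral)
  have m: "(\<lambda>(z, y, x). vec3 x y z) \<in> borel_measurable (lborel \<Otimes>\<^sub>M (lborel \<Otimes>\<^sub>M lborel))"
    by measurable
  have "(\<lambda>(z, y, x). vec3 x y z) -` box l u \<inter> space (lborel \<Otimes>\<^sub>M (lborel \<Otimes>\<^sub>M lborel)) =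
     {l$3<..<u$3} \<times> ({l$2<..<u$2} \<times> {l$1<..<u$1})"
    by (auto simp: mem_box_cart forall_3 space_pair_measure)
  then have "emeasure (distr (lborel \<Otimes>\<^sub>M (lborel \<Otimes>\<^sub>M lborel)) borel (\<lambda>(z, y, x). vec3 x y z)) (box l u)
    = emeasure (lborel \<Otimes>\<^sub>M (lborel \<Otimes>\<^sub>M lborel)) ({l$3<..<u$3} \<times> ({l$2<..<u$2} \<times> {l$1<..<u$1}))"
    using m by (subst emeasure_distr) (auto simp: borel_open)
  also have "\<dots> = ennreal (u$3 - l$3) * (ennreal (u$2 - l$2) * ennreal (u$1 - l$1))"
    using lu by (simp add: lborel_pair.P.emeasure_pair_measure_Times lborel.emeasure_pair_measure_Times)
  also have "\<dots> = ennreal (\<Prod>i\<in>UNIV. (u - l) $ i)"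
  proof -
    have "(\<Prod>i\<in>UNIV. (u - l) $ i) = (u$3 - l$3) * ((u$2 - l$2) * (u$1 - l$1))"
      unfolding UNIV_3 by simp
    then show ?thesis using lu by (simp only: ennreal_mult diff_ge_0_iff_ge mult_nonneg_nonneg)
  qed
  also have "(\<Prod>i\<in>UNIV. (u - l) $ i) = (\<Prod>b\<in>Basis. (u - l) \<bullet> b)"
  proof -
    have B: "Basis = range (\<lambda>i::3. axis i (1::real))" by (auto simp: Basis_vec_def)
    have "inj (\<lambda>i::3. axis i (1::real))" by (auto simp: inj_def axis_eq_axis)
    from prod.reindex[OF this, of "\<lambda>b. (u - l) \<bullet> b"] show ?thesis unfolding B by (simp add: inner_axis)
  qed
  finally show "emeasure (distr (lborel \<Otimes>\<^sub>M (lborel \<Otimes>\<^sub>M lborel)) borel (\<lambda>(z, y, x). vec3 x y z)) (box l u)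
    = (\<Prod>b\<in>Basis. (u - l) \<bullet> b)" .
qed simp

lemma nn_integral_R3:
  assumes [measurable]: "F \<in> borel_measurable borel"
  shows "(\<integral>\<^sup>+p. F p \<partial>(lborel :: R3 measure)) = (\<integral>\<^sup>+z. \<integral>\<^sup>+y. \<integral>\<^sup>+x. F (vec3 x y z) \<partial>lborel \<partial>lborel \<partial>lborel)"
proof -
  have [measurable]: "(\<lambda>(z, y, x). vec3 x y z) \<in> borel_measurable (lborel \<Otimes>\<^sub>M (lborel \<Otimes>\<^sub>M lborel))"
    by measurable
  have "(\<integral>\<^sup>+p. F p \<partial>(lborel :: R3 measure)) =
      (\<integral>\<^sup>+q. F (case q of (z, y, x) \<Rightarrow> vec3 x y z) \<partial>(lborel \<Otimes>\<^sub>M (lborel \<Otimes>\<^sub>M lborel)))"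
    by (subst lborel_R3_eq_distr, subst nn_integral_distr) auto
  also have "\<dots> = (\<integral>\<^sup>+z. \<integral>\<^sup>+q. F (case q of (y, x) \<Rightarrow> vec3 x y z) \<partial>(lborel \<Otimes>\<^sub>M lborel) \<partial>lborel)"
    by (subst lborel_pair.P.nn_integral_fst[symmetric]) auto
  also have "\<dots> = (\<integral>\<^sup>+z. \<integral>\<^sup>+y. \<integral>\<^sup>+x. F (vec3 x y z) \<partial>lborel \<partial>lborel \<partial>lborel)"
    by (intro nn_integral_cong, subst lborel.nn_integral_fst[symmetric]) auto
  finally show ?thesis .
qed

text \<open>Fundamental theorem of calculus for f^2 along the line, started beyond the support. The
  integral runs over the whole line and so does not depend on t; this independence is what makes the
  slice integrals factorise later.\<close>

lemma square_le_nn_integral_line: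
  assumes f: "test_fun \<Omega> f"
  shows "ennreal ((f (a + t *\<^sub>R axis i 1))\<^sup>2) \<le>
    (\<integral>\<^sup>+s. ennreal (2 * \<bar>f (a + s *\<^sub>R axis i 1)\<bar> * \<bar>partial i f (a + s *\<^sub>R axis i 1)\<bar>) \<partial>lborel)"
proof -
  define e :: R3 where "e = axis i 1"
  define G where "G = (\<lambda>s. 2 * f (a + s *\<^sub>R e) * partial i f (a + s *\<^sub>R e))"
  obtain S where S: "compact S" "\<And>x. x \<notin> S \<Longrightarrow> f x = 0"
    using test_funE[OF f] by metis
  obtain R where R: "\<And>x. x \<in> S \<Longrightarrow> norm x \<le> R"
    using compact_imp_bounded[OF S(1)] by (auto simp: bounded_iff)
  \<comment> \<open>Far enough out for the point a + b e to leave the ball of radius R that contains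
    the support, and with b <= t.\<close>
  define b where "b = - (\<bar>R\<bar> + norm a + 1 + \<bar>t\<bar>)"
  have "norm (b *\<^sub>R e) \<le> norm (a + b *\<^sub>R e) + norm a"
    by (metis add_diff_cancel_left' add.commute norm_triangle_ineq4)
  then have "norm (a + b *\<^sub>R e) > R" by (simp add: e_def b_def)
  then have fb: "f (a + b *\<^sub>R e) = 0" using S(2) R by force
  have bt: "b \<le> t" by (simp add: b_def) (smt (verit) norm_ge_zero)
  have d: "((\<lambda>s. (f (a + s *\<^sub>R e))\<^sup>2) has_real_derivative G s) (at s)" for s
    using has_derivative_along_axis[OF f, of a i s] unfolding G_def e_def
    by (auto intro!: derivative_eq_intros)
  have Gc: "isCont G s" for s
  proof -
    have "continuous_on UNIV f" "continuous_on UNIV (partial i f)"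
      by (rule test_fun_continuous[OF f], rule test_fun_continuous[OF test_fun_partial[OF f]])
    moreover have "continuous_on UNIV (\<lambda>s. a + s *\<^sub>R e)" by (intro continuous_intros)
    ultimately have "continuous_on UNIV (\<lambda>s. f (a + s *\<^sub>R e))" "continuous_on UNIV (\<lambda>s. partial i f (a + s *\<^sub>R e))"
      by (auto intro: continuous_on_compose2[of UNIV f] continuous_on_compose2[of UNIV "partial i f"])
    then have "continuous_on UNIV G" unfolding G_def by (intro continuous_on_mult continuous_on_const)
    then show ?thesis by (simp add: continuous_on_eq_continuous_at)
  qed
  have *: "(f (a + t *\<^sub>R e))\<^sup>2 = (\<integral>s. G s * indicator {b..t} s \<partial>lborel)"
    using integral_FTC_Icc_real[OF bt, of "\<lambda>s. (f (a + s *\<^sub>R e))\<^sup>2" G] d Gc fb by simp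
  have "ennreal ((f (a + t *\<^sub>R e))\<^sup>2) \<le> ennreal (norm (\<integral>s. G s * indicator {b..t} s \<partial>lborel))"
    unfolding * by (intro ennreal_leI) simp
  also have "\<dots> \<le> (\<integral>\<^sup>+s. ennreal (norm (G s * indicator {b..t} s)) \<partial>lborel)"
  proof (rule integral_norm_bound_ennreal)
    have "integrable lborel (\<lambda>s. indicator {b..t} s *\<^sub>R G s)"
      by (intro borel_integrable_compact) (auto intro: continuous_at_imp_continuous_on Gc)
    then show "integrable lborel (\<lambda>s. G s * indicator {b..t} s)" by (simp add: mult.commute)
  qed
  also have "\<dots> \<le> (\<integral>\<^sup>+s. ennreal (2 * \<bar>f (a + s *\<^sub>R e)\<bar> * \<bar>partial i f (a + s *\<^sub>R e)\<bar>) \<partial>lborel)"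
    by (intro nn_integral_mono ennreal_leI) (auto simp: G_def abs_mult indicator_def)
  finally show ?thesis by (simp add: e_def)
qed

lemma ennreal_mult_le_squares: "(a::ennreal) * b \<le> a\<^sup>2 + b\<^sup>2"
proof (cases "a \<le> b")
  case True
  then have "a * b \<le> b * b" by (intro mult_right_mono) auto
  then show ?thesis by (simp add: power2_eq_square add_increasing)
next
  case False
  then have "a * b \<le> a * a" by (intro mult_left_mono) auto
  then show ?thesis by (simp add: power2_eq_square add_increasing2)
qed

text \<open>Ladyzhenskaya's slicing argument: bound \<open>f\<^sup>2\<close> on each slice \<open>z = const\<close> by its integrals along
  the two coordinate directions, and the slice norms of \<open>f\<close> by integrating along the third.\<close>
lemma ladyzhenskaya:
  assumes f: "test_fun \<Omega> f"
  shows "(\<integral>\<^sup>+p. ennreal ((f p)^4) \<partial>lborel) \<le>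
    4 * (\<integral>\<^sup>+p. ennreal ((f p)\<^sup>2 + (partial 3 f p)\<^sup>2) \<partial>lborel) *
      ((\<integral>\<^sup>+p. ennreal ((partial 1 f p)\<^sup>2) \<partial>lborel) + (\<integral>\<^sup>+p. ennreal ((partial 2 f p)\<^sup>2) \<partial>lborel))"
proof -
  note [measurable] = test_fun_borel[OF f] test_fun_borel[OF test_fun_partial[OF f]]
  define G where "G = (\<lambda>i p. ennreal (2 * \<bar>f p\<bar> * \<bar>partial i f p\<bar>))"
  have [measurable]: "G i \<in> borel_measurable borel" for i unfolding G_def by measurable
  define Q where "Q = (\<lambda>i z. \<integral>\<^sup>+y. \<integral>\<^sup>+x. G i (vec3 x y z) \<partial>lborel \<partial>lborel)"
  define \<sigma> where "\<sigma> = (\<lambda>z. \<integral>\<^sup>+y. \<integral>\<^sup>+x. ennreal ((f (vec3 x y z))\<^sup>2) \<partial>lborel \<partial>lborel)"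
  define \<alpha> where "\<alpha> = (\<lambda>i z. \<integral>\<^sup>+y. \<integral>\<^sup>+x. ennreal ((partial i f (vec3 x y z))\<^sup>2) \<partial>lborel \<partial>lborel)"
  have lines:
    "ennreal ((f (vec3 x y z))\<^sup>2) \<le> (\<integral>\<^sup>+x. G 1 (vec3 x y z) \<partial>lborel)"
    "ennreal ((f (vec3 x y z))\<^sup>2) \<le> (\<integral>\<^sup>+y. G 2 (vec3 x y z) \<partial>lborel)"
    "ennreal ((f (vec3 x y z))\<^sup>2) \<le> (\<integral>\<^sup>+z. G 3 (vec3 x y z) \<partial>lborel)" for x y z
    using square_le_nn_integral_line[OF f, of "vec3 0 y z" x 1]
      square_le_nn_integral_line[OF f, of "vec3 x 0 z" y 2]
      square_le_nn_integral_line[OF f, of "vec3 x y 0" z 3]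
    by (simp_all add: vec3_def G_def algebra_simps)
  \<comment> \<open>Cauchy-Schwarz on the slice at height z; the factor 2 stays with f, hence the
    4.\<close>
  have CS: "(Q i z)\<^sup>2 \<le> 4 * \<sigma> z * \<alpha> i z" for i z
  proof -
    have "Q i z = (\<integral>\<^sup>+q. G i (vec3 (snd q) (fst q) z) \<partial>(lborel \<Otimes>\<^sub>M lborel))"
      unfolding Q_def by (subst lborel.nn_integral_fst[symmetric]) auto
    also have "\<dots> = (\<integral>\<^sup>+q. ennreal (2 * \<bar>f (vec3 (snd q) (fst q) z)\<bar>) * ennreal \<bar>partial i f (vec3 (snd q) (fst q) z)\<bar>
        \<partial>(lborel \<Otimes>\<^sub>M lborel))"
      by (simp add: G_def ennreal_mult)
    also have "\<dots>\<^sup>2 \<le> (\<integral>\<^sup>+q. (ennreal (2 * \<bar>f (vec3 (snd q) (fst q) z)\<bar>))\<^sup>2 \<partial>(lborel \<Otimes>\<^sub>M lborel)) *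
       (\<integral>\<^sup>+q. (ennreal \<bar>partial i f (vec3 (snd q) (fst q) z)\<bar>)\<^sup>2 \<partial>(lborel \<Otimes>\<^sub>M lborel))"
      by (rule Cauchy_Schwarz_nn_integral) auto
    also have "(\<integral>\<^sup>+q. (ennreal (2 * \<bar>f (vec3 (snd q) (fst q) z)\<bar>))\<^sup>2 \<partial>(lborel \<Otimes>\<^sub>M lborel)) = 4 * \<sigma> z"
    proof -
      have "(\<integral>\<^sup>+q. (ennreal (2 * \<bar>f (vec3 (snd q) (fst q) z)\<bar>))\<^sup>2 \<partial>(lborel \<Otimes>\<^sub>M lborel))
         = (\<integral>\<^sup>+q. 4 * ennreal ((f (vec3 (snd q) (fst q) z))\<^sup>2) \<partial>(lborel \<Otimes>\<^sub>M lborel))"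
        by (simp add: ennreal_power power_mult_distrib ennreal_mult)
      also have "\<dots> = 4 * (\<integral>\<^sup>+q. ennreal ((f (vec3 (snd q) (fst q) z))\<^sup>2) \<partial>(lborel \<Otimes>\<^sub>M lborel))"
        by (rule nn_integral_cmult) simp
      also have "\<dots> = 4 * \<sigma> z"
        unfolding \<sigma>_def by (subst lborel.nn_integral_fst[symmetric]) auto
      finally show ?thesis .
    qed
    also have "(\<integral>\<^sup>+q. (ennreal \<bar>partial i f (vec3 (snd q) (fst q) z)\<bar>)\<^sup>2 \<partial>(lborel \<Otimes>\<^sub>M lborel)) = \<alpha> i z"
      unfolding \<alpha>_def by (subst lborel.nn_integral_fst[symmetric]) (auto simp: ennreal_power)
    finally show ?thesis .
  qed
  have [measurable]: "\<sigma> \<in> borel_measurable borel" "\<alpha> i \<in> borel_measurable borel"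
      "Q i \<in> borel_measurable borel" for i
    unfolding \<sigma>_def \<alpha>_def Q_def by measurable
  define s where "s = (\<integral>\<^sup>+p. G 3 p \<partial>lborel)"
  \<comment> \<open>Bounding f^2 by its integral in direction 3 removes the dependence on z: all
    slice norms lie below the one number \<open>s\<close>.\<close>
  have \<sigma>: "\<sigma> z \<le> s" for z
  proof -
    have "\<sigma> z \<le> (\<integral>\<^sup>+y. \<integral>\<^sup>+x. \<integral>\<^sup>+z. G 3 (vec3 x y z) \<partial>lborel \<partial>lborel \<partial>lborel)"
      unfolding \<sigma>_def by (intro nn_integral_mono lines)
    also have "\<dots> = (\<integral>\<^sup>+y. \<integral>\<^sup>+z. \<integral>\<^sup>+x. G 3 (vec3 x y z) \<partial>lborel \<partial>lborel \<partial>lborel)"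
      by (intro nn_integral_cong lborel_pair.Fubini') measurable
    also have "\<dots> = (\<integral>\<^sup>+z. \<integral>\<^sup>+y. \<integral>\<^sup>+x. G 3 (vec3 x y z) \<partial>lborel \<partial>lborel \<partial>lborel)"
      by (intro lborel_pair.Fubini') measurable
    also have "\<dots> = s" unfolding s_def by (subst nn_integral_R3) auto
    finally show ?thesis .
  qed
  have "(\<integral>\<^sup>+p. ennreal ((f p)^4) \<partial>lborel) =
     (\<integral>\<^sup>+z. \<integral>\<^sup>+y. \<integral>\<^sup>+x. ennreal ((f (vec3 x y z))\<^sup>2) * ennreal ((f (vec3 x y z))\<^sup>2) \<partial>lborel \<partial>lborel \<partial>lborel)"
    by (subst nn_integral_R3) (auto simp: ennreal_mult[symmetric] power2_eq_square power4_eq_xxxx mult.assoc)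
  also have "\<dots> \<le> (\<integral>\<^sup>+z. \<integral>\<^sup>+y. \<integral>\<^sup>+x. (\<integral>\<^sup>+x. G 1 (vec3 x y z) \<partial>lborel) * (\<integral>\<^sup>+y. G 2 (vec3 x y z) \<partial>lborel)
       \<partial>lborel \<partial>lborel \<partial>lborel)"
    by (intro nn_integral_mono mult_mono lines) auto
  \<comment> \<open>The first factor is constant in x and the second in y, so the integral over a
    slice splits into a product.\<close>
  also have "\<dots> = (\<integral>\<^sup>+z. Q 1 z * (\<integral>\<^sup>+x. \<integral>\<^sup>+y. G 2 (vec3 x y z) \<partial>lborel \<partial>lborel) \<partial>lborel)"
    unfolding Q_def by (simp add: nn_integral_cmult nn_integral_multc)
  also have "\<dots> = (\<integral>\<^sup>+z. Q 1 z * Q 2 z \<partial>lborel)"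
    unfolding Q_def by (intro nn_integral_cong arg_cong2[where f="(*)"] refl lborel_pair.Fubini') measurable
  also have "\<dots> \<le> (\<integral>\<^sup>+z. 4 * s * (\<alpha> 1 z + \<alpha> 2 z) \<partial>lborel)"
  proof (rule nn_integral_mono)
    fix z
    have "Q 1 z * Q 2 z \<le> (Q 1 z)\<^sup>2 + (Q 2 z)\<^sup>2" by (rule ennreal_mult_le_squares)
    also have "\<dots> \<le> 4 * \<sigma> z * \<alpha> 1 z + 4 * \<sigma> z * \<alpha> 2 z" by (intro add_mono CS)
    also have "\<dots> \<le> 4 * s * \<alpha> 1 z + 4 * s * \<alpha> 2 z"
      by (intro add_mono mult_mono \<sigma>) auto
    finally show "Q 1 z * Q 2 z \<le> 4 * s * (\<alpha> 1 z + \<alpha> 2 z)" by (simp add: distrib_left)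
  qed
  also have "\<dots> = 4 * s * ((\<integral>\<^sup>+z. \<alpha> 1 z \<partial>lborel) + (\<integral>\<^sup>+z. \<alpha> 2 z \<partial>lborel))"
    by (simp add: nn_integral_cmult nn_integral_add)
  also have "(\<integral>\<^sup>+z. \<alpha> 1 z \<partial>lborel) = (\<integral>\<^sup>+p. ennreal ((partial 1 f p)\<^sup>2) \<partial>lborel)"
    unfolding \<alpha>_def by (subst nn_integral_R3) auto
  also have "(\<integral>\<^sup>+z. \<alpha> 2 z \<partial>lborel) = (\<integral>\<^sup>+p. ennreal ((partial 2 f p)\<^sup>2) \<partial>lborel)"
    unfolding \<alpha>_def by (subst nn_integral_R3) auto
  also have "s \<le> (\<integral>\<^sup>+p. ennreal ((f p)\<^sup>2 + (partial 3 f p)\<^sup>2) \<partial>lborel)"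
    unfolding s_def G_def
  proof (intro nn_integral_mono ennreal_leI)
    fix p
    have "0 \<le> (\<bar>f p\<bar> - \<bar>partial 3 f p\<bar>)\<^sup>2" by simp
    then show "2 * \<bar>f p\<bar> * \<bar>partial 3 f p\<bar> \<le> (f p)\<^sup>2 + (partial 3 f p)\<^sup>2"
      by (simp add: power2_diff)
  qed
  finally show ?thesis by (simp add: mult_mono)
qed

text \<open>Poincare's inequality replaces the f^2 term of Ladyzhenskaya's inequality by 4 R^2 times
  the Dirichlet integral, and each partial derivative is bounded by the full gradient; what remains
  is an L^4 bound by the gradient alone.\<close>

lemma integral_power4_le:
  assumes f: "test_fun \<Omega> f" and R: "\<And>x. x \<in> \<Omega> \<Longrightarrow> norm x \<le> R"
  shows "(\<integral>x. (f x)^4 \<partial>lborel) \<le> 4 * (4 * R\<^sup>2 + 1) * (\<integral>x. (norm (cgrad f x))\<^sup>2 \<partial>lborel)\<^sup>2"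
proof -
  let ?D = "\<integral>x. (norm (cgrad f x))\<^sup>2 \<partial>lborel"
  have f4: "test_fun \<Omega> (\<lambda>x. (f x)^4)" using test_fun_power[OF f, of 3] by simp
  have p: "integrable lborel (\<lambda>x. (partial i f x)\<^sup>2)" for i
    by (rule test_fun_integrable[OF test_fun_square[OF test_fun_partial[OF f]]])
  have fi: "integrable lborel (\<lambda>x. (f x)\<^sup>2)" by (rule test_fun_integrable[OF test_fun_square[OF f]])
  have D: "?D = (\<integral>x. (partial 1 f x)\<^sup>2 \<partial>lborel) + (\<integral>x. (partial 2 f x)\<^sup>2 \<partial>lborel) + (\<integral>x. (partial 3 f x)\<^sup>2 \<partial>lborel)"
    unfolding cgrad_norm_sq sum_3 using p by simp
  have nn: "0 \<le> (\<integral>x. (partial i f x)\<^sup>2 \<partial>lborel)" for i by simp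
  have "ennreal (\<integral>x. (f x)^4 \<partial>lborel) = (\<integral>\<^sup>+x. ennreal ((f x)^4) \<partial>lborel)"
    by (rule nn_integral_eq_integral[symmetric]) (auto intro: test_fun_integrable[OF f4])
  also have "\<dots> \<le> 4 * (\<integral>\<^sup>+p. ennreal ((f p)\<^sup>2 + (partial 3 f p)\<^sup>2) \<partial>lborel) *
      ((\<integral>\<^sup>+p. ennreal ((partial 1 f p)\<^sup>2) \<partial>lborel) + (\<integral>\<^sup>+p. ennreal ((partial 2 f p)\<^sup>2) \<partial>lborel))"
    by (rule ladyzhenskaya[OF f])
  also have "\<dots> = ennreal (4 * ((\<integral>x. (f x)\<^sup>2 \<partial>lborel) + (\<integral>x. (partial 3 f x)\<^sup>2 \<partial>lborel)) *
      ((\<integral>x. (partial 1 f x)\<^sup>2 \<partial>lborel) + (\<integral>x. (partial 2 f x)\<^sup>2 \<partial>lborel)))"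
  proof -
    have "(\<integral>\<^sup>+p. ennreal ((f p)\<^sup>2 + (partial 3 f p)\<^sup>2) \<partial>lborel) =
        ennreal ((\<integral>x. (f x)\<^sup>2 \<partial>lborel) + (\<integral>x. (partial 3 f x)\<^sup>2 \<partial>lborel))"
      using p fi by (subst nn_integral_eq_integral) auto
    moreover have "(\<integral>\<^sup>+p. ennreal ((partial i f p)\<^sup>2) \<partial>lborel) = ennreal (\<integral>x. (partial i f x)\<^sup>2 \<partial>lborel)" for i
      using p by (subst nn_integral_eq_integral) auto
    ultimately show ?thesis
      by (simp only: ennreal_plus[symmetric] nn add_nonneg_nonneg Bochner_Integration.integral_nonneg
          zero_le_power2 ennreal_mult zero_le_numeral mult_nonneg_nonneg ennreal_numeral)
  qed
  finally have "(\<integral>x. (f x)^4 \<partial>lborel) \<le> 4 * ((\<integral>x. (f x)\<^sup>2 \<partial>lborel) + (\<integral>x. (partial 3 f x)\<^sup>2 \<partial>lborel)) *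
      ((\<integral>x. (partial 1 f x)\<^sup>2 \<partial>lborel) + (\<integral>x. (partial 2 f x)\<^sup>2 \<partial>lborel))"
    by (subst (asm) ennreal_le_iff) auto
  also have "\<dots> \<le> 4 * ((4 * R\<^sup>2 * ?D) + ?D) * ?D"
    using poincare_test_fun[OF f R] nn[of 1] nn[of 2] nn[of 3] D
    by (intro mult_mono add_mono) auto
  finally show ?thesis by (simp add: power2_eq_square algebra_simps)
qed

section \<open>Square-integrable functions\<close>

definition L2 :: "'a measure \<Rightarrow> ('a \<Rightarrow> 'b::euclidean_space) \<Rightarrow> bool" where
  "L2 M f \<longleftrightarrow> f \<in> borel_measurable M \<and> integrable M (\<lambda>x. (norm (f x))\<^sup>2)"

text \<open>No quotient by null sets is taken, so this is a seminorm; limits are unique almost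
  everywhere.\<close>

definition l2n :: "'a measure \<Rightarrow> ('a \<Rightarrow> 'b::euclidean_space) \<Rightarrow> real" where
  "l2n M f = sqrt (\<integral>x. (norm (f x))\<^sup>2 \<partial>M)"

lemma L2_measurable [measurable_dest]: "L2 M f \<Longrightarrow> f \<in> borel_measurable M"
  by (simp add: L2_def)

lemma L2_integrable_sq: "L2 M f \<Longrightarrow> integrable M (\<lambda>x. (norm (f x))\<^sup>2)"
  by (simp add: L2_def)

lemma l2n_nonneg [simp]: "0 \<le> l2n M f"
  by (simp add: l2n_def)

lemma l2n_sq: "(l2n M f)\<^sup>2 = (\<integral>x. (norm (f x))\<^sup>2 \<partial>M)"
  by (simp add: l2n_def)

lemma l2n_cong_AE:
  assumes "f \<in> borel_measurable M" "g \<in> borel_measurable M" "AE x in M. f x = g x"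
  shows "l2n M f = l2n M g"
proof -
  have "(\<integral>x. (norm (f x))\<^sup>2 \<partial>M) = (\<integral>x. (norm (g x))\<^sup>2 \<partial>M)"
    using assms by (intro integral_cong_AE) auto
  then show ?thesis by (simp add: l2n_def)
qed

lemma l2n_minus_commute: "l2n M (\<lambda>x. f x - g x) = l2n M (\<lambda>x. g x - f x)"
  by (simp add: l2n_def norm_minus_commute)

lemma L2_cong_AE:
  assumes "L2 M f" "g \<in> borel_measurable M" "AE x in M. f x = g x"
  shows "L2 M g"
  unfolding L2_def
proof
  have "AE x in M. (norm (g x))\<^sup>2 = (norm (f x))\<^sup>2" using assms(3) by eventually_elim simp
  then show "integrable M (\<lambda>x. (norm (g x))\<^sup>2)"
    using assms(2) by (intro integrable_cong_AE_imp[OF L2_integrable_sq[OF assms(1)]]) auto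
qed (rule assms(2))

lemma L2_bound:
  assumes "L2 M f" "g \<in> borel_measurable M" "AE x in M. norm (g x) \<le> norm (f x)"
  shows "L2 M g"
  unfolding L2_def
proof (intro conjI assms(2) Bochner_Integration.integrable_bound[OF L2_integrable_sq[OF assms(1)]])
  show "AE x in M. norm ((norm (g x))\<^sup>2) \<le> norm ((norm (f x))\<^sup>2)"
    using assms(3) by eventually_elim (simp add: power_mono)
qed (use assms(2) in measurable)

lemma l2n_mono_AE:
  assumes "L2 M f" "g \<in> borel_measurable M" "AE x in M. norm (g x) \<le> norm (f x)"
  shows "l2n M g \<le> l2n M f"
  unfolding l2n_def
proof (intro real_sqrt_le_mono integral_mono_AE L2_integrable_sq assms)
  show "L2 M g" by (rule L2_bound[OF assms])
  show "AE x in M. (norm (g x))\<^sup>2 \<le> (norm (f x))\<^sup>2"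
    using assms(3) by eventually_elim (simp add: power_mono)
qed

lemma L2_zero [simp]: "L2 M (\<lambda>x. 0)"
  by (simp add: L2_def)

lemma l2n_zero [simp]: "l2n M (\<lambda>x. 0) = 0"
  by (simp add: l2n_def)

lemma L2_scaleR [intro]: "L2 M f \<Longrightarrow> L2 M (\<lambda>x. c *\<^sub>R f x)"
  by (auto simp: L2_def power_mult_distrib)

lemma L2_cmult [intro]: "L2 M f \<Longrightarrow> L2 M (\<lambda>x. c * f x :: real)"
  using L2_scaleR[of M f c] by simp

lemma l2n_scaleR: "l2n M (\<lambda>x. c *\<^sub>R f x) = \<bar>c\<bar> * l2n M f"
  by (simp add: l2n_def power_mult_distrib real_sqrt_mult)

lemma L2_norm [intro]: "L2 M f \<Longrightarrow> L2 M (\<lambda>x. norm (f x))"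
  by (auto simp: L2_def)

lemma L2_add [intro]:
  assumes "L2 M f" "L2 M g" shows "L2 M (\<lambda>x. f x + g x)"
  unfolding L2_def
proof
  show [measurable]: "(\<lambda>x. f x + g x) \<in> borel_measurable M" using assms by measurable
  show "integrable M (\<lambda>x. (norm (f x + g x))\<^sup>2)"
  proof (rule Bochner_Integration.integrable_bound)
    show "integrable M (\<lambda>x. 2 * (norm (f x))\<^sup>2 + 2 * (norm (g x))\<^sup>2)"
      using assms by (auto simp: L2_def)
    have "(norm (f x + g x))\<^sup>2 \<le> 2 * (norm (f x))\<^sup>2 + 2 * (norm (g x))\<^sup>2" for x
    proof -
      have "(norm (f x + g x))\<^sup>2 \<le> (norm (f x) + norm (g x))\<^sup>2"
        by (intro power_mono norm_triangle_ineq) auto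
      moreover have "0 \<le> (norm (f x) - norm (g x))\<^sup>2" by simp
      ultimately show ?thesis by (simp add: power2_eq_square algebra_simps)
    qed
    then show "AE x in M. norm ((norm (f x + g x))\<^sup>2) \<le> norm (2 * (norm (f x))\<^sup>2 + 2 * (norm (g x))\<^sup>2)"
      by auto
  qed measurable
qed

lemma L2_diff [intro]: "L2 M f \<Longrightarrow> L2 M g \<Longrightarrow> L2 M (\<lambda>x. f x - g x)"
  using L2_add[of M f "\<lambda>x. (-1) *\<^sub>R g x"] L2_scaleR[of M g "-1"] by simp

lemma L2_norm_mult_integrable:
  assumes "L2 M f" "L2 M g" shows "integrable M (\<lambda>x. norm (f x) * norm (g x))"
proof (rule Bochner_Integration.integrable_bound)
  show "integrable M (\<lambda>x. (norm (f x))\<^sup>2 + (norm (g x))\<^sup>2)"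
    using assms by (auto simp: L2_def)
  have "norm (f x) * norm (g x) \<le> (norm (f x))\<^sup>2 + (norm (g x))\<^sup>2" for x
  proof -
    have "0 \<le> norm (f x) * norm (g x)" by simp
    then show ?thesis
      using sum_squares_bound[of "norm (f x)" "norm (g x)"] unfolding mult.assoc by linarith
  qed
  then show "AE x in M. norm (norm (f x) * norm (g x)) \<le> norm ((norm (f x))\<^sup>2 + (norm (g x))\<^sup>2)"
    by auto
qed (use assms in measurable)

lemma L2_inner_integrable:
  assumes "L2 M f" "L2 M g" shows "integrable M (\<lambda>x. f x \<bullet> g x)"
  by (rule Bochner_Integration.integrable_bound[OF L2_norm_mult_integrable[OF assms]])
    (use assms Cauchy_Schwarz_ineq2 in \<open>auto simp: L2_def\<close>)

lemma L2_mult_integrable: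
  fixes f g :: "'a \<Rightarrow> real"
  shows "L2 M f \<Longrightarrow> L2 M g \<Longrightarrow> integrable M (\<lambda>x. f x * g x)"
  using L2_inner_integrable[of M f g] by simp

lemma L2_Cauchy_Schwarz_norm:
  assumes f: "L2 M f" and g: "L2 M g"
  shows "(\<integral>x. norm (f x) * norm (g x) \<partial>M) \<le> l2n M f * l2n M g"
proof -
  define A where "A = (\<integral>x. (norm (f x))\<^sup>2 \<partial>M)"
  define B where "B = (\<integral>x. (norm (g x))\<^sup>2 \<partial>M)"
  define C where "C = (\<integral>x. norm (f x) * norm (g x) \<partial>M)"
  note i = L2_integrable_sq[OF f] L2_integrable_sq[OF g] L2_norm_mult_integrable[OF f g]
  \<comment> \<open>The discriminant argument: the expression is the integral of a square for every
    t. It is used at its minimum t = C/B or, if B = 0, at a t that makes it equal to -1.\<close>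
  have q: "0 \<le> A - 2 * t * C + t\<^sup>2 * B" for t
  proof -
    have "0 \<le> (\<integral>x. (norm (f x) - t * norm (g x))\<^sup>2 \<partial>M)" by simp
    also have "(\<lambda>x. (norm (f x) - t * norm (g x))\<^sup>2) =
       (\<lambda>x. (norm (f x))\<^sup>2 - (2 * t) * (norm (f x) * norm (g x)) + t\<^sup>2 * (norm (g x))\<^sup>2)"
      by (auto simp: power2_eq_square algebra_simps)
    also have "(\<integral>x. \<dots> x \<partial>M) = A - 2 * t * C + t\<^sup>2 * B"
      using i by (simp add: A_def B_def C_def)
    finally show ?thesis .
  qed
  have nn: "0 \<le> A" "0 \<le> B" "0 \<le> C" by (auto simp: A_def B_def C_def)
  have "C\<^sup>2 \<le> A * B"
  proof (cases "B = 0")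
    case True
    have "C = 0"
    proof (rule ccontr)
      assume "C \<noteq> 0"
      with q[of "(A + 1) / (2 * C)"] True show False by (simp add: field_simps)
    qed
    then show ?thesis using True by simp
  next
    case False
    with q[of "C / B"] nn show ?thesis by (simp add: field_simps power2_eq_square)
  qed
  then have "C \<le> sqrt (A * B)" using nn by (simp add: real_le_rsqrt)
  then show ?thesis by (simp add: C_def A_def B_def l2n_def real_sqrt_mult)
qed

lemma L2_Cauchy_Schwarz:
  assumes f: "L2 M f" and g: "L2 M g"
  shows "\<bar>\<integral>x. f x \<bullet> g x \<partial>M\<bar> \<le> l2n M f * l2n M g"
proof -
  have "\<bar>\<integral>x. f x \<bullet> g x \<partial>M\<bar> \<le> (\<integral>x. norm (f x \<bullet> g x) \<partial>M)"
    using integral_norm_bound[of M "\<lambda>x. f x \<bullet> g x"] by simp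
  also have "\<dots> \<le> (\<integral>x. norm (f x) * norm (g x) \<partial>M)"
    by (intro integral_mono integrable_norm L2_inner_integrable[OF f g] L2_norm_mult_integrable[OF f g])
      (simp add: Cauchy_Schwarz_ineq2)
  finally have "\<bar>\<integral>x. f x \<bullet> g x \<partial>M\<bar> \<le> (\<integral>x. norm (f x) * norm (g x) \<partial>M)" .
  with L2_Cauchy_Schwarz_norm[OF f g] show ?thesis by linarith
qed

lemma L2_Cauchy_Schwarz_real:
  fixes f g :: "'a \<Rightarrow> real"
  shows "L2 M f \<Longrightarrow> L2 M g \<Longrightarrow> \<bar>\<integral>x. f x * g x \<partial>M\<bar> \<le> l2n M f * l2n M g"
  using L2_Cauchy_Schwarz[of M f g] by simp

lemma l2n_add_sq:
  assumes f: "L2 M f" and g: "L2 M g"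
  shows "(l2n M (\<lambda>x. f x + g x))\<^sup>2 = (l2n M f)\<^sup>2 + 2 * (\<integral>x. f x \<bullet> g x \<partial>M) + (l2n M g)\<^sup>2"
proof -
  have *: "(norm (f x + g x))\<^sup>2 = (norm (f x))\<^sup>2 + 2 * (f x \<bullet> g x) + (norm (g x))\<^sup>2" for x
    by (simp add: power2_norm_eq_inner inner_add_left inner_add_right inner_commute)
  show ?thesis
    unfolding l2n_sq * using L2_integrable_sq[OF f] L2_integrable_sq[OF g] L2_inner_integrable[OF f g]
    by simp
qed

lemma l2n_triangle:
  assumes f: "L2 M f" and g: "L2 M g"
  shows "l2n M (\<lambda>x. f x + g x) \<le> l2n M f + l2n M g"
proof (rule power2_le_imp_le)
  show "(l2n M (\<lambda>x. f x + g x))\<^sup>2 \<le> (l2n M f + l2n M g)\<^sup>2"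
    using L2_Cauchy_Schwarz[OF f g] unfolding l2n_add_sq[OF f g] power2_sum by linarith
qed simp

lemma l2n_triangle_diff:
  assumes "L2 M f" "L2 M g" "L2 M h"
  shows "l2n M (\<lambda>x. f x - h x) \<le> l2n M (\<lambda>x. f x - g x) + l2n M (\<lambda>x. g x - h x)"
  using l2n_triangle[OF L2_diff[OF assms(1,2)] L2_diff[OF assms(2,3)]] by simp

lemma l2n_eq_0_iff: 
  assumes "L2 M f" shows "l2n M f = 0 \<longleftrightarrow> (AE x in M. f x = 0)"
  using integral_nonneg_eq_0_iff_AE[OF L2_integrable_sq[OF assms]] by (simp add: l2n_def)

lemma integral_inner_tendsto:
  assumes "\<And>n. L2 M (s n)" "L2 M f" "L2 M g" "(\<lambda>n. l2n M (\<lambda>x. s n x - f x)) \<longlonglongrightarrow> 0"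
  shows "(\<lambda>n. \<integral>x. s n x \<bullet> g x \<partial>M) \<longlonglongrightarrow> (\<integral>x. f x \<bullet> g x \<partial>M)"
proof -
  have b: "norm ((\<integral>x. s n x \<bullet> g x \<partial>M) - (\<integral>x. f x \<bullet> g x \<partial>M)) \<le> l2n M (\<lambda>x. s n x - f x) * l2n M g" for n
    using L2_Cauchy_Schwarz[OF L2_diff[OF assms(1)[of n] assms(2)] assms(3)]
      L2_inner_integrable[OF assms(1)[of n] assms(3)] L2_inner_integrable[OF assms(2,3)]
    by (simp add: inner_diff_left)
  have "(\<lambda>n. l2n M (\<lambda>x. s n x - f x) * l2n M g) \<longlonglongrightarrow> 0"
    using tendsto_mult[OF assms(4) tendsto_const[of "l2n M g"]] by simp
  with b have "(\<lambda>n. (\<integral>x. s n x \<bullet> g x \<partial>M) - (\<integral>x. f x \<bullet> g x \<partial>M)) \<longlonglongrightarrow> 0"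
    by (rule Lim_null_comparison[OF always_eventually[OF allI]])
  then show ?thesis by (rule LIM_zero_cancel)
qed

lemma integral_mult_tendsto:
  fixes f :: "'a \<Rightarrow> real"
  assumes "\<And>n. L2 M (s n)" "L2 M f" "L2 M g" "(\<lambda>n. l2n M (\<lambda>x. s n x - f x)) \<longlonglongrightarrow> 0"
  shows "(\<lambda>n. \<integral>x. s n x * g x \<partial>M) \<longlonglongrightarrow> (\<integral>x. f x * g x \<partial>M)"
  using integral_inner_tendsto[OF assms] by simp

lemma l2n_tendsto:
  assumes "\<And>n. L2 M (s n)" "L2 M f" "(\<lambda>n. l2n M (\<lambda>x. s n x - f x)) \<longlonglongrightarrow> 0"
  shows "(\<lambda>n. l2n M (s n)) \<longlonglongrightarrow> l2n M f"
proof -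
  have "norm (l2n M (s n) - l2n M f) \<le> l2n M (\<lambda>x. s n x - f x)" for n
    using l2n_triangle[OF L2_diff[OF assms(1)[of n] assms(2)] assms(2)]
      l2n_triangle[OF L2_diff[OF assms(2) assms(1)[of n]] assms(1)[of n]]
    by (simp add: l2n_minus_commute[of M "s n"])
  then have "(\<lambda>n. l2n M (s n) - l2n M f) \<longlonglongrightarrow> 0"
    by (rule Lim_null_comparison[OF always_eventually[OF allI] assms(3)])
  then show ?thesis by (rule LIM_zero_cancel)
qed

section \<open>Square integrability over a finite measure, and completeness\<close>

context finite_measure begin

lemma L2_bounded:
  assumes "f \<in> borel_measurable M" "AE x in M. norm (f x) \<le> c"
  shows "L2 M f"
proof (rule L2_bound)
  show "L2 M (\<lambda>x. \<bar>c\<bar>)" by (simp add: L2_def)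
  show "AE x in M. norm (f x) \<le> norm \<bar>c\<bar>" using assms(2) by eventually_elim simp
qed (rule assms(1))

lemma L2_const [simp]: "L2 M (\<lambda>x. c)"
  by (rule L2_bounded[of _ "norm c"]) auto

lemma l2n_const: "l2n M (\<lambda>x. c) = sqrt (measure M (space M)) * norm c"
  by (simp add: l2n_def real_sqrt_mult)

lemma L2_integrable:
  assumes "L2 M f" shows "integrable M f"
  using L2_norm_mult_integrable[OF assms L2_const[of "1::real"]] L2_measurable[OF assms]
  by (simp add: integrable_norm_iff)

lemma integral_norm_le_l2n:
  assumes "L2 M f" shows "(\<integral>x. norm (f x) \<partial>M) \<le> l2n M f * sqrt (measure M (space M))"
  using L2_Cauchy_Schwarz_norm[OF assms L2_const[of "1::real"]] by (simp add: l2n_const)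

text \<open>Riesz-Fischer. On a finite measure space an L^2 Cauchy sequence is L^1 Cauchy, hence a
  subsequence converges almost everywhere; Fatou's lemma shows that the pointwise limit is the L^2
  limit of the whole sequence.\<close>

lemma L2_complete:
  fixes s :: "nat \<Rightarrow> 'a \<Rightarrow> 'b::euclidean_space"
  assumes s: "\<And>n. L2 M (s n)"
    and Cauchy: "\<And>e. e > 0 \<Longrightarrow> \<exists>N. \<forall>i\<ge>N. \<forall>j\<ge>N. l2n M (\<lambda>x. s i x - s j x) < e"
  obtains f where "L2 M f" "(\<lambda>n. l2n M (\<lambda>x. s n x - f x)) \<longlonglongrightarrow> 0"
proof -
  note [measurable] = L2_measurable[OF s]
  \<comment> \<open>The summand 1 keeps the divisor positive even on a null space.\<close>
  define m where "m = sqrt (measure M (space M)) + 1"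
  have m: "m > 0" by (simp add: m_def add_nonneg_pos)
  have "\<exists>N. \<forall>i\<ge>N. \<forall>j\<ge>N. (\<integral>x. norm (s i x - s j x) \<partial>M) < e" if "e > 0" for e
  proof -
    obtain N where N: "\<And>i j. i \<ge> N \<Longrightarrow> j \<ge> N \<Longrightarrow> l2n M (\<lambda>x. s i x - s j x) < e / m"
      using Cauchy[of "e / m"] m \<open>e > 0\<close> by (metis divide_pos_pos)
    have "(\<integral>x. norm (s i x - s j x) \<partial>M) < e" if "i \<ge> N" "j \<ge> N" for i j
    proof -
      have "(\<integral>x. norm (s i x - s j x) \<partial>M) \<le> l2n M (\<lambda>x. s i x - s j x) * sqrt (measure M (space M))"
        by (rule integral_norm_le_l2n[OF L2_diff[OF s s]])
      also have "\<dots> \<le> l2n M (\<lambda>x. s i x - s j x) * m" by (intro mult_left_mono) (auto simp: m_def)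
      also have "\<dots> < e" using N[OF that] m by (simp add: field_simps)
      finally show ?thesis .
    qed
    then show ?thesis by blast
  qed
  then obtain r where r: "strict_mono r" and AE_Cauchy: "AE x in M. Cauchy (\<lambda>i. s (r i) x)"
    using cauchy_L1_AE_cauchy_subseq[of M s] L2_integrable[OF s] by metis
  define f where "f = (\<lambda>x. lim (\<lambda>i. s (r i) x))"
  have [measurable]: "f \<in> borel_measurable M" unfolding f_def by measurable
  have lim: "AE x in M. (\<lambda>i. s (r i) x) \<longlonglongrightarrow> f x"
    using AE_Cauchy by eventually_elim (simp add: f_def Cauchy_convergent_iff convergent_LIMSEQ_iff)
  \<comment> \<open>With n fixed, Fatou along the subsequence carries a bound valid for all late k
    over to the limit.\<close>
  have fatou: "(\<integral>\<^sup>+x. ennreal ((norm (s n x - f x))\<^sup>2) \<partial>M) \<le> ennreal (e\<^sup>2)"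
    if e: "\<And>k. k \<ge> N \<Longrightarrow> l2n M (\<lambda>x. s n x - s k x) \<le> e" for n N e
  proof -
    have "AE x in M. ennreal ((norm (s n x - f x))\<^sup>2) = liminf (\<lambda>i. ennreal ((norm (s n x - s (r i) x))\<^sup>2))"
      using lim
    proof eventually_elim
      case (elim x)
      have "(\<lambda>i. ennreal ((norm (s n x - s (r i) x))\<^sup>2)) \<longlonglongrightarrow> ennreal ((norm (s n x - f x))\<^sup>2)"
        by (intro tendsto_intros elim)
      then show ?case by (intro lim_imp_Liminf[symmetric] trivial_limit_sequentially)
    qed
    then have "(\<integral>\<^sup>+x. ennreal ((norm (s n x - f x))\<^sup>2) \<partial>M) =
        (\<integral>\<^sup>+x. liminf (\<lambda>i. ennreal ((norm (s n x - s (r i) x))\<^sup>2)) \<partial>M)"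
      by (rule nn_integral_cong_AE)
    also have "\<dots> \<le> liminf (\<lambda>i. \<integral>\<^sup>+x. ennreal ((norm (s n x - s (r i) x))\<^sup>2) \<partial>M)"
      by (rule nn_integral_liminf) measurable
    also have "\<dots> \<le> limsup (\<lambda>i. \<integral>\<^sup>+x. ennreal ((norm (s n x - s (r i) x))\<^sup>2) \<partial>M)"
      by (rule Liminf_le_Limsup) simp
    also have "\<dots> \<le> ennreal (e\<^sup>2)"
    proof (rule Limsup_bounded)
      show "eventually (\<lambda>i. (\<integral>\<^sup>+x. ennreal ((norm (s n x - s (r i) x))\<^sup>2) \<partial>M) \<le> ennreal (e\<^sup>2)) sequentially"
        using eventually_ge_at_top[of N]
      proof eventually_elim
        case (elim i)
        then have "l2n M (\<lambda>x. s n x - s (r i) x) \<le> e" using e seq_suble[OF r, of i] by auto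
        moreover have "(\<integral>\<^sup>+x. ennreal ((norm (s n x - s (r i) x))\<^sup>2) \<partial>M) = ennreal ((l2n M (\<lambda>x. s n x - s (r i) x))\<^sup>2)"
          unfolding l2n_sq by (rule nn_integral_eq_integral) (use L2_integrable_sq[OF L2_diff[OF s s]] in auto)
        ultimately show ?case by (simp add: ennreal_leI power_mono)
      qed
    qed
    finally show ?thesis .
  qed
  have diff: "L2 M (\<lambda>x. s n x - f x)" "l2n M (\<lambda>x. s n x - f x) \<le> e"
    if e: "\<And>k. k \<ge> N \<Longrightarrow> l2n M (\<lambda>x. s n x - s k x) \<le> e" for n N e
  proof -
    have "integrable M (\<lambda>x. (norm (s n x - f x))\<^sup>2)"
      using fatou[OF e] by (intro integrableI_bounded) (auto simp: less_top[symmetric] top_unique)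
    then show *: "L2 M (\<lambda>x. s n x - f x)" by (simp add: L2_def)
    have "ennreal ((l2n M (\<lambda>x. s n x - f x))\<^sup>2) \<le> ennreal (e\<^sup>2)"
      using fatou[OF e] L2_integrable_sq[OF *] unfolding l2n_sq
      by (subst (asm) nn_integral_eq_integral) auto
    moreover have "0 \<le> e" using e[of N] l2n_nonneg order_trans by blast
    ultimately show "l2n M (\<lambda>x. s n x - f x) \<le> e"
      by (auto intro: power2_le_imp_le)
  qed
  obtain N1 where "\<forall>i\<ge>N1. \<forall>j\<ge>N1. l2n M (\<lambda>x. s i x - s j x) < 1" using Cauchy[of 1] by auto
  then have "L2 M (\<lambda>x. s N1 x - f x)" by (intro diff(1)[of N1 _ 1]) (auto simp: less_imp_le)
  then have f: "L2 M f" using L2_diff[OF s[of N1]] by force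
  moreover have "(\<lambda>n. l2n M (\<lambda>x. s n x - f x)) \<longlonglongrightarrow> 0"
  proof (rule LIMSEQ_I)
    fix e :: real assume "e > 0"
    then obtain N where "\<forall>i\<ge>N. \<forall>j\<ge>N. l2n M (\<lambda>x. s i x - s j x) < e / 2"
      using Cauchy[of "e/2"] by auto
    then have "l2n M (\<lambda>x. s n x - f x) \<le> e / 2" if "n \<ge> N" for n
      using that by (intro diff(2)[of N]) (auto simp: less_imp_le)
    with \<open>e > 0\<close> show "\<exists>N. \<forall>n\<ge>N. norm (l2n M (\<lambda>x. s n x - f x) - 0) < e"
      by (intro exI[of _ N]) force
  qed
  ultimately show ?thesis by (rule that)
qed

end

section \<open>Weak gradients on a bounded open set\<close>

text \<open>Boxes are stable under intersection and generate the Borel sets, and the sets over which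
  the integral vanishes form a Dynkin system. The whole space is not a box, hence the separate
  assumption \<open>tot\<close>, which handles complements.\<close>

lemma integral_zero_on_boxes_imp_AE_zero:
  fixes h :: "R3 \<Rightarrow> real"
  assumes h: "integrable lborel h"
    and tot: "(\<integral>x. h x \<partial>lborel) = 0"
    and box: "\<And>c d. (LINT x:box c d|lborel. h x) = 0"
  shows "AE x in lborel. h x = 0"
proof (rule sigma_finite_measure.density_zero[OF sigma_finite_lborel h])
  fix A :: "R3 set" assume "A \<in> sets lborel"
  let ?E = "range (\<lambda>(a, b). box a b :: R3 set)"
  have "sets borel = sigma_sets UNIV ?E" by (subst borel_eq_box) (simp add: sets_measure_of)
  then have A: "A \<in> sigma_sets UNIV ?E" using \<open>A \<in> sets lborel\<close> by simp
  have si: "set_integrable lborel B h" if "B \<in> sets borel" for B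
    using integrable_mult_indicator[OF _ h, of B] that by (simp add: set_integrable_def)
  have "Int_stable ?E" by (auto simp: Int_stable_def box_Int_box)
  moreover have "?E \<subseteq> Pow UNIV" by simp
  ultimately show "(LINT x:A|lborel. h x) = 0" using A
  proof (induction rule: sigma_sets_induct_disjoint)
    case (basic B) then show ?case using box by auto
  next
    case empty show ?case by (simp add: set_lebesgue_integral_def)
  next
    case (compl B)
    then have B: "B \<in> sets borel" using \<open>sets borel = _\<close> by simp
    have "(LINT x:UNIV|lborel. h x) = (LINT x:B|lborel. h x) + (LINT x:UNIV - B|lborel. h x)"
      using set_integral_Un[of B "UNIV - B" lborel h] si B by (simp add: Un_absorb1)
    then show ?case using compl tot by (simp add: set_lebesgue_integral_def)
  next
    case (union F)
    then have F: "F i \<in> sets borel" for i using \<open>sets borel = _\<close> by auto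
    have "(LINT x:(\<Union>i. F i)|lborel. h x) = (\<Sum>i. LINT x:F i|lborel. h x)"
      using union(1) F si[of "\<Union>i. F i"]
      by (intro lebesgue_integral_countable_add) (auto simp: disjoint_family_on_def)
    then show ?case using union by simp
  qed
qed

section \<open>Integration with respect to the restricted Lebesgue measure\<close>

locale bounded_open_set =
  fixes \<Omega> :: "R3 set"
  assumes open_\<Omega>: "open \<Omega>" and bounded_\<Omega>: "bounded \<Omega>"
begin

abbreviation "M \<equiv> lebesgue_on \<Omega>"

lemma \<Omega>_lebesgue [simp, measurable]: "\<Omega> \<in> sets lebesgue"
  using fmeasurableD[OF lmeasurable_open[OF bounded_\<Omega> open_\<Omega>]] .

sublocale finite_measure M
  using finite_measure_lebesgue_on[OF lmeasurable_open[OF bounded_\<Omega> open_\<Omega>]] .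

lemma set_integral_eq: "(LINT x:\<Omega>|lebesgue. F x) = (\<integral>x. F x \<partial>M)" for F :: "R3 \<Rightarrow> real"
  by (simp add: set_lebesgue_integral_def integral_restrict_space)

lemma set_integrable_iff: "set_integrable lebesgue \<Omega> F \<longleftrightarrow> integrable M F" for F :: "R3 \<Rightarrow> real"
  by (simp add: set_integrable_def integrable_restrict_space)

lemma set_borel_measurable_iff: "set_borel_measurable lebesgue \<Omega> F \<longleftrightarrow> F \<in> borel_measurable M" for F :: "R3 \<Rightarrow> real"
  by (simp add: set_borel_measurable_def borel_measurable_restrict_space_iff)

lemma AE_iff: "(AE x in lebesgue. x \<in> \<Omega> \<longrightarrow> P x) \<longleftrightarrow> (AE x in M. P x)"
  by (simp add: AE_restrict_space_iff)

lemma borel_imp_M: "f \<in> borel_measurable borel \<Longrightarrow> f \<in> borel_measurable M"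
  by (intro measurable_restrict_space1 measurable_completion) simp

lemma integral_M_lborel:
  fixes f :: "R3 \<Rightarrow> real"
  assumes "f \<in> borel_measurable borel" "\<And>x. x \<notin> \<Omega> \<Longrightarrow> f x = 0"
  shows "(\<integral>x. f x \<partial>M) = (\<integral>x. f x \<partial>lborel)"
proof -
  have "(\<lambda>x. indicator \<Omega> x *\<^sub>R f x) = f" using assms(2) by (auto simp: fun_eq_iff indicator_def)
  then have "(\<integral>x. f x \<partial>M) = (\<integral>x. f x \<partial>lebesgue)" by (simp add: integral_restrict_space)
  also have "\<dots> = (\<integral>x. f x \<partial>lborel)" using assms(1) by (intro integral_completion) simp
  finally show ?thesis .
qed

lemma test_fun_zero_outside: "test_fun \<Omega> f \<Longrightarrow> x \<notin> \<Omega> \<Longrightarrow> f x = 0"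
  using test_funE by (metis subsetD)

lemma integral_test_fun: "test_fun \<Omega> f \<Longrightarrow> (\<integral>x. f x \<partial>M) = (\<integral>x. f x \<partial>lborel)"
  by (intro integral_M_lborel test_fun_zero_outside test_fun_borel)

lemma test_fun_measurable_M [measurable]: "test_fun \<Omega> f \<Longrightarrow> f \<in> borel_measurable M"
  by (intro borel_imp_M test_fun_borel)

lemma borel_measurable_vec_iff:
  fixes g :: "R3 \<Rightarrow> R3"
  shows "g \<in> borel_measurable N \<longleftrightarrow> (\<forall>i. (\<lambda>x. g x $ i) \<in> borel_measurable N)"
  by (subst borel_measurable_euclidean_space) (auto simp: Basis_vec_def inner_axis)

lemma cgrad_borel [measurable]: "test_fun \<Omega> f \<Longrightarrow> cgrad f \<in> borel_measurable M"
  unfolding borel_measurable_vec_iff by (auto intro: test_fun_measurable_M test_fun_partial)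

lemma test_fun_L2 [intro]:
  assumes "test_fun \<Omega> f" shows "L2 M f" 
proof -
  obtain B where "\<And>x. \<bar>f x\<bar> \<le> B" using test_fun_bound[OF assms] by metis
  then show ?thesis using assms by (intro L2_bounded[of _ B]) auto
qed

lemma cgrad_L2 [intro]:
  assumes "test_fun \<Omega> f" shows "L2 M (cgrad f)" 
proof -
  obtain B where "\<And>x. \<bar>(norm (cgrad f x))\<^sup>2\<bar> \<le> B"
    using test_fun_bound[OF test_fun_cgrad_norm_sq[OF assms]] by metis
  then have "norm (cgrad f x) \<le> sqrt B" for x by (simp add: real_le_rsqrt)
  then show ?thesis using assms by (intro L2_bounded[of _ "sqrt B"]) auto
qed

lemma integral_by_parts_test_fun:
  assumes f: "test_fun \<Omega> f" and g: "test_fun \<Omega> g"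
  shows "(\<integral>x. f x * partial i g x \<partial>M) = - (\<integral>x. partial i f x * g x \<partial>M)"
proof -
  have fg: "test_fun \<Omega> (\<lambda>x. f x * g x)" by (rule test_fun_mult[OF f test_fun_Ck[OF g]])
  have d: "partial i (\<lambda>x. f x * g x) = (\<lambda>x. f x * partial i g x + partial i f x * g x)"
    using f g by (auto simp: partial_mult test_fun_differentiable)
  have "(\<integral>x. partial i (\<lambda>x. f x * g x) x \<partial>M) = 0"
    using integral_test_fun[OF test_fun_partial[OF fg]] integral_partial_eq_0[OF fg] by simp
  moreover have "integrable M (\<lambda>x. f x * partial i g x)" "integrable M (\<lambda>x. partial i f x * g x)"
    using f g test_fun_partial by (auto intro!: L2_mult_integrable)
  ultimately show ?thesis unfolding d by simp
qed

text \<open>The space \<open>H10\<close> with the gradient carried along explicitly, because \<open>wgrad\<close> is chosen by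
  \<open>SOME\<close> and determined only almost everywhere.\<close>
definition H1g :: "(R3 \<Rightarrow> real) \<Rightarrow> (R3 \<Rightarrow> R3) \<Rightarrow> bool" where
  "H1g u g \<longleftrightarrow> L2 M u \<and> L2 M g \<and> (\<exists>\<phi>. (\<forall>n. test_fun \<Omega> (\<phi> n)) \<and>
     (\<lambda>n. l2n M (\<lambda>x. \<phi> n x - u x)) \<longlonglongrightarrow> 0 \<and> (\<lambda>n. l2n M (\<lambda>x. cgrad (\<phi> n) x - g x)) \<longlonglongrightarrow> 0)"

lemma H1gE:
  assumes "H1g u g"
  obtains \<phi> where "\<And>n. test_fun \<Omega> (\<phi> n)"
     "(\<lambda>n. l2n M (\<lambda>x. \<phi> n x - u x)) \<longlonglongrightarrow> 0" "(\<lambda>n. l2n M (\<lambda>x. cgrad (\<phi> n) x - g x)) \<longlonglongrightarrow> 0"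
  using assms unfolding H1g_def by blast

lemma H1g_L2: "H1g u g \<Longrightarrow> L2 M u" "H1g u g \<Longrightarrow> L2 M g"
  by (auto simp: H1g_def)

lemma Lp_norm_2: "Lp_norm \<Omega> 2 u = l2n M u"
  unfolding Lp_norm_def set_integral_eq l2n_def by (simp add: powr_half_sqrt)

lemma l2n_norm: "l2n N (\<lambda>x. norm (g x)) = l2n N g"
  by (simp add: l2n_def)

lemma in_Lp_2: "in_Lp \<Omega> 2 u \<longleftrightarrow> L2 M u"
  unfolding in_Lp_def set_integrable_iff set_borel_measurable_iff L2_def by simp

lemma L2_nth: "L2 M g \<Longrightarrow> L2 M (\<lambda>x. g x $ i)" for g :: "R3 \<Rightarrow> R3"
  by (rule L2_bound[of _ g]) (auto simp: L2_def borel_measurable_vec_iff intro: component_le_norm_cart)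

text \<open>Integration by parts holds for the approximating test functions, and both sides pass to
  the L^2 limit; each component of the gradient error is dominated by its norm.\<close>

lemma H1g_imp_weak_grad:
  assumes u: "H1g u g" shows "weak_grad \<Omega> u g"
  unfolding weak_grad_def set_integral_eq
proof (intro conjI allI impI)
  note L = H1g_L2[OF u]
  fix C assume C: "compact C \<and> C \<subseteq> \<Omega>"
  then have "C \<in> sets lebesgue" by (simp add: compact_imp_closed borel_closed)
  with C show "set_integrable lebesgue C u" "set_integrable lebesgue C (\<lambda>x. g x $ i)" for i
    using L2_integrable[OF L(1)] L2_integrable[OF L2_nth[OF L(2), of i]]
    by (auto intro: set_integrable_subset simp flip: set_integrable_iff)
next
  note L = H1g_L2[OF u]
  fix \<psi> i assume \<psi>: "test_fun \<Omega> \<psi>"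
  obtain \<phi> where \<phi>: "\<And>n. test_fun \<Omega> (\<phi> n)"
     "(\<lambda>n. l2n M (\<lambda>x. \<phi> n x - u x)) \<longlonglongrightarrow> 0" "(\<lambda>n. l2n M (\<lambda>x. cgrad (\<phi> n) x - g x)) \<longlonglongrightarrow> 0"
    using H1gE[OF u] by blast
  have "(\<lambda>n. \<integral>x. \<phi> n x * partial i \<psi> x \<partial>M) \<longlonglongrightarrow> (\<integral>x. u x * partial i \<psi> x \<partial>M)"
    using \<psi> \<phi> L by (intro integral_mult_tendsto) (auto intro: test_fun_partial)
  moreover have "(\<lambda>n. - (\<integral>x. partial i (\<phi> n) x * \<psi> x \<partial>M)) \<longlonglongrightarrow> - (\<integral>x. g x $ i * \<psi> x \<partial>M)"
  proof (intro tendsto_minus integral_mult_tendsto)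
    show "(\<lambda>n. l2n M (\<lambda>x. partial i (\<phi> n) x - g x $ i)) \<longlonglongrightarrow> 0"
    proof (rule Lim_null_comparison[OF _ \<phi>(3)], intro always_eventually allI)
      fix n
      have "AE x in M. norm (partial i (\<phi> n) x - g x $ i) \<le> norm (cgrad (\<phi> n) x - g x)"
        using component_le_norm_cart[of "cgrad (\<phi> n) _ - g _" i] by auto
      then have "l2n M (\<lambda>x. partial i (\<phi> n) x - g x $ i) \<le> l2n M (\<lambda>x. cgrad (\<phi> n) x - g x)"
        by (intro l2n_mono_AE L2_diff cgrad_L2 \<phi> L L2_measurable[OF L2_diff] test_fun_L2
            test_fun_partial L2_nth)
      then show "norm (l2n M (\<lambda>x. partial i (\<phi> n) x - g x $ i)) \<le> l2n M (\<lambda>x. cgrad (\<phi> n) x - g x)"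
        by simp
    qed
  qed (use \<psi> \<phi> L2_nth[OF L(2)] in \<open>auto intro: test_fun_partial\<close>)
  moreover have "(\<integral>x. \<phi> n x * partial i \<psi> x \<partial>M) = - (\<integral>x. partial i (\<phi> n) x * \<psi> x \<partial>M)" for n
    by (rule integral_by_parts_test_fun[OF \<phi>(1) \<psi>])
  ultimately show "(\<integral>x. u x * cgrad \<psi> x $ i \<partial>M) = - (\<integral>x. g x $ i * \<psi> x \<partial>M)"
    using LIMSEQ_unique by simp
qed

text \<open>A weak gradient comes with integrability on compact subsets only. Countably many closed
  boxes exhaust the open set, and measurability is glued together from them.\<close>

lemma weak_grad_measurable:
  assumes "weak_grad \<Omega> u g" shows "g \<in> borel_measurable M"
  unfolding borel_measurable_vec_iff
proof
  fix i
  obtain D where D: "countable D" "D \<subseteq> Pow \<Omega>" "\<And>X. X \<in> D \<Longrightarrow> \<exists>a b. X = cbox a b" "\<Union>D = \<Omega>"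
    using open_countable_Union_open_cbox[OF open_\<Omega>] by metis
  show "(\<lambda>x. g x $ i) \<in> borel_measurable M"
  proof (rule measurable_piecewise_restrict[of D])
    fix X assume X: "X \<in> D"
    then have c: "compact X" "X \<subseteq> \<Omega>" and XL: "X \<in> sets lebesgue" using D by fastforce+
    then have "\<Omega> \<inter> X = X" by blast
    then show "X \<inter> space M \<in> sets M" using XL c(2)
      by (auto simp: sets_restrict_space space_restrict_space)
    have "(\<lambda>x. g x $ i) \<in> borel_measurable (lebesgue_on X)"
      using assms c XL by (subst borel_measurable_restrict_space_iff)
        (auto simp: weak_grad_def set_integrable_def dest!: borel_measurable_integrable)
    then show "(\<lambda>x. g x $ i) \<in> borel_measurable (restrict_space M X)"
      using XL \<open>\<Omega> \<inter> X = X\<close> by (simp add: restrict_restrict_space)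
  qed (use D in \<open>auto simp: space_restrict_space\<close>)
qed

lemma H1g_imp_H10:
  assumes "H1g u g" shows "H10 \<Omega> u"
proof -
  obtain \<phi> where \<phi>: "\<And>n. test_fun \<Omega> (\<phi> n)"
     "(\<lambda>n. l2n M (\<lambda>x. \<phi> n x - u x)) \<longlonglongrightarrow> 0" "(\<lambda>n. l2n M (\<lambda>x. cgrad (\<phi> n) x - g x)) \<longlonglongrightarrow> 0"
    using H1gE[OF assms] by blast
  then show ?thesis
    unfolding H10_def in_Lp_2 Lp_norm_2 l2n_norm
    using H1g_L2[OF assms] H1g_imp_weak_grad[OF assms] by (auto intro!: exI[of _ g] exI[of _ \<phi>])
qed

lemma H10_imp_H1g:
  assumes "H10 \<Omega> u" obtains g where "H1g u g"
proof -
  obtain g where g: "weak_grad \<Omega> u g" "L2 M (\<lambda>x. norm (g x))" "L2 M u"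
    "\<exists>\<phi>. (\<forall>n. test_fun \<Omega> (\<phi> n)) \<and>
     (\<lambda>n. l2n M (\<lambda>x. \<phi> n x - u x)) \<longlonglongrightarrow> 0 \<and> (\<lambda>n. l2n M (\<lambda>x. cgrad (\<phi> n) x - g x)) \<longlonglongrightarrow> 0"
    using assms unfolding H10_def in_Lp_2 Lp_norm_2 l2n_norm by blast
  \<comment> \<open>\<open>H10\<close> provides measurability of the norm of g; that of g itself
    comes from its being a weak gradient.\<close>
  then have "L2 M g" using weak_grad_measurable[OF g(1)] by (simp add: L2_def)
  with g show ?thesis by (intro that[of g]) (auto simp: H1g_def)
qed

text \<open>The fundamental lemma of the calculus of variations. Bumps turn orthogonality into
  vanishing integrals over open boxes, which determine an integrable function. Since g is only
  locally integrable, this is done inside one closed box at a time, and countably many boxes are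
  then combined.\<close>

lemma test_fun_orthogonal_imp_AE_zero:
  fixes g :: "R3 \<Rightarrow> real"
  assumes g: "\<And>C. compact C \<Longrightarrow> C \<subseteq> \<Omega> \<Longrightarrow> set_integrable lebesgue C g"
    and orth: "\<And>\<phi>. test_fun \<Omega> \<phi> \<Longrightarrow> (\<integral>x. g x * \<phi> x \<partial>M) = 0"
  shows "AE x in M. g x = 0"
proof -
  have box: "(LINT x:box c d|lebesgue. g x) = 0" if "cbox c d \<subseteq> \<Omega>" for c d
  proof -
    let ?g = "\<lambda>x. indicator (cbox c d) x * g x"
    have gi: "integrable lebesgue ?g"
      using g[OF compact_cbox that] by (simp add: set_integrable_def)
    have "(\<lambda>n. \<integral>x. ?g x * box_bump c d n x \<partial>lebesgue) \<longlonglongrightarrow> (\<integral>x. ?g x * indicator (box c d) x \<partial>lebesgue)"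
    proof (rule integral_dominated_convergence[where w="\<lambda>x. \<bar>?g x\<bar>"])
      have "box_bump c d n \<in> borel_measurable lebesgue" for n
        using test_fun_borel[OF test_fun_box_bump[OF that]] by (intro measurable_completion) simp
      then show "(\<lambda>x. ?g x * box_bump c d n x) \<in> borel_measurable lebesgue" for n
        using borel_measurable_times[OF borel_measurable_integrable[OF gi]] by blast
      show "(\<lambda>x. ?g x * indicator (box c d) x) \<in> borel_measurable lebesgue"
        by (rule borel_measurable_times[OF borel_measurable_integrable[OF gi] borel_measurable_indicator]) simp
      show "AE x in lebesgue. norm (?g x * box_bump c d n x) \<le> \<bar>?g x\<bar>" for n
        using box_bump_bounds[of c d n] by (auto simp: abs_mult intro!: mult_left_le)
      show "AE x in lebesgue. (\<lambda>n. ?g x * box_bump c d n x) \<longlonglongrightarrow> ?g x * indicator (box c d) x"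
        by (auto intro!: tendsto_mult tendsto_const box_bump_tendsto)
    qed (use gi in simp)
    moreover have "(\<integral>x. ?g x * box_bump c d n x \<partial>lebesgue) = 0" for n
    proof -
      have "box_bump c d n x = 0" if "x \<notin> cbox c d" for x
        using test_funE[OF test_fun_box_bump[OF subset_refl, of c d n]] that by (metis subsetD)
      then have "(\<lambda>x. ?g x * box_bump c d n x) = (\<lambda>x. indicator \<Omega> x *\<^sub>R (g x * box_bump c d n x))"
        using that by (auto simp: fun_eq_iff indicator_def)
      then show ?thesis using orth[OF test_fun_box_bump[OF that]] by (simp add: integral_restrict_space)
    qed
    moreover have "(\<lambda>x. ?g x * indicator (box c d) x) = (\<lambda>x. indicator (box c d) x *\<^sub>R g x)"
      using box_subset_cbox[of c d] by (auto simp: fun_eq_iff indicator_def)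
    ultimately show ?thesis by (simp add: LIMSEQ_const_iff set_lebesgue_integral_def)
  qed
  have cb: "AE x in lebesgue. x \<in> box a b \<longrightarrow> g x = 0" if ab: "cbox a b \<subseteq> \<Omega>" for a b
  proof -
    let ?g = "\<lambda>x. indicator (box a b) x *\<^sub>R g x"
    have "set_integrable lebesgue (box a b) g"
      by (rule set_integrable_subset[OF g[OF compact_cbox ab] _ box_subset_cbox]) simp
    then have gi: "integrable lebesgue ?g" by (simp add: set_integrable_def)
    \<comment> \<open>The function is merely Lebesgue measurable, whereas the uniqueness argument on
      boxes concerns \<open>lborel\<close>; h is a Borel representative.\<close>
    obtain h where h: "h \<in> borel_measurable lborel" "AE x in lborel. ?g x = h x"
      using completion_ex_borel_measurable_real[OF borel_measurable_integrable[OF gi]] by blast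
    have AEh: "AE x in lebesgue. ?g x = h x" using h(2) by (rule AE_completion)
    have hM: "h \<in> borel_measurable lebesgue" using h(1) by (rule measurable_completion)
    have "integrable lebesgue h"
      using AEh by (intro integrable_cong_AE_imp[OF gi hM]) auto
    then have hi: "integrable lborel h" using h(1) by (simp add: integrable_completion)
    have sub: "(LINT x:box c d|lborel. h x) = (LINT x:box c d \<inter> box a b|lebesgue. g x)" for c d
    proof -
      have "(LINT x:box c d|lborel. h x) = (\<integral>x. indicator (box c d) x *\<^sub>R h x \<partial>lebesgue)"
        unfolding set_lebesgue_integral_def using h(1)
        by (intro integral_completion[symmetric] borel_measurable_scaleR borel_measurable_indicator) auto
      also have "\<dots> = (\<integral>x. indicator (box c d) x *\<^sub>R ?g x \<partial>lebesgue)"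
      proof (rule integral_cong_AE)
        show "AE x in lebesgue. indicator (box c d) x *\<^sub>R h x = indicator (box c d) x *\<^sub>R ?g x"
          using AEh by eventually_elim simp
      qed (intro borel_measurable_scaleR borel_measurable_indicator hM borel_measurable_integrable[OF gi]; simp)+
      finally show ?thesis by (simp add: set_lebesgue_integral_def indicator_inter_arith mult.assoc)
    qed
    have "(LINT x:box c d|lborel. h x) = 0" for c d
    proof -
      obtain c' d' where cd: "box c d \<inter> box a b = box c' d'" using box_Int_box[of c d a b] that by blast
      show ?thesis
      \<comment> \<open>An empty open box can have a nonempty closed counterpart, so taking closures
        yields the closed box only in the nonempty case.\<close>
      proof (cases "box c' d' = {}")
        case True then show ?thesis unfolding sub cd by (simp add: set_lebesgue_integral_def)
      next
        case False
        have sub': "box c' d' \<subseteq> box a b" using cd by blast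
        then have ne: "box a b \<noteq> {}" using False by blast
        have "cbox c' d' \<subseteq> cbox a b"
          using closure_mono[OF sub'] unfolding closure_box[OF ne] closure_box[OF False] .
        then show ?thesis unfolding sub cd using ab by (intro box) auto
      qed
    qed
    moreover have "(\<integral>x. h x \<partial>lborel) = 0"
    proof -
      have "(\<integral>x. h x \<partial>lborel) = (\<integral>x. h x \<partial>lebesgue)"
        using h(1) by (rule integral_completion[symmetric])
      also have "\<dots> = (\<integral>x. ?g x \<partial>lebesgue)"
        using AEh hM gi by (intro integral_cong_AE) auto
      also have "\<dots> = 0" using box[OF ab] by (simp add: set_lebesgue_integral_def)
      finally show ?thesis .
    qed
    ultimately have "AE x in lborel. h x = 0" by (intro integral_zero_on_boxes_imp_AE_zero[OF hi])
    then have "AE x in lebesgue. h x = 0" by (rule AE_completion)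
    with AEh show ?thesis by eventually_elim (auto simp: indicator_def split: if_splits)
  qed
  obtain D where D: "countable D" "D \<subseteq> Pow \<Omega>" "\<And>X. X \<in> D \<Longrightarrow> \<exists>a b. X = cbox a b" "\<Union>D = \<Omega>"
    using open_countable_Union_open_cbox[OF open_\<Omega>] by metis
  have "AE x in lebesgue. x \<in> X \<longrightarrow> g x = 0" if X: "X \<in> D" for X
  proof -
    obtain a b where ab: "X = cbox a b" using D(3)[OF X] by blast
    \<comment> \<open>The cover consists of closed boxes, while \<open>cb\<close> speaks about open
      ones; the difference is a null set.\<close>
    have "AE x in lebesgue. x \<notin> cbox a b - box a b"
      by (intro AE_not_in) (simp add: negligible_frontier_interval flip: negligible_iff_null_sets)
    moreover have "cbox a b \<subseteq> \<Omega>" using D(2) X ab by auto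
    from cb[OF this] have "AE x in lebesgue. x \<in> box a b \<longrightarrow> g x = 0" .
    ultimately show ?thesis unfolding ab by eventually_elim auto
  qed
  then have "AE x in lebesgue. \<forall>X\<in>D. x \<in> X \<longrightarrow> g x = 0"
    using D(1) by (subst AE_ball_countable) auto
  then have "AE x in lebesgue. x \<in> \<Omega> \<longrightarrow> g x = 0"
    using D(4) by (auto elim!: eventually_mono)
  then show ?thesis by (simp add: AE_iff)
qed

lemma weak_grad_unique:
  assumes g: "weak_grad \<Omega> u g" and g': "weak_grad \<Omega> u g'"
  shows "AE x in M. g x = g' x"
proof -
  have "AE x in M. g x $ i - g' x $ i = 0" for i
  proof (rule test_fun_orthogonal_imp_AE_zero)
    show "set_integrable lebesgue C (\<lambda>x. g x $ i - g' x $ i)" if "compact C" "C \<subseteq> \<Omega>" for C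
      using assms that by (auto simp: weak_grad_def)
    fix \<phi> assume \<phi>: "test_fun \<Omega> \<phi>"
    obtain S where S: "compact S" "S \<subseteq> \<Omega>" "\<And>x. x \<notin> S \<Longrightarrow> \<phi> x = 0"
      using test_funE[OF \<phi>] by metis
    obtain B where B: "\<And>x. \<bar>\<phi> x\<bar> \<le> B" using test_fun_bound[OF \<phi>] by metis
    \<comment> \<open>A weak gradient may fail to be integrable over the whole set, but the test
      function is bounded and lives on the compact \<open>S\<close>, where integrability is
      given.\<close>
    have int: "integrable M (\<lambda>x. k x $ i * \<phi> x)" if k: "weak_grad \<Omega> u k" for k
    proof (rule Bochner_Integration.integrable_bound)
      have "integrable lebesgue (\<lambda>x. indicator S x *\<^sub>R k x $ i)"
        using k S by (simp add: weak_grad_def set_integrable_def)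
      then have "integrable M (\<lambda>x. indicator S x *\<^sub>R k x $ i)"
        using integrable_mult_indicator[OF \<Omega>_lebesgue, of "\<lambda>x. indicator S x *\<^sub>R k x $ i"]
        by (subst integrable_restrict_space) simp_all
      then show "integrable M (\<lambda>x. B * (indicator S x *\<^sub>R k x $ i))" by simp
      show "(\<lambda>x. k x $ i * \<phi> x) \<in> borel_measurable M"
        using weak_grad_measurable[OF k] test_fun_measurable_M[OF \<phi>]
        unfolding borel_measurable_vec_iff by (intro borel_measurable_times) auto
      have "\<bar>k x $ i * \<phi> x\<bar> \<le> \<bar>B * (indicator S x *\<^sub>R k x $ i)\<bar>" for x
        using B[of x] S(3)[of x] mult_right_mono[OF order_trans[OF B[of x] abs_ge_self], of "\<bar>k x $ i\<bar>"]
        by (auto simp: indicator_def abs_mult mult.commute)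
      then show "AE x in M. norm (k x $ i * \<phi> x) \<le> norm (B * (indicator S x *\<^sub>R k x $ i))" by simp
    qed
    have e: "(\<integral>x. u x * cgrad \<phi> x $ i \<partial>M) = - (\<integral>x. k x $ i * \<phi> x \<partial>M)" if "weak_grad \<Omega> u k" for k
      using that \<phi> unfolding weak_grad_def set_integral_eq by blast
    show "(\<integral>x. (g x $ i - g' x $ i) * \<phi> x \<partial>M) = 0"
      using int[OF g] int[OF g'] e[OF g] e[OF g'] by (simp add: left_diff_distrib)
  qed
  then have "AE x in M. \<forall>i. g x $ i - g' x $ i = 0" by (simp add: AE_all_countable)
  then show ?thesis by eventually_elim (simp add: vec_eq_iff)
qed

text \<open>\<open>wgrad\<close> is a weak gradient as soon as one exists, and uniqueness then
  identifies it with the gradient carried by \<open>H1g\<close>; integrals of \<open>wgrad\<close>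
  thereby become computable.\<close>

lemma wgrad_AE_eq:
  assumes "H1g u g" shows "AE x in M. wgrad \<Omega> u x = g x" "wgrad \<Omega> u \<in> borel_measurable M"
proof -
  have "weak_grad \<Omega> u (wgrad \<Omega> u)"
    unfolding wgrad_def using someI[of "weak_grad \<Omega> u", OF H1g_imp_weak_grad[OF assms]] .
  then show "AE x in M. wgrad \<Omega> u x = g x" "wgrad \<Omega> u \<in> borel_measurable M"
    using weak_grad_unique[OF _ H1g_imp_weak_grad[OF assms]] weak_grad_measurable by auto
qed

lemma integral_wgrad:
  assumes u: "H1g u g" and v: "H1g v k"
  shows "(LINT x:\<Omega>|lebesgue. wgrad \<Omega> u x \<bullet> wgrad \<Omega> v x) = (\<integral>x. g x \<bullet> k x \<partial>M)"
  unfolding set_integral_eq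
proof (rule integral_cong_AE)
  show "AE x in M. wgrad \<Omega> u x \<bullet> wgrad \<Omega> v x = g x \<bullet> k x"
    using wgrad_AE_eq(1)[OF u] wgrad_AE_eq(1)[OF v] by eventually_elim simp
qed (use wgrad_AE_eq(2)[OF u] wgrad_AE_eq(2)[OF v] H1g_L2[OF u] H1g_L2[OF v] in \<open>auto simp: L2_def\<close>)

end

section \<open>The Dirichlet problem\<close>

context bounded_open_set begin

text \<open>Fixed by choice, so that the constants built from it depend on the set alone.\<close>

definition rad :: real where "rad = (SOME R. 0 < R \<and> (\<forall>x\<in>\<Omega>. norm x \<le> R))"

lemma rad: "0 < rad" "x \<in> \<Omega> \<Longrightarrow> norm x \<le> rad"
proof -
  obtain R where "\<forall>x\<in>\<Omega>. norm x \<le> R" using bounded_\<Omega> by (auto simp: bounded_iff)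
  then have "0 < max R 1 \<and> (\<forall>x\<in>\<Omega>. norm x \<le> max R 1)" by force
  from someI[where P="\<lambda>R. 0 < R \<and> (\<forall>x\<in>\<Omega>. norm x \<le> R)", OF this]
  show "0 < rad" "x \<in> \<Omega> \<Longrightarrow> norm x \<le> rad" unfolding rad_def by auto
qed

lemma H1g_test_fun: "test_fun \<Omega> \<phi> \<Longrightarrow> H1g \<phi> (cgrad \<phi>)"
  unfolding H1g_def by (auto intro!: exI[of _ "\<lambda>n. \<phi>"])

lemma H1g_lincomb:
  assumes u: "H1g u g" and v: "H1g v k"
  shows "H1g (\<lambda>x. u x + c * v x) (\<lambda>x. g x + c *\<^sub>R k x)"
proof -
  note L = H1g_L2[OF u] H1g_L2[OF v]
  obtain \<phi> where \<phi>: "\<And>n. test_fun \<Omega> (\<phi> n)"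
     "(\<lambda>n. l2n M (\<lambda>x. \<phi> n x - u x)) \<longlonglongrightarrow> 0" "(\<lambda>n. l2n M (\<lambda>x. cgrad (\<phi> n) x - g x)) \<longlonglongrightarrow> 0"
    using H1gE[OF u] by blast
  obtain \<psi> where \<psi>: "\<And>n. test_fun \<Omega> (\<psi> n)"
     "(\<lambda>n. l2n M (\<lambda>x. \<psi> n x - v x)) \<longlonglongrightarrow> 0" "(\<lambda>n. l2n M (\<lambda>x. cgrad (\<psi> n) x - k x)) \<longlonglongrightarrow> 0"
    using H1gE[OF v] by blast
  define \<xi> where "\<xi> = (\<lambda>n x. \<phi> n x + c * \<psi> n x)"
  have \<xi>: "test_fun \<Omega> (\<xi> n)" for n
    unfolding \<xi>_def by (intro test_fun_add test_fun_cmult \<phi> \<psi>)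
  have g\<xi>: "cgrad (\<xi> n) x = cgrad (\<phi> n) x + c *\<^sub>R cgrad (\<psi> n) x" for n x
    unfolding \<xi>_def cgrad_add[OF \<phi>(1) test_fun_cmult[OF \<psi>(1)]] cgrad_cmult[OF \<psi>(1)] ..
  have "(\<lambda>n. l2n M (\<lambda>x. \<xi> n x - (u x + c * v x))) \<longlonglongrightarrow> 0"
  proof (rule tendsto_sandwich[OF _ _ tendsto_const])
    show "(\<lambda>n. l2n M (\<lambda>x. \<phi> n x - u x) + \<bar>c\<bar> * l2n M (\<lambda>x. \<psi> n x - v x)) \<longlonglongrightarrow> 0"
      using tendsto_add[OF \<phi>(2) tendsto_mult[OF tendsto_const \<psi>(2), of "\<bar>c\<bar>"]] by simp
    have "l2n M (\<lambda>x. (\<phi> n x - u x) + c *\<^sub>R (\<psi> n x - v x)) \<le> l2n M (\<lambda>x. \<phi> n x - u x) + \<bar>c\<bar> * l2n M (\<lambda>x. \<psi> n x - v x)" for n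
      unfolding l2n_scaleR[symmetric] by (intro l2n_triangle L2_diff L2_scaleR L test_fun_L2[OF \<phi>(1)] test_fun_L2[OF \<psi>(1)])
    moreover have "(\<lambda>x. (\<phi> n x - u x) + c *\<^sub>R (\<psi> n x - v x)) = (\<lambda>x. \<xi> n x - (u x + c * v x))" for n
      by (auto simp: \<xi>_def algebra_simps)
    ultimately show "eventually (\<lambda>n. l2n M (\<lambda>x. \<xi> n x - (u x + c * v x)) \<le> l2n M (\<lambda>x. \<phi> n x - u x) + \<bar>c\<bar> * l2n M (\<lambda>x. \<psi> n x - v x)) sequentially"
      by (simp only: eventually_True)
  qed simp
  moreover have "(\<lambda>n. l2n M (\<lambda>x. cgrad (\<xi> n) x - (g x + c *\<^sub>R k x))) \<longlonglongrightarrow> 0"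
  proof (rule tendsto_sandwich[OF _ _ tendsto_const])
    show "(\<lambda>n. l2n M (\<lambda>x. cgrad (\<phi> n) x - g x) + \<bar>c\<bar> * l2n M (\<lambda>x. cgrad (\<psi> n) x - k x)) \<longlonglongrightarrow> 0"
      using tendsto_add[OF \<phi>(3) tendsto_mult[OF tendsto_const \<psi>(3), of "\<bar>c\<bar>"]] by simp
    have "l2n M (\<lambda>x. (cgrad (\<phi> n) x - g x) + c *\<^sub>R (cgrad (\<psi> n) x - k x)) \<le> l2n M (\<lambda>x. cgrad (\<phi> n) x - g x) + \<bar>c\<bar> * l2n M (\<lambda>x. cgrad (\<psi> n) x - k x)" for n
      unfolding l2n_scaleR[symmetric] by (intro l2n_triangle L2_diff L2_scaleR L cgrad_L2 \<phi> \<psi>)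
    moreover have "(\<lambda>x. (cgrad (\<phi> n) x - g x) + c *\<^sub>R (cgrad (\<psi> n) x - k x)) = (\<lambda>x. cgrad (\<xi> n) x - (g x + c *\<^sub>R k x))" for n
      by (auto simp: g\<xi> algebra_simps)
    ultimately show "eventually (\<lambda>n. l2n M (\<lambda>x. cgrad (\<xi> n) x - (g x + c *\<^sub>R k x)) \<le> l2n M (\<lambda>x. cgrad (\<phi> n) x - g x) + \<bar>c\<bar> * l2n M (\<lambda>x. cgrad (\<psi> n) x - k x)) sequentially"
      by (simp only: eventually_True)
  qed simp
  moreover have "L2 M (\<lambda>x. u x + c * v x)" "L2 M (\<lambda>x. g x + c *\<^sub>R k x)"
    using L by (auto intro: L2_add L2_cmult L2_scaleR)
  ultimately show ?thesis unfolding H1g_def using \<xi> by blast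
qed

lemma H1g_cong_AE:
  assumes u: "H1g u g" and v: "v \<in> borel_measurable M" "AE x in M. u x = v x"
  shows "H1g v g"
proof -
  have "l2n M (\<lambda>x. \<phi> x - v x) = l2n M (\<lambda>x. \<phi> x - u x)" if "test_fun \<Omega> \<phi>" for \<phi>
    using v(2) H1g_L2(1)[OF u] by (intro l2n_cong_AE borel_measurable_diff test_fun_measurable_M[OF that] v(1))
      (auto simp: L2_def elim!: eventually_mono)
  then show ?thesis
    using u L2_cong_AE[OF H1g_L2(1)[OF u] v] unfolding H1g_def by (metis (no_types, lifting) ext)
qed

lemma l2n_test_fun_sq: "test_fun \<Omega> \<phi> \<Longrightarrow> (l2n M \<phi>)\<^sup>2 = (\<integral>x. (\<phi> x)\<^sup>2 \<partial>lborel)"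
  using integral_test_fun[OF test_fun_square] by (simp add: l2n_sq)

lemma l2n_cgrad_sq: "test_fun \<Omega> \<phi> \<Longrightarrow> (l2n M (cgrad \<phi>))\<^sup>2 = (\<integral>x. (norm (cgrad \<phi> x))\<^sup>2 \<partial>lborel)"
  using integral_test_fun[OF test_fun_cgrad_norm_sq] by (simp add: l2n_sq)

lemma poincare_test: 
  assumes "test_fun \<Omega> \<phi>" shows "l2n M \<phi> \<le> 2 * rad * l2n M (cgrad \<phi>)"
proof (rule power2_le_imp_le)
  show "(l2n M \<phi>)\<^sup>2 \<le> (2 * rad * l2n M (cgrad \<phi>))\<^sup>2"
    using poincare_test_fun[OF assms rad(2)]
    unfolding power_mult_distrib l2n_test_fun_sq[OF assms] l2n_cgrad_sq[OF assms] by simp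
qed (use rad(1) in simp)

lemma poincare:
  assumes u: "H1g u g" shows "l2n M u \<le> 2 * rad * l2n M g"
proof -
  obtain \<phi> where \<phi>: "\<And>n. test_fun \<Omega> (\<phi> n)"
     "(\<lambda>n. l2n M (\<lambda>x. \<phi> n x - u x)) \<longlonglongrightarrow> 0" "(\<lambda>n. l2n M (\<lambda>x. cgrad (\<phi> n) x - g x)) \<longlonglongrightarrow> 0"
    using H1gE[OF u] by blast
  have "(\<lambda>n. l2n M (\<phi> n)) \<longlonglongrightarrow> l2n M u"
    by (rule l2n_tendsto[OF test_fun_L2[OF \<phi>(1)] H1g_L2(1)[OF u] \<phi>(2)])
  moreover have "(\<lambda>n. 2 * rad * l2n M (cgrad (\<phi> n))) \<longlonglongrightarrow> 2 * rad * l2n M g"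
    by (intro tendsto_mult tendsto_const l2n_tendsto[OF cgrad_L2[OF \<phi>(1)] H1g_L2(2)[OF u] \<phi>(3)])
  ultimately show ?thesis
    by (rule LIMSEQ_le) (use poincare_test[OF \<phi>(1)] in auto)
qed

text \<open>Weak solutions in \<open>H10\<close> of \<open>- \<Delta> w = f\<close>.\<close>
definition poisson :: "(R3 \<Rightarrow> real) \<Rightarrow> (R3 \<Rightarrow> real) \<Rightarrow> bool" where
  "poisson f w \<longleftrightarrow> L2 M f \<and>
     (\<exists>g. H1g w g \<and> (\<forall>\<psi> k. H1g \<psi> k \<longrightarrow> (\<integral>x. g x \<bullet> k x \<partial>M) = (\<integral>x. f x * \<psi> x \<partial>M)))"

lemma poissonE:
  assumes "poisson f w"
  obtains g where "H1g w g" "\<And>\<psi> k. H1g \<psi> k \<Longrightarrow> (\<integral>x. g x \<bullet> k x \<partial>M) = (\<integral>x. f x * \<psi> x \<partial>M)"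
  using assms unfolding poisson_def by blast

lemma poisson_L2: "poisson f w \<Longrightarrow> L2 M f" "poisson f w \<Longrightarrow> L2 M w"
  using H1g_L2 by (auto simp: poisson_def)

lemma poisson_lincomb:
  assumes "poisson f w" "poisson f' w'"
  shows "poisson (\<lambda>x. f x + c * f' x) (\<lambda>x. w x + c * w' x)"
proof -
  note L = poisson_L2[OF assms(1)] poisson_L2[OF assms(2)]
  obtain g where g: "H1g w g" "\<And>\<psi> k. H1g \<psi> k \<Longrightarrow> (\<integral>x. g x \<bullet> k x \<partial>M) = (\<integral>x. f x * \<psi> x \<partial>M)"
    using poissonE[OF assms(1)] by blast
  obtain g' where g': "H1g w' g'" "\<And>\<psi> k. H1g \<psi> k \<Longrightarrow> (\<integral>x. g' x \<bullet> k x \<partial>M) = (\<integral>x. f' x * \<psi> x \<partial>M)"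
    using poissonE[OF assms(2)] by blast
  have "(\<integral>x. (g x + c *\<^sub>R g' x) \<bullet> k x \<partial>M) = (\<integral>x. (f x + c * f' x) * \<psi> x \<partial>M)" if \<psi>: "H1g \<psi> k" for \<psi> k
  proof -
    note P = H1g_L2[OF \<psi>]
    have "(\<integral>x. (g x + c *\<^sub>R g' x) \<bullet> k x \<partial>M) = (\<integral>x. g x \<bullet> k x \<partial>M) + c * (\<integral>x. g' x \<bullet> k x \<partial>M)"
      using L2_inner_integrable[OF H1g_L2(2)[OF g(1)] P(2)] L2_inner_integrable[OF H1g_L2(2)[OF g'(1)] P(2)]
      by (simp add: inner_add_left)
    also have "\<dots> = (\<integral>x. f x * \<psi> x \<partial>M) + c * (\<integral>x. f' x * \<psi> x \<partial>M)"
      using g(2)[OF \<psi>] g'(2)[OF \<psi>] by simp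
    also have "\<dots> = (\<integral>x. (f x + c * f' x) * \<psi> x \<partial>M)"
      using L2_mult_integrable[OF L(1) P(1)] L2_mult_integrable[OF L(3) P(1)]
      by (simp add: distrib_right mult.assoc)
    finally show ?thesis .
  qed
  then show ?thesis unfolding poisson_def using H1g_lincomb[OF g(1) g'(1), of c] L2_add[OF L(1) L2_cmult[OF L(3)]] by blast
qed

lemma poisson_diff: "poisson f w \<Longrightarrow> poisson f' w' \<Longrightarrow> poisson (\<lambda>x. f x - f' x) (\<lambda>x. w x - w' x)"
  using poisson_lincomb[of f w f' w' "-1"] by simp

lemma poisson_cong_AE:
  assumes p: "poisson f w" and f': "f' \<in> borel_measurable M" "AE x in M. f x = f' x"
    and w': "w' \<in> borel_measurable M" "AE x in M. w x = w' x"
  shows "poisson f' w'"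
proof -
  obtain g where g: "H1g w g" "\<And>\<psi> k. H1g \<psi> k \<Longrightarrow> (\<integral>x. g x \<bullet> k x \<partial>M) = (\<integral>x. f x * \<psi> x \<partial>M)"
    using poissonE[OF p] by blast
  have "(\<integral>x. f x * \<psi> x \<partial>M) = (\<integral>x. f' x * \<psi> x \<partial>M)" if "H1g \<psi> k" for \<psi> k
    using f' poisson_L2(1)[OF p] H1g_L2(1)[OF that]
    by (intro integral_cong_AE) (auto simp: L2_def elim!: eventually_mono)
  then show ?thesis
    unfolding poisson_def using L2_cong_AE[OF poisson_L2(1)[OF p] f'] H1g_cong_AE[OF g(1) w'] g(2) by metis
qed

text \<open>Testing with w gives ||g||^2 <= ||f|| ||w||. Poincare's inequality is used once here and
  once to return from g to w, each time with a factor 2 \<open>rad\<close>. This is the Lipschitz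
  bound of the solution operator behind the contraction.\<close>

lemma poisson_L2_bound:
  assumes p: "poisson f w" shows "l2n M w \<le> 4 * rad\<^sup>2 * l2n M f"
proof -
  obtain g where g: "H1g w g" "\<And>\<psi> k. H1g \<psi> k \<Longrightarrow> (\<integral>x. g x \<bullet> k x \<partial>M) = (\<integral>x. f x * \<psi> x \<partial>M)"
    using poissonE[OF p] by blast
  note P = poincare[OF g(1)]
  have "l2n M g * l2n M g = (\<integral>x. f x * w x \<partial>M)"
    using g(2)[OF g(1)] l2n_sq[of M g] by (simp add: power2_norm_eq_inner flip: power2_eq_square)
  also have "\<dots> \<le> l2n M f * l2n M w"
    using L2_Cauchy_Schwarz_real[OF poisson_L2[OF p]] by simp
  also have "\<dots> \<le> l2n M f * (2 * rad * l2n M g)" using P by (intro mult_left_mono) auto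
  finally have "l2n M g \<le> 2 * rad * l2n M f"
    using rad(1) l2n_nonneg[of M g] l2n_nonneg[of M f]
    by (cases "l2n M g = 0") (auto simp: mult.assoc mult.left_commute intro!: mult_nonneg_nonneg)
  then have "2 * rad * l2n M g \<le> 2 * rad * (2 * rad * l2n M f)" using rad(1) by (intro mult_left_mono) auto
  with P show ?thesis by (simp add: power2_eq_square)
qed

text \<open>Minimise the Dirichlet energy over test functions; by the parallelogram law the gradients of a
  minimising sequence converge.\<close>
lemma poisson_exists:
  assumes f: "L2 M f" shows "\<exists>w. poisson f w"
proof -
  define J where "J = (\<lambda>\<phi>. (l2n M (cgrad \<phi>))\<^sup>2 / 2 - (\<integral>x. f x * \<phi> x \<partial>M))"
  define d where "d = Inf (J ` {\<phi>. test_fun \<Omega> \<phi>})"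
  note fi = L2_mult_integrable[OF f test_fun_L2]
  \<comment> \<open>Completing the square in G^2/2 - c G.\<close>
  have J_lb: "- ((2 * rad * l2n M f)\<^sup>2 / 2) \<le> J \<phi>" if \<phi>: "test_fun \<Omega> \<phi>" for \<phi>
  proof -
    let ?G = "l2n M (cgrad \<phi>)" and ?c = "2 * rad * l2n M f"
    have "(\<integral>x. f x * \<phi> x \<partial>M) \<le> l2n M f * l2n M \<phi>"
      using L2_Cauchy_Schwarz_real[OF f test_fun_L2[OF \<phi>]] by simp
    also have "\<dots> \<le> l2n M f * (2 * rad * ?G)" using poincare_test[OF \<phi>] by (intro mult_left_mono) auto
    finally have "(\<integral>x. f x * \<phi> x \<partial>M) \<le> ?c * ?G" by (simp add: mult_ac)
    moreover have "0 \<le> (?G - ?c)\<^sup>2" by simp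
    ultimately show ?thesis unfolding J_def power2_diff by (simp add: field_simps)
  qed
  have bdd: "bdd_below (J ` {\<phi>. test_fun \<Omega> \<phi>})" using J_lb by (auto intro!: bdd_belowI)
  have d: "d \<le> J \<phi>" if "test_fun \<Omega> \<phi>" for \<phi>
    unfolding d_def using that by (intro cInf_lower[OF _ bdd]) auto
  have "\<exists>\<phi>. test_fun \<Omega> \<phi> \<and> J \<phi> < d + e" if "e > 0" for e
    using cInf_lessD[of "J ` {\<phi>. test_fun \<Omega> \<phi>}" "d + e"] that test_fun_zero unfolding d_def by auto
  then have "\<forall>n. \<exists>\<phi>. test_fun \<Omega> \<phi> \<and> J \<phi> < d + 1 / real (Suc n)" by simp
  then obtain \<phi> where \<phi>: "\<And>n. test_fun \<Omega> (\<phi> n)" and J\<phi>: "\<And>n. J (\<phi> n) < d + 1 / real (Suc n)"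
    by metis
  have diff_eq: "cgrad (\<lambda>x. \<phi> n x + (-1) * \<phi> m x) x = cgrad (\<phi> n) x - cgrad (\<phi> m) x" for n m x
    unfolding cgrad_add[OF \<phi> test_fun_cmult[OF \<phi>]] cgrad_cmult[OF \<phi>] by simp
  \<comment> \<open>The midpoint of two members is again a competitor, so J there is at least d. By
    the parallelogram identity the squared distance of the gradients equals 4 J + 4 J - 8
    J(midpoint), which leaves only the excesses over d.\<close>
  have par: "(l2n M (\<lambda>x. cgrad (\<phi> n) x - cgrad (\<phi> m) x))\<^sup>2 \<le> 4 / real (Suc n) + 4 / real (Suc m)" for n m
  proof -
    let ?h = "\<lambda>x. (1/2) * (\<phi> n x + \<phi> m x)"
    have h: "test_fun \<Omega> ?h" by (intro test_fun_cmult test_fun_add \<phi>)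
    have "cgrad ?h x = (1/2) *\<^sub>R (cgrad (\<phi> n) x + cgrad (\<phi> m) x)" for x
      unfolding cgrad_cmult[OF test_fun_add[OF \<phi> \<phi>]] cgrad_add[OF \<phi> \<phi>] ..
    then have "cgrad ?h = (\<lambda>x. (1/2) *\<^sub>R (cgrad (\<phi> n) x + cgrad (\<phi> m) x))" by auto
    then have A: "(l2n M (cgrad ?h))\<^sup>2 = (l2n M (\<lambda>x. cgrad (\<phi> n) x + cgrad (\<phi> m) x))\<^sup>2 / 4"
      by (simp only: l2n_scaleR power_mult_distrib) (simp add: power2_eq_square)
    have B: "(\<integral>x. f x * ?h x \<partial>M) = ((\<integral>x. f x * \<phi> n x \<partial>M) + (\<integral>x. f x * \<phi> m x \<partial>M)) / 2"
      using fi[OF \<phi>(1)[of n]] fi[OF \<phi>(1)[of m]] by (simp add: distrib_left)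
    have Jh: "8 * J ?h = (l2n M (\<lambda>x. cgrad (\<phi> n) x + cgrad (\<phi> m) x))\<^sup>2
        - 4 * ((\<integral>x. f x * \<phi> n x \<partial>M) + (\<integral>x. f x * \<phi> m x \<partial>M))"
      unfolding J_def A B by (simp add: field_simps)
    note L = cgrad_L2[OF \<phi>(1)[of n]] cgrad_L2[OF \<phi>(1)[of m]]
    have "(l2n M (\<lambda>x. cgrad (\<phi> n) x + (-1) *\<^sub>R cgrad (\<phi> m) x))\<^sup>2 =
       (l2n M (cgrad (\<phi> n)))\<^sup>2 + 2 * (\<integral>x. cgrad (\<phi> n) x \<bullet> ((-1) *\<^sub>R cgrad (\<phi> m) x) \<partial>M)
        + (l2n M (\<lambda>x. (-1) *\<^sub>R cgrad (\<phi> m) x))\<^sup>2"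
      by (rule l2n_add_sq[OF L(1) L2_scaleR[OF L(2)]])
    then have "(l2n M (\<lambda>x. cgrad (\<phi> n) x - cgrad (\<phi> m) x))\<^sup>2 + (l2n M (\<lambda>x. cgrad (\<phi> n) x + cgrad (\<phi> m) x))\<^sup>2
       = 2 * (l2n M (cgrad (\<phi> n)))\<^sup>2 + 2 * (l2n M (cgrad (\<phi> m)))\<^sup>2"
      using l2n_add_sq[OF L] l2n_scaleR[of M "-1" "cgrad (\<phi> m)"] by simp
    then have "(l2n M (\<lambda>x. cgrad (\<phi> n) x - cgrad (\<phi> m) x))\<^sup>2 = 4 * J (\<phi> n) + 4 * J (\<phi> m) - 8 * J ?h"
      unfolding Jh by (simp add: J_def field_simps)
    then show ?thesis using d[OF h] J\<phi>[of n] J\<phi>[of m] by simp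
  qed
  have gC: "\<exists>N. \<forall>i\<ge>N. \<forall>j\<ge>N. l2n M (\<lambda>x. cgrad (\<phi> i) x - cgrad (\<phi> j) x) < e" if e: "e > 0" for e
  proof -
    \<comment> \<open>Two terms of size at most 4/N each must stay below e^2.\<close>
    obtain N where N: "8 / e\<^sup>2 < real N" using reals_Archimedean2 by blast
    have "l2n M (\<lambda>x. cgrad (\<phi> i) x - cgrad (\<phi> j) x) < e" if "i \<ge> N" "j \<ge> N" for i j
    proof -
      have N0: "real N > 0" using N e by (smt (verit) divide_nonneg_nonneg zero_le_power2)
      have "4 / real (Suc i) \<le> 4 / real N" "4 / real (Suc j) \<le> 4 / real N"
        using that N0 by (auto intro!: divide_left_mono)
      moreover have "8 / real N < e\<^sup>2" using N N0 e by (simp add: field_simps)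
      ultimately have "(l2n M (\<lambda>x. cgrad (\<phi> i) x - cgrad (\<phi> j) x))\<^sup>2 < e\<^sup>2"
        using par[of i j] by simp
      then show ?thesis using e by (intro power2_less_imp_less[of _ e]) auto
    qed
    then show ?thesis by blast
  qed
  have uC: "\<exists>N. \<forall>i\<ge>N. \<forall>j\<ge>N. l2n M (\<lambda>x. \<phi> i x - \<phi> j x) < e" if e: "e > 0" for e
  proof -
    obtain N where N: "\<And>i j. i \<ge> N \<Longrightarrow> j \<ge> N \<Longrightarrow> l2n M (\<lambda>x. cgrad (\<phi> i) x - cgrad (\<phi> j) x) < e / (2 * rad)"
    proof -
      have "e / (2 * rad) > 0" using e rad(1) by simp
      from gC[OF this] that show ?thesis by blast
    qed
    have "l2n M (\<lambda>x. \<phi> i x - \<phi> j x) < e" if "i \<ge> N" "j \<ge> N" for i j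
    proof -
      have "test_fun \<Omega> (\<lambda>x. \<phi> i x + (-1) * \<phi> j x)" by (intro test_fun_add test_fun_cmult \<phi>)
      from poincare_test[OF this] have "l2n M (\<lambda>x. \<phi> i x - \<phi> j x) \<le> 2 * rad * l2n M (\<lambda>x. cgrad (\<phi> i) x - cgrad (\<phi> j) x)"
        unfolding diff_eq[abs_def] by simp
      also have "\<dots> < e" using N[OF that] rad(1) by (simp add: field_simps)
      finally show ?thesis .
    qed
    then show ?thesis by blast
  qed
  obtain g where g: "L2 M g" "(\<lambda>n. l2n M (\<lambda>x. cgrad (\<phi> n) x - g x)) \<longlonglongrightarrow> 0"
    using L2_complete[OF cgrad_L2[OF \<phi>] gC] by blast
  obtain w where w: "L2 M w" "(\<lambda>n. l2n M (\<lambda>x. \<phi> n x - w x)) \<longlonglongrightarrow> 0"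
    using L2_complete[OF test_fun_L2[OF \<phi>] uC] by blast
  have H: "H1g w g" unfolding H1g_def using \<phi> g w by blast
  \<comment> \<open>The limit w need not be a test function, so the variation is applied along the
    minimising sequence: its perturbation by t \<psi> has energy at least d, which exceeds the
    unperturbed energy minus 1/(n+1); then n tends to infinity.\<close>
  have EL: "(\<integral>x. g x \<bullet> cgrad \<psi> x \<partial>M) = (\<integral>x. f x * \<psi> x \<partial>M)" if \<psi>: "test_fun \<Omega> \<psi>" for \<psi>
  proof -
    define D where "D = (l2n M (cgrad \<psi>))\<^sup>2"
    define L where "L = (\<integral>x. g x \<bullet> cgrad \<psi> x \<partial>M) - (\<integral>x. f x * \<psi> x \<partial>M)"
    have lim: "(\<lambda>n. \<integral>x. cgrad (\<phi> n) x \<bullet> cgrad \<psi> x \<partial>M) \<longlonglongrightarrow> (\<integral>x. g x \<bullet> cgrad \<psi> x \<partial>M)"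
      by (rule integral_inner_tendsto[OF cgrad_L2[OF \<phi>] g(1) cgrad_L2[OF \<psi>] g(2)])
    have "0 \<le> t * L + t\<^sup>2 * D / 2" for t
    proof -
      have "(\<lambda>n. 1 / real (Suc n) + t * ((\<integral>x. cgrad (\<phi> n) x \<bullet> cgrad \<psi> x \<partial>M) - (\<integral>x. f x * \<psi> x \<partial>M)) + t\<^sup>2 * D / 2)
         \<longlonglongrightarrow> 0 + t * ((\<integral>x. g x \<bullet> cgrad \<psi> x \<partial>M) - (\<integral>x. f x * \<psi> x \<partial>M)) + t\<^sup>2 * D / 2"
        by (intro tendsto_intros lim LIMSEQ_Suc lim_1_over_n)
      moreover have "0 \<le> 1 / real (Suc n) + t * ((\<integral>x. cgrad (\<phi> n) x \<bullet> cgrad \<psi> x \<partial>M) - (\<integral>x. f x * \<psi> x \<partial>M)) + t\<^sup>2 * D / 2" for n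
      proof -
        let ?h = "\<lambda>x. \<phi> n x + t * \<psi> x"
        have h: "test_fun \<Omega> ?h" by (intro test_fun_cmult test_fun_add \<phi> \<psi>)
        have "cgrad ?h = (\<lambda>x. cgrad (\<phi> n) x + t *\<^sub>R cgrad \<psi> x)"
          by (intro ext) (simp only: cgrad_add[OF \<phi> test_fun_cmult[OF \<psi>]] cgrad_cmult[OF \<psi>])
        then have "(l2n M (cgrad ?h))\<^sup>2 = (l2n M (cgrad (\<phi> n)))\<^sup>2 + 2 * (\<integral>x. cgrad (\<phi> n) x \<bullet> (t *\<^sub>R cgrad \<psi> x) \<partial>M)
            + (l2n M (\<lambda>x. t *\<^sub>R cgrad \<psi> x))\<^sup>2"
          by (simp only: l2n_add_sq[OF cgrad_L2[OF \<phi>] L2_scaleR[OF cgrad_L2[OF \<psi>]]])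
        then have "(l2n M (cgrad ?h))\<^sup>2 = (l2n M (cgrad (\<phi> n)))\<^sup>2 + 2 * t * (\<integral>x. cgrad (\<phi> n) x \<bullet> cgrad \<psi> x \<partial>M) + t\<^sup>2 * D"
          by (simp add: l2n_scaleR power_mult_distrib D_def)
        moreover have "(\<integral>x. f x * ?h x \<partial>M) = (\<integral>x. f x * \<phi> n x \<partial>M) + t * (\<integral>x. f x * \<psi> x \<partial>M)"
          using fi[OF \<phi>(1)[of n]] fi[OF \<psi>] by (simp add: distrib_left mult.left_commute)
        ultimately have "J ?h = J (\<phi> n) + t * ((\<integral>x. cgrad (\<phi> n) x \<bullet> cgrad \<psi> x \<partial>M) - (\<integral>x. f x * \<psi> x \<partial>M)) + t\<^sup>2 * D / 2"
          by (simp add: J_def field_simps)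
        then show ?thesis using d[OF h] J\<phi>[of n] by linarith
      qed
      ultimately have "0 \<le> 0 + t * ((\<integral>x. g x \<bullet> cgrad \<psi> x \<partial>M) - (\<integral>x. f x * \<psi> x \<partial>M)) + t\<^sup>2 * D / 2"
        by (intro LIMSEQ_le_const) blast+
      then show ?thesis by (simp add: L_def)
    qed
    \<comment> \<open>The minimum of t L + t^2 D/2 is at t = -L/D; D + 1 avoids a vanishing
      denominator and still gives a negative value unless L = 0.\<close>
    from this[of "- L / (D + 1)"] have "0 \<le> (- L / (D + 1)) * L + (- L / (D + 1))\<^sup>2 * D / 2" .
    also have "\<dots> = - (L\<^sup>2 * (D + 2)) / (2 * (D + 1)\<^sup>2)"
    proof -
      have "D + 1 \<noteq> 0" by (simp add: D_def add_nonneg_pos less_imp_neq[symmetric])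
      then show ?thesis by (simp add: divide_simps power2_eq_square) (simp add: algebra_simps)
    qed
    finally have "0 \<le> - (L\<^sup>2 * (D + 2)) / (2 * (D + 1)\<^sup>2)" .
    moreover have "0 < 2 * (D + 1)\<^sup>2" using zero_less_power[of "D + 1" 2] by (simp add: D_def add_nonneg_pos)
    ultimately have "0 \<le> - (L\<^sup>2 * (D + 2))" by (metis not_less divide_neg_pos)
    then have "L\<^sup>2 * (D + 2) \<le> 0" by linarith
    moreover have "D + 2 > 0" by (simp add: D_def add_nonneg_pos)
    ultimately have "L = 0" by (smt (verit) mult_pos_pos zero_less_power2)
    then show ?thesis by (simp add: L_def)
  qed
  \<comment> \<open>Density extends the equation from test functions to all of
    \<open>H10\<close>.\<close>
  have "(\<integral>x. g x \<bullet> k x \<partial>M) = (\<integral>x. f x * \<psi> x \<partial>M)" if \<psi>: "H1g \<psi> k" for \<psi> k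
  proof -
    obtain \<xi> where \<xi>: "\<And>n. test_fun \<Omega> (\<xi> n)"
       "(\<lambda>n. l2n M (\<lambda>x. \<xi> n x - \<psi> x)) \<longlonglongrightarrow> 0" "(\<lambda>n. l2n M (\<lambda>x. cgrad (\<xi> n) x - k x)) \<longlonglongrightarrow> 0"
      using H1gE[OF \<psi>] by blast
    note L = H1g_L2[OF \<psi>]
    have "(\<lambda>n. \<integral>x. cgrad (\<xi> n) x \<bullet> g x \<partial>M) \<longlonglongrightarrow> (\<integral>x. k x \<bullet> g x \<partial>M)"
      by (rule integral_inner_tendsto[OF cgrad_L2[OF \<xi>(1)] L(2) g(1) \<xi>(3)])
    moreover have "(\<lambda>n. \<integral>x. \<xi> n x * f x \<partial>M) \<longlonglongrightarrow> (\<integral>x. \<psi> x * f x \<partial>M)"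
      by (rule integral_mult_tendsto[OF test_fun_L2[OF \<xi>(1)] L(1) f \<xi>(2)])
    ultimately show ?thesis
      using EL[OF \<xi>(1)] by (simp add: inner_commute mult.commute LIMSEQ_unique)
  qed
  then show ?thesis unfolding poisson_def using f H by blast
qed

end

section \<open>The sup bound\<close>

text \<open>The test function \<open>Phi\<close> is bounded, its derivative dominates \<open>(Psi')\<^sup>2\<close> up to a constant, and yet
  \<open>Psi\<^sup>4\<close> grows faster than \<open>\<bar>t\<bar>\<close> to the power \<open>3/2\<close>, the exponent dual to 3. Writing them in terms of
  \<open>qf\<close>, with \<open>qf t ^ 10 = 1 + t\<^sup>2\<close>, makes all estimates rational.\<close>
definition qf :: "real \<Rightarrow> real" where "qf t = (1 + t\<^sup>2) powr (1 / 10)"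
definition Phi :: "real \<Rightarrow> real" where "Phi t = t * inverse (qf t ^ 5 + qf t ^ 4)"
definition Psi :: "real \<Rightarrow> real" where "Psi t = t * inverse (qf t ^ 3)"
definition Phi' :: "real \<Rightarrow> real" where
  "Phi' t = (qf t ^ 10 + 5 * qf t + 4) / (5 * qf t ^ 14 * (qf t + 1)\<^sup>2)"
definition Psi' :: "real \<Rightarrow> real" where "Psi' t = (2 * qf t ^ 10 + 3) / (5 * qf t ^ 13)"

lemma qf_ge_1: "1 \<le> qf t"
  by (simp add: qf_def ge_one_powr_ge_zero)

lemma qf_power: "qf t ^ n = (1 + t\<^sup>2) powr (real n / 10)"
proof -
  have "1 + t\<^sup>2 > 0" by (simp add: add_pos_nonneg)
  then show ?thesis by (simp add: qf_def powr_power)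
qed

lemma qf_power_10: "qf t ^ 10 = 1 + t\<^sup>2"
  by (simp add: qf_power add_nonneg_nonneg)

lemma qf_deriv: "(qf has_real_derivative t / (5 * qf t ^ 9)) (at t)"
proof -
  have pos: "1 + t\<^sup>2 > 0" by (simp add: add_pos_nonneg)
  have "(qf has_real_derivative (1 / 10) * (1 + t\<^sup>2) powr (1 / 10 - 1) * (2 * t)) (at t)"
    unfolding qf_def[abs_def] using pos by (auto intro!: derivative_eq_intros)
  moreover have "(1 + t\<^sup>2) powr (1 / 10 - 1) = inverse (qf t ^ 9)"
    by (simp add: qf_power powr_minus[symmetric])
  ultimately show ?thesis by (simp add: field_simps)
qed

text \<open>Quotient rule for t / s(t) with t s' prescribed as a fraction. The derivative of
  \<open>qf\<close> contains a factor t, so t s' contains t^2 = q^10 - 1, and the outcome is a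
  rational function of q free of t.\<close>

lemma has_real_derivative_ident_div:
  fixes s :: "real \<Rightarrow> real"
  assumes "(s has_real_derivative s') (at t)" "s t \<noteq> 0" "y \<noteq> 0" "t * s' = z / y"
  shows "((\<lambda>t. t * inverse (s t)) has_real_derivative (s t * y - z) / (y * (s t)\<^sup>2)) (at t)"
proof -
  have *: "(s t * y - z) / (y * (s t)\<^sup>2) = 1 * inverse (s t) + - (inverse (s t) * s' * inverse (s t)) * t"
  proof -
    have "(s t * y - z) / (y * (s t)\<^sup>2) = (s t - z / y) / (s t)\<^sup>2"
      using assms(2,3) by (simp add: field_simps)
    also have "\<dots> = (s t - t * s') / (s t)\<^sup>2" by (simp only: assms(4))
    also have "\<dots> = 1 * inverse (s t) + - (inverse (s t) * s' * inverse (s t)) * t"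
      using assms(2) by (simp add: field_simps power2_eq_square)
    finally show ?thesis .
  qed
  show ?thesis unfolding * by (rule DERIV_mult[OF DERIV_ident DERIV_inverse'[OF assms(1,2)]])
qed

lemma Phi_deriv: "(Phi has_real_derivative Phi' t) (at t)"
proof -
  define q where "q = qf t"
  have q: "q \<ge> 1" "q > 0" and t2: "t * t = q ^ 10 - 1"
    using qf_ge_1[of t] qf_power_10[of t] by (auto simp: q_def power2_eq_square)
  have s: "qf t ^ 5 + qf t ^ 4 \<noteq> 0" using q by (simp add: q_def add_pos_pos less_imp_neq[symmetric])
  have "((\<lambda>t. qf t ^ 5 + qf t ^ 4) has_real_derivative (5 * q ^ 4 + 4 * q ^ 3) * (t / (5 * q ^ 9))) (at t)"
  proof -
    have "((\<lambda>t. qf t ^ 5 + qf t ^ 4) has_real_derivative (5 * q ^ 4 + 4 * q ^ 3) * r) (at t)"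
      if "(qf has_real_derivative r) (at t)" for r
      using that by (auto intro!: derivative_eq_intros simp: q_def distrib_right)
    from this[OF qf_deriv] show ?thesis by (simp only: q_def)
  qed
  moreover have "t * ((5 * q ^ 4 + 4 * q ^ 3) * (t / (5 * q ^ 9))) = ((q ^ 10 - 1) * (5 * q ^ 4 + 4 * q ^ 3)) / (5 * q ^ 9)"
    unfolding t2[symmetric] by simp
  ultimately have "(Phi has_real_derivative
     ((q ^ 5 + q ^ 4) * (5 * q ^ 9) - (q ^ 10 - 1) * (5 * q ^ 4 + 4 * q ^ 3)) / (5 * q ^ 9 * (q ^ 5 + q ^ 4)\<^sup>2)) (at t)"
    unfolding Phi_def[abs_def] q_def using s q unfolding q_def
    by (intro has_real_derivative_ident_div) auto
  also have "((q ^ 5 + q ^ 4) * (5 * q ^ 9) - (q ^ 10 - 1) * (5 * q ^ 4 + 4 * q ^ 3)) / (5 * q ^ 9 * (q ^ 5 + q ^ 4)\<^sup>2)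
      = (q ^ 3 * (q ^ 10 + 5 * q + 4)) / (q ^ 3 * (5 * q ^ 14 * (q + 1)\<^sup>2))"
    by (rule arg_cong2[where f="(/)"]) algebra+
  also have "\<dots> = Phi' t" using q unfolding Phi'_def q_def[symmetric] by simp
  finally show ?thesis .
qed

lemma Psi_deriv: "(Psi has_real_derivative Psi' t) (at t)"
proof -
  define q where "q = qf t"
  have q: "q \<ge> 1" "q > 0" and t2: "t * t = q ^ 10 - 1"
    using qf_ge_1[of t] qf_power_10[of t] by (auto simp: q_def power2_eq_square)
  have "((\<lambda>t. qf t ^ 3) has_real_derivative 3 * q ^ 2 * (t / (5 * q ^ 9))) (at t)"
    by (auto intro!: derivative_eq_intros qf_deriv simp: q_def)
  moreover have "t * (3 * q ^ 2 * (t / (5 * q ^ 9))) = ((q ^ 10 - 1) * (3 * q ^ 2)) / (5 * q ^ 9)"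
    unfolding t2[symmetric] by simp
  ultimately have "(Psi has_real_derivative
     (q ^ 3 * (5 * q ^ 9) - (q ^ 10 - 1) * (3 * q ^ 2)) / (5 * q ^ 9 * (q ^ 3)\<^sup>2)) (at t)"
    unfolding Psi_def[abs_def] q_def using q unfolding q_def
    by (intro has_real_derivative_ident_div) auto
  also have "(q ^ 3 * (5 * q ^ 9) - (q ^ 10 - 1) * (3 * q ^ 2)) / (5 * q ^ 9 * (q ^ 3)\<^sup>2)
      = (q ^ 2 * (2 * q ^ 10 + 3)) / (q ^ 2 * (5 * q ^ 13))"
    by (rule arg_cong2[where f="(/)"]) algebra+
  also have "\<dots> = Psi' t" using q unfolding Psi'_def q_def[symmetric] by simp
  finally show ?thesis .
qed

text \<open>For large t the quantity q = \<open>qf t\<close> has size |t|^(1/5), and |Phi|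
  approaches 1 with a gap of order 1/q, so the slope has order q^-6. The lower bound pays for
  \<open>Psi'\<close>; the upper bound ensures that composition with \<open>Phi\<close> does not
  enlarge gradients.\<close>

lemma Phi'_bounds: "1 / (20 * qf t ^ 6) \<le> Phi' t" "Phi' t \<le> 1" "0 \<le> Phi' t"
proof -
  define q where "q = qf t"
  have q: "q \<ge> 1" "q > 0" using qf_ge_1[of t] by (auto simp: q_def)
  have "(q + 1)\<^sup>2 \<le> (2 * q)\<^sup>2" using q by (intro power_mono) auto
  then have "(q + 1)\<^sup>2 \<le> 4 * q ^ 2" by (simp add: power_mult_distrib)
  then have "5 * q ^ 14 * (q + 1)\<^sup>2 \<le> 5 * q ^ 14 * (4 * q ^ 2)" using q by (intro mult_left_mono) auto
  then have "q ^ 10 / (5 * q ^ 14 * (4 * q ^ 2)) \<le> Phi' t"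
    unfolding Phi'_def q_def[symmetric] using q by (intro frac_le) auto
  moreover have "q ^ 10 / (5 * q ^ 14 * (4 * q ^ 2)) = 1 / (20 * q ^ 6)"
    using q by (simp add: field_simps flip: power_add)
  ultimately show "1 / (20 * qf t ^ 6) \<le> Phi' t" by (simp add: q_def)
  have "q \<le> q ^ 10" "1 \<le> q ^ 10" using q self_le_power[of q 10] one_le_power[of q 10] by auto
  then have "q ^ 10 + 5 * q + 4 \<le> 10 * q ^ 10" by linarith
  also have "\<dots> \<le> 10 * q ^ 14" using q power_increasing[of 10 14 q] by simp
  also have "\<dots> \<le> 5 * q ^ 14 * (q + 1)\<^sup>2"
  proof -
    have "2 \<le> (q + 1)\<^sup>2" using q power_mono[of 2 "q + 1" 2] by simp
    from mult_left_mono[OF this, of "5 * q ^ 14"] q show ?thesis by simp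
  qed
  finally show "Phi' t \<le> 1" unfolding Phi'_def q_def[symmetric] using q by (simp add: divide_le_eq_1)
  show "0 \<le> Phi' t" unfolding Phi'_def q_def[symmetric] using q by simp
qed

text \<open>From 2 q^10 + 3 <= 5 q^10 one gets Psi' <= q^-3, whose square has exactly the order of
  \<open>Phi'\<close>; the 20 is that of \<open>Phi'_bounds\<close>.\<close>

lemma Psi'_sq_le: "(Psi' t)\<^sup>2 \<le> 20 * Phi' t"
proof -
  define q where "q = qf t"
  have q: "q \<ge> 1" "q > 0" using qf_ge_1[of t] by (auto simp: q_def)
  have "1 \<le> q ^ 10" using q by simp
  then have "Psi' t \<le> (5 * q ^ 10) / (5 * q ^ 13)"
    unfolding Psi'_def q_def[symmetric] using q by (intro divide_right_mono) auto
  also have "\<dots> = 1 / q ^ 3" using q by (simp add: field_simps power_add[symmetric])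
  finally have "(Psi' t)\<^sup>2 \<le> (1 / q ^ 3)\<^sup>2"
    using q by (intro power_mono) (auto simp: Psi'_def q_def[symmetric])
  also have "\<dots> = 20 * (1 / (20 * q ^ 6))" by (simp add: power_divide flip: power_mult)
  also have "\<dots> \<le> 20 * Phi' t" using Phi'_bounds(1)[of t] by (simp add: q_def)
  finally show ?thesis .
qed

lemma abs_le_qf: "\<bar>t\<bar> \<le> qf t ^ 5"
proof (rule power2_le_imp_le)
  have "(qf t ^ 5)\<^sup>2 = 1 + t\<^sup>2" using qf_power_10[of t] by (simp flip: power_mult)
  then show "\<bar>t\<bar>\<^sup>2 \<le> (qf t ^ 5)\<^sup>2" by simp
qed (use qf_ge_1[of t] in simp)

lemma Phi_bound: "\<bar>Phi t\<bar> \<le> 1"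
proof -
  have q: "qf t > 0" using qf_ge_1[of t] by simp
  then have "\<bar>t\<bar> \<le> qf t ^ 5 + qf t ^ 4" using abs_le_qf[of t] by (simp add: add_increasing2)
  moreover have "qf t ^ 5 + qf t ^ 4 > 0" using q by (simp add: add_pos_pos)
  ultimately show ?thesis by (simp add: Phi_def abs_mult divide_inverse[symmetric])
qed

text \<open>q^20 = (1 + t^2)^2 is at most 2 + 2 t^4, and t^4 / q^12 is the fourth power of
  \<open>Psi\<close>. So an L^4 bound on \<open>Psi\<close> controls q^8, of order |t|^(8/5), just
  above the required 3/2.\<close>

lemma qf_power_8_le: "qf t ^ 8 \<le> 2 + 2 * Psi t ^ 4"
proof -
  define q where "q = qf t"
  have q: "q \<ge> 1" "q > 0" and t2: "q ^ 10 = 1 + t\<^sup>2"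
    using qf_ge_1[of t] qf_power_10[of t] by (auto simp: q_def)
  have "q ^ 8 * q ^ 12 = (1 + t\<^sup>2)\<^sup>2" unfolding t2[symmetric] by (simp flip: power_add power_mult)
  also have "\<dots> \<le> 2 + 2 * t ^ 4"
  proof -
    have "0 \<le> (1 - t\<^sup>2)\<^sup>2" by simp
    then show ?thesis by (simp add: power2_eq_square power4_eq_xxxx algebra_simps)
  qed
  also have "\<dots> \<le> 2 * q ^ 12 + 2 * t ^ 4" using q by simp
  finally have "q ^ 8 \<le> (2 * q ^ 12 + 2 * t ^ 4) / q ^ 12" using q by (subst pos_le_divide_eq) auto
  also have "\<dots> = 2 + 2 * Psi t ^ 4"
    using q unfolding Psi_def q_def[symmetric] by (simp add: power_mult_distrib field_simps flip: power_mult)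
  finally show ?thesis by (simp add: q_def)
qed

text \<open>A Young inequality with exponents 3 and 3/2, the latter power of |t| being dominated by
  q^8. The threshold a = q^3 balances the terms: below it |t| <= q^5 gives q^8, above it |t| <= q^6
  <= a^2 gives a^3.\<close>

lemma young_qf: 
  assumes "0 \<le> a" shows "a * \<bar>t\<bar> \<le> a ^ 3 + qf t ^ 8"
proof (cases "a \<le> qf t ^ 3")
  case True
  then have "a * \<bar>t\<bar> \<le> qf t ^ 3 * qf t ^ 5" using assms abs_le_qf[of t] qf_ge_1[of t] by (intro mult_mono) auto
  then show ?thesis using assms by (simp add: add_increasing flip: power_add)
next
  case False
  have q: "qf t \<ge> 1" by (rule qf_ge_1)
  have "\<bar>t\<bar> \<le> qf t ^ 6" using abs_le_qf[of t] power_increasing[of 5 6 "qf t"] q by simp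
  also have "\<dots> = (qf t ^ 3)\<^sup>2" by (simp flip: power_mult)
  also have "\<dots> \<le> a\<^sup>2" using False q by (intro power_mono) auto
  finally have "a * \<bar>t\<bar> \<le> a * a\<^sup>2" using assms by (intro mult_left_mono)
  then show ?thesis using q by (simp add: power3_eq_cube power2_eq_square add_increasing2)
qed

section \<open>Composing test functions with the auxiliary functions\<close>

lemma Ck_power: "f \<in> Ck k UNIV \<Longrightarrow> (\<lambda>x. f x ^ n) \<in> Ck k UNIV"
  by (induction n) (auto intro: Ck_const Ck_mult)

lemma Ck_inverse:
  assumes "f \<in> Ck k UNIV" "\<And>x. f x > 0" shows "(\<lambda>x. inverse (f x)) \<in> Ck k UNIV"
  using Ck_powr[OF assms, of "-1"] assms(2) by (simp add: powr_minus less_imp_le)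

lemma Ck_qf: "f \<in> Ck k UNIV \<Longrightarrow> (\<lambda>x. qf (f x)) \<in> Ck k UNIV"
  unfolding qf_def by (intro Ck_powr Ck_add Ck_const Ck_power) (auto simp: add_pos_nonneg)

lemma
  assumes f: "test_fun \<Omega> f"
  shows test_fun_Phi: "test_fun \<Omega> (\<lambda>x. Phi (f x))" and test_fun_Psi: "test_fun \<Omega> (\<lambda>x. Psi (f x))"
proof -
  have q: "qf t > 0" for t using qf_ge_1[of t] by simp
  show "test_fun \<Omega> (\<lambda>x. Phi (f x))" unfolding Phi_def
    by (intro test_fun_mult[OF f] Ck_inverse Ck_add Ck_power Ck_qf test_fun_Ck[OF f]) (auto intro!: add_pos_pos zero_less_power q)
  show "test_fun \<Omega> (\<lambda>x. Psi (f x))" unfolding Psi_def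
    by (intro test_fun_mult[OF f] Ck_inverse Ck_add Ck_power Ck_qf test_fun_Ck[OF f]) (auto intro: q)
qed

lemma cgrad_compose:
  assumes "test_fun \<Omega> f" "\<And>t. (F has_real_derivative F' t) (at t)"
  shows "cgrad (\<lambda>x. F (f x)) x = F' (f x) *\<^sub>R cgrad f x"
  using partial_compose(1)[OF test_fun_differentiable[OF assms(1)] assms(2)] by (simp add: vec_eq_iff)

context bounded_open_set begin

text \<open>The first factors are the constant of \<open>integral_power4_le\<close> for radius
  \<open>rad\<close>. The 40 bounds the Dirichlet integral of the composition with
  \<open>Psi\<close>: 20 from \<open>Psi'_sq_le\<close> times the energy bound 2.\<close>

definition C4 :: real where "C4 = 4 * (4 * rad\<^sup>2 + 1) * 40\<^sup>2"
definition Cq :: real where "Cq = 2 * measure M (space M) + 2 * C4"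
text \<open>The dual estimate yields 1 + \<open>Cq\<close>; the factor 2 leaves the gap on which the
  contradiction in \<open>poisson_upper_bound\<close> rests.\<close>

definition Csup :: real where "Csup = 2 * (1 + Cq)"

lemma Cq_nonneg: "0 \<le> Cq"
  by (auto simp: Cq_def C4_def intro!: add_nonneg_nonneg mult_nonneg_nonneg)

text \<open>By the chain rule and \<open>Psi'_sq_le\<close>, the Dirichlet integral of the
  composition with \<open>Psi\<close> is at most 20 times the pairing in \<open>E\<close>; the L^4
  estimate and \<open>qf_power_8_le\<close> then apply. The 2 in \<open>E\<close> is a unit of mass
  plus room for an approximation error.\<close>

lemma integral_qf8_le:
  assumes \<phi>: "test_fun \<Omega> \<phi>"
    and E: "(\<integral>x. cgrad \<phi> x \<bullet> cgrad (\<lambda>x. Phi (\<phi> x)) x \<partial>M) \<le> 2"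
  shows "integrable M (\<lambda>x. qf (\<phi> x) ^ 8)" "(\<integral>x. qf (\<phi> x) ^ 8 \<partial>M) \<le> Cq"
proof -
  let ?\<psi> = "\<lambda>x. Psi (\<phi> x)"
  have \<psi>: "test_fun \<Omega> ?\<psi>" by (rule test_fun_Psi[OF \<phi>])
  have \<psi>4: "test_fun \<Omega> (\<lambda>x. ?\<psi> x ^ 4)" using test_fun_power[OF \<psi>, of 3] by simp
  have "(\<integral>x. (norm (cgrad ?\<psi> x))\<^sup>2 \<partial>M) \<le> (\<integral>x. 20 * (cgrad \<phi> x \<bullet> cgrad (\<lambda>x. Phi (\<phi> x)) x) \<partial>M)"
  proof (rule integral_mono)
    show "integrable M (\<lambda>x. (norm (cgrad ?\<psi> x))\<^sup>2)" by (rule L2_integrable_sq[OF cgrad_L2[OF \<psi>]])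
    show "integrable M (\<lambda>x. 20 * (cgrad \<phi> x \<bullet> cgrad (\<lambda>x. Phi (\<phi> x)) x))"
      using L2_inner_integrable[OF cgrad_L2[OF \<phi>] cgrad_L2[OF test_fun_Phi[OF \<phi>]]] by simp
    fix x
    have "(norm (cgrad ?\<psi> x))\<^sup>2 = (Psi' (\<phi> x))\<^sup>2 * (norm (cgrad \<phi> x))\<^sup>2"
      using cgrad_compose[OF \<phi> Psi_deriv, of x] by (simp add: power_mult_distrib)
    also have "\<dots> \<le> (20 * Phi' (\<phi> x)) * (norm (cgrad \<phi> x))\<^sup>2"
      by (intro mult_right_mono Psi'_sq_le) simp
    also have "\<dots> = 20 * (cgrad \<phi> x \<bullet> cgrad (\<lambda>x. Phi (\<phi> x)) x)"
      using cgrad_compose[OF \<phi> Phi_deriv, of x] by (simp add: power2_norm_eq_inner)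
    finally show "(norm (cgrad ?\<psi> x))\<^sup>2 \<le> 20 * (cgrad \<phi> x \<bullet> cgrad (\<lambda>x. Phi (\<phi> x)) x)" .
  qed
  also have "\<dots> \<le> 40" using E by simp
  finally have D: "(\<integral>x. (norm (cgrad ?\<psi> x))\<^sup>2 \<partial>lborel) \<le> 40"
    using integral_test_fun[OF test_fun_cgrad_norm_sq[OF \<psi>]] by simp
  have "(\<integral>x. ?\<psi> x ^ 4 \<partial>M) \<le> 4 * (4 * rad\<^sup>2 + 1) * (\<integral>x. (norm (cgrad ?\<psi> x))\<^sup>2 \<partial>lborel)\<^sup>2"
    using integral_power4_le[OF \<psi> rad(2)] integral_test_fun[OF \<psi>4] by simp
  also have "\<dots> \<le> C4" unfolding C4_def using D by (intro mult_left_mono power_mono) auto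
  finally have I: "(\<integral>x. ?\<psi> x ^ 4 \<partial>M) \<le> C4" .
  have i4: "integrable M (\<lambda>x. 2 + 2 * ?\<psi> x ^ 4)"
    using L2_integrable[OF test_fun_L2[OF \<psi>4]] by simp
  have "qf \<in> borel_measurable borel" unfolding qf_def[abs_def] by measurable
  then have m: "(\<lambda>x. qf (\<phi> x) ^ 8) \<in> borel_measurable M" using \<phi> by measurable
  show i: "integrable M (\<lambda>x. qf (\<phi> x) ^ 8)"
  proof (rule Bochner_Integration.integrable_bound[OF i4 m])
    have "norm (qf (\<phi> x) ^ 8) \<le> norm (2 + 2 * ?\<psi> x ^ 4)" for x
      using qf_power_8_le[of "\<phi> x"] qf_ge_1[of "\<phi> x"] by (simp add: add_nonneg_nonneg)
    then show "AE x in M. norm (qf (\<phi> x) ^ 8) \<le> norm (2 + 2 * ?\<psi> x ^ 4)" by simp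
  qed
  have "(\<integral>x. qf (\<phi> x) ^ 8 \<partial>M) \<le> (\<integral>x. 2 + 2 * ?\<psi> x ^ 4 \<partial>M)"
    by (rule integral_mono[OF i i4]) (rule qf_power_8_le)
  also have "\<dots> = 2 * measure M (space M) + 2 * (\<integral>x. ?\<psi> x ^ 4 \<partial>M)"
    using L2_integrable[OF test_fun_L2[OF \<psi>4]] by (subst Bochner_Integration.integral_add) auto
  finally show "(\<integral>x. qf (\<phi> x) ^ 8 \<partial>M) \<le> Cq" using I by (simp add: Cq_def)
qed

text \<open>Test the equation for \<open>v\<close> with \<open>Phi v\<close>, which is bounded, so that only the mass of \<open>\<rho>\<close> enters.\<close>
lemma poisson_dual_bound:
  assumes p: "poisson \<rho> v" and \<rho>: "\<And>x. 0 \<le> \<rho> x" "(\<integral>x. \<rho> x \<partial>M) \<le> 1"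
    and f: "L2 M f" "integrable M (\<lambda>x. \<bar>f x\<bar> ^ 3)" "(\<integral>x. \<bar>f x\<bar> ^ 3 \<partial>M) \<le> m ^ 3" and m: "m > 0"
  shows "(\<integral>x. f x * v x \<partial>M) \<le> m * (1 + Cq)"
proof -
  obtain g where g: "H1g v g" "\<And>\<psi> k. H1g \<psi> k \<Longrightarrow> (\<integral>x. g x \<bullet> k x \<partial>M) = (\<integral>x. \<rho> x * \<psi> x \<partial>M)"
    using poissonE[OF p] by blast
  obtain \<phi> where \<phi>: "\<And>n. test_fun \<Omega> (\<phi> n)"
     "(\<lambda>n. l2n M (\<lambda>x. \<phi> n x - v x)) \<longlonglongrightarrow> 0" "(\<lambda>n. l2n M (\<lambda>x. cgrad (\<phi> n) x - g x)) \<longlonglongrightarrow> 0"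
    using H1gE[OF g(1)] by blast
  define k where "k = (\<lambda>n. cgrad (\<lambda>x. Phi (\<phi> n x)))"
  note gL = H1g_L2(2)[OF g(1)]
  have kL: "L2 M (k n)" for n unfolding k_def by (intro cgrad_L2 test_fun_Phi \<phi>)
  have kn: "l2n M (k n) \<le> l2n M (cgrad (\<phi> n))" for n
  proof (rule l2n_mono_AE[OF cgrad_L2[OF \<phi>(1)] L2_measurable[OF kL]])
    have "norm (k n x) \<le> norm (cgrad (\<phi> n) x)" for x
      using Phi'_bounds[of "\<phi> n x"] cgrad_compose[OF \<phi>(1) Phi_deriv, of n x]
      by (simp add: k_def mult_left_le_one_le)
    then show "AE x in M. norm (k n x) \<le> norm (cgrad (\<phi> n) x)" by simp
  qed
  \<comment> \<open>The equation holds for g, not for the gradient of \<open>\<phi> n\<close>, so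
    the difference is split off; the main part is at most the mass of \<rho> because |Phi| <=
    1.\<close>
  have E: "(\<integral>x. cgrad (\<phi> n) x \<bullet> k n x \<partial>M) \<le> 1 + l2n M (\<lambda>x. cgrad (\<phi> n) x - g x) * l2n M (cgrad (\<phi> n))" for n
  proof -
    have "(\<integral>x. cgrad (\<phi> n) x \<bullet> k n x \<partial>M) = (\<integral>x. g x \<bullet> k n x \<partial>M) + (\<integral>x. (cgrad (\<phi> n) x - g x) \<bullet> k n x \<partial>M)"
      using L2_inner_integrable[OF gL kL[of n]] L2_inner_integrable[OF cgrad_L2[OF \<phi>(1)[of n]] kL[of n]]
      by (simp add: inner_diff_left)
    also have "(\<integral>x. g x \<bullet> k n x \<partial>M) = (\<integral>x. \<rho> x * Phi (\<phi> n x) \<partial>M)"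
      unfolding k_def by (intro g(2) H1g_test_fun test_fun_Phi \<phi>)
    also have "\<dots> \<le> (\<integral>x. \<rho> x \<partial>M)"
    proof (rule integral_mono)
      show "integrable M (\<lambda>x. \<rho> x * Phi (\<phi> n x))"
        by (intro L2_mult_integrable poisson_L2(1)[OF p] test_fun_L2 test_fun_Phi \<phi>)
      show "integrable M \<rho>" by (rule L2_integrable[OF poisson_L2(1)[OF p]])
      show "\<rho> x * Phi (\<phi> n x) \<le> \<rho> x" for x
        using Phi_bound[of "\<phi> n x"] \<rho>(1)[of x] by (intro mult_left_le) auto
    qed
    also have "(\<integral>x. (cgrad (\<phi> n) x - g x) \<bullet> k n x \<partial>M) \<le> l2n M (\<lambda>x. cgrad (\<phi> n) x - g x) * l2n M (k n)"
      using L2_Cauchy_Schwarz[OF L2_diff[OF cgrad_L2[OF \<phi>(1)[of n]] gL] kL[of n]] by simp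
    also have "\<dots> \<le> l2n M (\<lambda>x. cgrad (\<phi> n) x - g x) * l2n M (cgrad (\<phi> n))"
      by (intro mult_left_mono kn) simp
    finally show ?thesis using \<rho>(2) by simp
  qed
  have "(\<lambda>n. 1 + l2n M (\<lambda>x. cgrad (\<phi> n) x - g x) * l2n M (cgrad (\<phi> n))) \<longlonglongrightarrow> 1 + 0 * l2n M g"
    by (intro tendsto_intros \<phi>(3) l2n_tendsto[OF cgrad_L2[OF \<phi>(1)] gL \<phi>(3)])
  then have ev: "eventually (\<lambda>n. 1 + l2n M (\<lambda>x. cgrad (\<phi> n) x - g x) * l2n M (cgrad (\<phi> n)) < 2) sequentially"
    by (intro order_tendstoD(2)[of _ "1 + 0 * l2n M g"]) auto
  have "(\<lambda>n. \<integral>x. \<phi> n x * f x \<partial>M) \<longlonglongrightarrow> (\<integral>x. v x * f x \<partial>M)"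
    by (rule integral_mult_tendsto[OF test_fun_L2[OF \<phi>(1)] H1g_L2(1)[OF g(1)] f(1) \<phi>(2)])
  moreover have "eventually (\<lambda>n. (\<integral>x. \<phi> n x * f x \<partial>M) \<le> m * (1 + Cq)) sequentially"
    using ev
  proof eventually_elim
    case (elim n)
    then have E2: "(\<integral>x. cgrad (\<phi> n) x \<bullet> cgrad (\<lambda>x. Phi (\<phi> n x)) x \<partial>M) \<le> 2"
      using E[of n] unfolding k_def by linarith
    note Q = integral_qf8_le[OF \<phi>(1) E2]
    have "(\<integral>x. \<phi> n x * f x \<partial>M) \<le> (\<integral>x. m * (\<bar>f x\<bar> ^ 3 / m ^ 3 + qf (\<phi> n x) ^ 8) \<partial>M)"
    proof (rule integral_mono)
      show "integrable M (\<lambda>x. \<phi> n x * f x)" by (intro L2_mult_integrable test_fun_L2 \<phi> f)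
      show "integrable M (\<lambda>x. m * (\<bar>f x\<bar> ^ 3 / m ^ 3 + qf (\<phi> n x) ^ 8))" using f(2) Q(1) by simp
      fix x
      have "\<phi> n x * f x \<le> \<bar>\<phi> n x * f x\<bar>" by simp
      \<comment> \<open>Division by m normalises the datum: its cubed integral becomes at most
        1.\<close>
      also have "\<dots> = m * ((\<bar>f x\<bar> / m) * \<bar>\<phi> n x\<bar>)" using m by (simp add: abs_mult)
      also have "\<dots> \<le> m * ((\<bar>f x\<bar> / m) ^ 3 + qf (\<phi> n x) ^ 8)"
        using m by (intro mult_left_mono young_qf) auto
      finally show "\<phi> n x * f x \<le> m * (\<bar>f x\<bar> ^ 3 / m ^ 3 + qf (\<phi> n x) ^ 8)" by (simp add: power_divide)
    qed
    also have "\<dots> = m * ((\<integral>x. \<bar>f x\<bar> ^ 3 \<partial>M) / m ^ 3 + (\<integral>x. qf (\<phi> n x) ^ 8 \<partial>M))"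
      using f(2) Q(1) by simp
    also have "\<dots> \<le> m * (1 + Cq)"
      using m f(3) Q(2) by (intro mult_left_mono add_mono) (auto simp: divide_le_eq_1)
    finally show ?case .
  qed
  ultimately have "(\<integral>x. v x * f x \<partial>M) \<le> m * (1 + Cq)"
    by (intro tendsto_upperbound[OF _ _ sequentially_bot])
  then show ?thesis by (simp add: mult.commute)
qed

text \<open>By duality: pair \<open>w\<close> with the normalised indicator of \<open>{w > Csup * m}\<close>.\<close>
lemma poisson_upper_bound:
  assumes p: "poisson f w"
    and f: "integrable M (\<lambda>x. \<bar>f x\<bar> ^ 3)" "(\<integral>x. \<bar>f x\<bar> ^ 3 \<partial>M) \<le> m ^ 3" and m: "m > 0"
  shows "AE x in M. w x \<le> Csup * m"
proof -
  define A where "A = {x \<in> space M. w x > Csup * m}"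
  have wm [measurable]: "w \<in> borel_measurable M" using poisson_L2(2)[OF p] by (simp add: L2_def)
  have A [measurable]: "A \<in> sets M" unfolding A_def by measurable
  have "measure M A = 0"
  proof (rule ccontr)
    assume "measure M A \<noteq> 0"
    then have a: "measure M A > 0" using measure_nonneg[of M A] by linarith
    define \<rho> where "\<rho> = (\<lambda>x. indicator A x / measure M A :: real)"
    have \<rho>L: "L2 M \<rho>"
      using a by (intro L2_bounded[of _ "1 / measure M A"]) (auto simp: \<rho>_def indicator_def)
    have \<rho>1: "(\<integral>x. \<rho> x \<partial>M) = 1" using a A sets.sets_into_space[OF A] by (simp add: \<rho>_def Int_absorb2)
    obtain v where v: "poisson \<rho> v" using poisson_exists[OF \<rho>L] by blast
    obtain g where g: "H1g v g" "\<And>\<psi> k. H1g \<psi> k \<Longrightarrow> (\<integral>x. g x \<bullet> k x \<partial>M) = (\<integral>x. \<rho> x * \<psi> x \<partial>M)"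
      using poissonE[OF v] by blast
    obtain k where k: "H1g w k" "\<And>\<psi> g. H1g \<psi> g \<Longrightarrow> (\<integral>x. k x \<bullet> g x \<partial>M) = (\<integral>x. f x * \<psi> x \<partial>M)"
      using poissonE[OF p] by blast
    have "Csup * m = (\<integral>x. \<rho> x * (Csup * m) \<partial>M)" using \<rho>1 by simp
    also have "\<dots> \<le> (\<integral>x. \<rho> x * w x \<partial>M)"
    proof (rule integral_mono)
      show "integrable M (\<lambda>x. \<rho> x * (Csup * m))" using L2_integrable[OF \<rho>L] by simp
      show "integrable M (\<lambda>x. \<rho> x * w x)" by (rule L2_mult_integrable[OF \<rho>L poisson_L2(2)[OF p]])
      show "\<rho> x * (Csup * m) \<le> \<rho> x * w x" for x
        by (auto simp: \<rho>_def A_def indicator_def divide_right_mono)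
    qed
    \<comment> \<open>Symmetry of the weak form: each solution serves as test function in the
      equation of the other, which turns the average of w over A into the pairing of f with
      v.\<close>
    also have "\<dots> = (\<integral>x. g x \<bullet> k x \<partial>M)" by (rule g(2)[OF k(1), symmetric])
    also have "\<dots> = (\<integral>x. f x * v x \<partial>M)" using k(2)[OF g(1)] by (simp add: inner_commute)
    also have "\<dots> \<le> m * (1 + Cq)"
      using \<rho>1 a by (intro poisson_dual_bound[OF v _ _ poisson_L2(1)[OF p] f m]) (auto simp: \<rho>_def)
    finally have "2 * (1 + Cq) * m \<le> (1 + Cq) * m" by (simp add: Csup_def mult.commute)
    then show False using m Cq_nonneg by (simp add: mult_le_cancel_right)
  qed
  then have "A \<in> null_sets M" using A by (auto simp: null_sets_def emeasure_eq_measure)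
  from AE_not_in[OF this] show ?thesis by (auto simp: A_def elim!: AE_mp)
qed

text \<open>The upper bound is applied to w and to -w; the equation for -w comes from the
  combination f - 2 f.\<close>

lemma poisson_sup_bound:
  assumes p: "poisson f w"
    and f: "integrable M (\<lambda>x. \<bar>f x\<bar> ^ 3)" "(\<integral>x. \<bar>f x\<bar> ^ 3 \<partial>M) \<le> m ^ 3" and m: "m > 0"
  shows "AE x in M. \<bar>w x\<bar> \<le> Csup * m"
proof -
  have "poisson (\<lambda>x. - f x) (\<lambda>x. - w x)"
    using poisson_lincomb[OF p p, of "-2"] by (simp add: algebra_simps)
  from poisson_upper_bound[OF this _ _ m] f have "AE x in M. - w x \<le> Csup * m" by simp
  with poisson_upper_bound[OF p f m] show ?thesis by eventually_elim simp
qed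

text \<open>The cubed integral is at most c^3 times the total mass. The 1 added to the mass makes
  the sum at most its own cube.\<close>

lemma poisson_sup_bound_Linf:
  assumes p: "poisson f w" and f: "AE x in M. \<bar>f x\<bar> \<le> c" and c: "c > 0"
  shows "AE x in M. \<bar>w x\<bar> \<le> Csup * ((measure M (space M) + 1) * c)"
proof -
  let ?\<mu> = "measure M (space M)"
  have fm: "f \<in> borel_measurable M" using poisson_L2(1)[OF p] by (simp add: L2_def)
  have b: "AE x in M. \<bar>f x\<bar> ^ 3 \<le> c ^ 3" using f by eventually_elim (simp add: power_mono)
  have i: "integrable M (\<lambda>x. \<bar>f x\<bar> ^ 3)"
    by (rule integrable_const_bound[of _ "c ^ 3"]) (use b fm in auto)
  have "(\<integral>x. \<bar>f x\<bar> ^ 3 \<partial>M) \<le> (\<integral>x. c ^ 3 \<partial>M)" by (rule integral_mono_AE[OF i _ b]) simp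
  also have "\<dots> \<le> (?\<mu> + 1) ^ 3 * c ^ 3"
    using c self_le_power[of "?\<mu> + 1" 3] by (auto intro!: mult_right_mono)
  finally show ?thesis using c measure_nonneg[of M "space M"]
    by (intro poisson_sup_bound[OF p i]) (auto simp: power_mult_distrib add_nonneg_pos)
qed

end

section \<open>The fixed point\<close>

definition odd_powr :: "real \<Rightarrow> real \<Rightarrow> real" where
  "odd_powr p t = \<bar>t\<bar> powr (p - 1) * t"

lemma odd_powr_minus: "odd_powr p (- t) = - odd_powr p t"
  by (simp add: odd_powr_def)

lemma abs_odd_powr_le:
  assumes "p > 1" "\<bar>t\<bar> \<le> r" shows "\<bar>odd_powr p t\<bar> \<le> r powr (p - 1) * \<bar>t\<bar>"
  using assms by (auto simp: odd_powr_def abs_mult intro!: mult_right_mono powr_mono2)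

lemma odd_powr_eq_powr: "0 \<le> t \<Longrightarrow> odd_powr p t = t powr p"
  using powr_mult_base[of t "p - 1"] by (simp add: odd_powr_def mult.commute)

lemma powr_diff_le:
  assumes p: "p > 1" and ab: "0 \<le> b" "b \<le> a" "a \<le> r"
  shows "\<bar>odd_powr p a - odd_powr p b\<bar> \<le> p * r powr (p - 1) * (a - b)"
\<comment> \<open>The mean value theorem is used for 0 < b < a, where the power rule applies; at b =
  0 the plain size bound suffices because p > 1.\<close>
proof (cases "b = 0 \<or> a = b")
  case True
  then show ?thesis
  proof
    assume "b = 0"
    have "\<bar>odd_powr p a\<bar> \<le> r powr (p - 1) * a" using abs_odd_powr_le[OF p, of a r] ab by simp
    also have "\<dots> \<le> p * (r powr (p - 1) * a)" using p ab mult_right_mono[of 1 p "r powr (p - 1) * a"] by simp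
    finally show ?thesis using \<open>b = 0\<close> by (simp add: odd_powr_def mult.assoc)
  qed simp
next
  case False
  then have "b < a" "0 < b" using ab by auto
  have "((\<lambda>t. t powr p) has_real_derivative p * t powr (p - 1)) (at t)" if "b \<le> t" "t \<le> a" for t
    using that \<open>0 < b\<close> by (auto intro!: derivative_eq_intros)
  from MVT2[OF \<open>b < a\<close> this] obtain z where z: "b < z" "z < a" "a powr p - b powr p = (a - b) * (p * z powr (p - 1))"
    by blast
  have "z powr (p - 1) \<le> r powr (p - 1)" using z ab \<open>0 < b\<close> p by (intro powr_mono2) auto
  then have "(a - b) * (p * z powr (p - 1)) \<le> (a - b) * (p * r powr (p - 1))"
    using \<open>b < a\<close> p by (intro mult_left_mono) auto
  moreover have "0 \<le> a powr p - b powr p" using ab p by (simp add: powr_mono2)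
  ultimately show ?thesis using z ab by (simp add: odd_powr_eq_powr mult_ac)
qed

text \<open>Oddness reduces two nonpositive arguments to nonnegative ones. For opposite signs |a| +
  |b| = |a - b|, so the size bounds of the two terms simply add up.\<close>

lemma odd_powr_lipschitz:
  assumes p: "p > 1" and a: "\<bar>a\<bar> \<le> r" and b: "\<bar>b\<bar> \<le> r"
  shows "\<bar>odd_powr p a - odd_powr p b\<bar> \<le> p * r powr (p - 1) * \<bar>a - b\<bar>"
proof -
  have same: "\<bar>odd_powr p a - odd_powr p b\<bar> \<le> p * r powr (p - 1) * \<bar>a - b\<bar>"
    if "\<bar>a\<bar> \<le> r" "\<bar>b\<bar> \<le> r" "0 \<le> a" "0 \<le> b" for a b
    using powr_diff_le[OF p, of b a r] powr_diff_le[OF p, of a b r] that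
    by (cases "b \<le> a") (auto simp: abs_minus_commute)
  have opp: "\<bar>odd_powr p a - odd_powr p b\<bar> \<le> p * r powr (p - 1) * \<bar>a - b\<bar>"
    if ab: "\<bar>a\<bar> \<le> r" "\<bar>b\<bar> \<le> r" "0 \<le> a" "b \<le> 0" for a b
  proof -
    have "\<bar>odd_powr p a - odd_powr p b\<bar> \<le> r powr (p - 1) * \<bar>a\<bar> + r powr (p - 1) * \<bar>b\<bar>"
      using abs_odd_powr_le[OF p ab(1)] abs_odd_powr_le[OF p ab(2)] by linarith
    also have "\<dots> = 1 * (r powr (p - 1) * \<bar>a - b\<bar>)" using ab by (simp add: algebra_simps)
    also have "\<dots> \<le> p * (r powr (p - 1) * \<bar>a - b\<bar>)" using p by (intro mult_right_mono) auto
    finally show ?thesis by (simp add: mult.assoc)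
  qed
  consider "0 \<le> a" "0 \<le> b" | "0 \<le> a" "b \<le> 0" | "a \<le> 0" "0 \<le> b" | "a \<le> 0" "b \<le> 0" by linarith
  then show ?thesis
  proof cases
    case 1 then show ?thesis using same a b by blast
  next
    case 2 then show ?thesis using opp a b by blast
  next
    case 3 then show ?thesis using opp[OF b a] by (simp add: abs_minus_commute)
  next
    case 4 then show ?thesis using same[of "- a" "- b"] a b by (simp add: odd_powr_minus abs_minus_commute)
  qed
qed

context bounded_open_set begin

definition Cinf :: real where "Cinf = Csup * (measure M (space M) + 1)"

lemma Cinf_pos: "0 < Cinf"
  using Cq_nonneg by (simp add: Cinf_def Csup_def add_nonneg_pos)

lemma poisson_Cinf:
  "poisson f w \<Longrightarrow> AE x in M. \<bar>f x\<bar> \<le> c \<Longrightarrow> c > 0 \<Longrightarrow> AE x in M. \<bar>w x\<bar> \<le> Cinf * c"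
  using poisson_sup_bound_Linf[of f w c] by (simp add: Cinf_def mult.assoc)

end

text \<open>\<open>hr\<close> grants the contribution of h half of the ball,
  \<open>invariance\<close> grants the nonlinear terms the other half, and
  \<open>contraction\<close> makes the L^2 Lipschitz constant at most 1/2. In them
  \<open>Cinf * (\<kappa> * r\<^sup>2)\<close> bounds the potential, \<open>4 * rad\<^sup>2\<close>
  bounds the solution operator in L^2, and \<open>\<kappa> * (2 * r)\<close> is a Lipschitz constant
  of K u^2.\<close>

locale schroedinger_maxwell = bounded_open_set +
  fixes p \<kappa> r m :: real and K h :: "R3 \<Rightarrow> real"
  assumes p: "p > 1"
    and K [measurable]: "K \<in> borel_measurable M" and K_bound: "AE x in M. \<bar>K x\<bar> \<le> \<kappa>" and \<kappa>: "\<kappa> > 0"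
    and h: "L2 M h" "integrable M (\<lambda>x. \<bar>h x\<bar> ^ 3)" "(\<integral>x. \<bar>h x\<bar> ^ 3 \<partial>M) \<le> m ^ 3" and m: "m > 0"
    and r: "r > 0" and hr: "Csup * m \<le> r / 2"
    and invariance: "Cinf * (r powr (p - 1) * r + \<kappa> * (Cinf * (\<kappa> * r\<^sup>2)) * r) \<le> r / 2"
    and contraction: "4 * rad\<^sup>2 * (p * r powr (p - 1) + \<kappa> * (Cinf * (\<kappa> * r\<^sup>2)) + \<kappa> * r * (4 * rad\<^sup>2 * (\<kappa> * (2 * r)))) \<le> 1 / 2"
begin

definition rhs :: "(R3 \<Rightarrow> real) \<Rightarrow> (R3 \<Rightarrow> real) \<Rightarrow> R3 \<Rightarrow> real" where
  "rhs u \<phi> x = odd_powr p (u x) + h x - K x * \<phi> x * u x"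

text \<open>One Picard step: \<open>w\<close> solves the first equation of the system with \<open>u\<close> and \<open>\<phi>\<^sub>u\<close> inserted in the
  right-hand side.\<close>
definition step :: "(R3 \<Rightarrow> real) \<Rightarrow> (R3 \<Rightarrow> real) \<Rightarrow> bool" where
  "step u w \<longleftrightarrow> (\<exists>\<phi>. poisson (\<lambda>x. K x * (u x)\<^sup>2) \<phi> \<and> poisson (rhs u \<phi>) w)"

definition admissible :: "(R3 \<Rightarrow> real) \<Rightarrow> bool" where
  "admissible u \<longleftrightarrow> u \<in> borel_measurable M \<and> (AE x in M. \<bar>u x\<bar> \<le> r)"

lemma odd_powr_measurable [measurable]: "odd_powr p \<in> borel_measurable borel"
  unfolding odd_powr_def[abs_def] by measurable

lemma admissible_L2: "admissible u \<Longrightarrow> L2 M u"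
  unfolding admissible_def by (auto intro: L2_bounded[of _ r])

lemma Ku2_bound: 
  assumes "admissible u" shows "AE x in M. \<bar>K x * (u x)\<^sup>2\<bar> \<le> \<kappa> * r\<^sup>2"
proof -
  have "AE x in M. \<bar>u x\<bar> \<le> r" using assms by (simp add: admissible_def)
  with K_bound show ?thesis
  proof eventually_elim
    case (elim x)
    have "\<bar>u x\<bar>\<^sup>2 \<le> r\<^sup>2" using elim by (intro power_mono) auto
    then show ?case using elim \<kappa> by (auto simp: abs_mult intro!: mult_mono)
  qed
qed

lemma Ku2_L2: "admissible u \<Longrightarrow> L2 M (\<lambda>x. K x * (u x)\<^sup>2)"
  by (rule L2_bounded[of _ "\<kappa> * r\<^sup>2"]) (use Ku2_bound[of u] in \<open>auto simp: admissible_def\<close>)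

lemma phi_bound:
  "admissible u \<Longrightarrow> poisson (\<lambda>x. K x * (u x)\<^sup>2) \<phi> \<Longrightarrow> AE x in M. \<bar>\<phi> x\<bar> \<le> Cinf * (\<kappa> * r\<^sup>2)"
  using \<kappa> r by (intro poisson_Cinf[of "\<lambda>x. K x * (u x)\<^sup>2"] Ku2_bound) auto

text \<open>The datum is split by linearity: the nonlinear part is bounded and falls under the
  estimate for bounded data, whereas h uses the L^3 estimate; each solution fits into r/2.\<close>

lemma step_exists:
  assumes u: "admissible u" shows "\<exists>w. step u w \<and> admissible w"
proof -
  obtain \<phi> where \<phi>: "poisson (\<lambda>x. K x * (u x)\<^sup>2) \<phi>" using poisson_exists[OF Ku2_L2[OF u]] by blast
  have [measurable]: "\<phi> \<in> borel_measurable M" "u \<in> borel_measurable M"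
    using poisson_L2(2)[OF \<phi>] u by (auto simp: L2_def admissible_def)
  let ?f = "\<lambda>x. odd_powr p (u x) - K x * \<phi> x * u x"
  define c where "c = r powr (p - 1) * r + \<kappa> * (Cinf * (\<kappa> * r\<^sup>2)) * r"
  have c: "c > 0" unfolding c_def using r \<kappa> Cinf_pos by (intro add_pos_pos mult_pos_pos) auto
  have "AE x in M. \<bar>u x\<bar> \<le> r" using u by (simp add: admissible_def)
  with K_bound phi_bound[OF u \<phi>] have f: "AE x in M. \<bar>?f x\<bar> \<le> c"
  proof eventually_elim
    case (elim x)
    have "\<bar>odd_powr p (u x)\<bar> \<le> r powr (p - 1) * \<bar>u x\<bar>" by (rule abs_odd_powr_le[OF p elim(3)])
    also have "\<dots> \<le> r powr (p - 1) * r" using elim by (intro mult_left_mono) auto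
    finally have "\<bar>odd_powr p (u x)\<bar> \<le> r powr (p - 1) * r" .
    moreover have "\<bar>K x * \<phi> x * u x\<bar> \<le> \<kappa> * (Cinf * (\<kappa> * r\<^sup>2)) * r"
      unfolding abs_mult using elim \<kappa> Cinf_pos by (intro mult_mono) auto
    ultimately show ?case unfolding c_def by linarith
  qed
  have fL: "L2 M ?f" by (rule L2_bounded[of _ c]) (use f in auto)
  obtain w1 where w1: "poisson ?f w1" using poisson_exists[OF fL] by blast
  obtain w2 where w2: "poisson h w2" using poisson_exists[OF h(1)] by blast
  have "poisson (rhs u \<phi>) (\<lambda>x. w1 x + w2 x)"
    using poisson_lincomb[OF w1 w2, of 1] by (simp add: rhs_def[abs_def] algebra_simps)
  moreover have "AE x in M. \<bar>w1 x + w2 x\<bar> \<le> r"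
    using poisson_Cinf[OF w1 f c] poisson_sup_bound[OF w2 h(2,3) m]
  proof eventually_elim
    case (elim x) then show ?case using invariance hr unfolding c_def by linarith
  qed
  moreover have "(\<lambda>x. w1 x + w2 x) \<in> borel_measurable M"
    using poisson_L2(2)[OF w1] poisson_L2(2)[OF w2] by (auto simp: L2_def)
  ultimately show ?thesis using \<phi> unfolding step_def admissible_def by blast
qed

text \<open>Differences are measured in L^2 and multiplied by factors bounded in the supremum. The
  difference of the potentials is controlled through K (u^2 - u'^2) = K (u + u') (u - u') by a
  further use of the L^2 bound, hence the nested second \<open>4 * rad\<^sup>2\<close> in
  \<open>contraction\<close>.\<close>

lemma step_contraction:
  assumes u: "admissible u" and u': "admissible u'" and w: "step u w" and w': "step u' w'"
  shows "l2n M (\<lambda>x. w x - w' x) \<le> l2n M (\<lambda>x. u x - u' x) / 2"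
proof -
  obtain \<phi> where \<phi>: "poisson (\<lambda>x. K x * (u x)\<^sup>2) \<phi>" "poisson (rhs u \<phi>) w" using w by (auto simp: step_def)
  obtain \<phi>' where \<phi>': "poisson (\<lambda>x. K x * (u' x)\<^sup>2) \<phi>'" "poisson (rhs u' \<phi>') w'" using w' by (auto simp: step_def)
  let ?du = "\<lambda>x. u x - u' x" and ?d\<phi> = "\<lambda>x. \<phi> x - \<phi>' x"
  have b: "AE x in M. \<bar>u x\<bar> \<le> r" "AE x in M. \<bar>u' x\<bar> \<le> r" using u u' by (auto simp: admissible_def)
  have du: "L2 M ?du" using u u' by (intro L2_diff admissible_L2)
  have d\<phi>: "L2 M ?d\<phi>" using poisson_L2 \<phi>(1) \<phi>'(1) by (intro L2_diff) blast+
  define a where "a = p * r powr (p - 1) + \<kappa> * (Cinf * (\<kappa> * r\<^sup>2))"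
  have a: "a \<ge> 0" unfolding a_def using p \<kappa> r Cinf_pos by (intro add_nonneg_nonneg mult_nonneg_nonneg) auto
  have "l2n M (\<lambda>x. K x * (u x)\<^sup>2 - K x * (u' x)\<^sup>2) \<le> l2n M (\<lambda>x. (\<kappa> * (2 * r)) *\<^sub>R ?du x)"
  proof (rule l2n_mono_AE)
    show "(\<lambda>x. K x * (u x)\<^sup>2 - K x * (u' x)\<^sup>2) \<in> borel_measurable M"
      using L2_diff[OF Ku2_L2[OF u] Ku2_L2[OF u']] by (simp add: L2_def)
    show "AE x in M. norm (K x * (u x)\<^sup>2 - K x * (u' x)\<^sup>2) \<le> norm ((\<kappa> * (2 * r)) *\<^sub>R ?du x)"
      using b K_bound
    proof eventually_elim
      case (elim x)
      have "\<bar>K x\<bar> * \<bar>u x + u' x\<bar> * \<bar>?du x\<bar> \<le> \<kappa> * (2 * r) * \<bar>?du x\<bar>"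
        using elim \<kappa> by (intro mult_right_mono mult_mono) auto
      moreover have "K x * (u x)\<^sup>2 - K x * (u' x)\<^sup>2 = K x * (u x + u' x) * ?du x"
        by (simp add: power2_eq_square algebra_simps)
      ultimately show ?case using \<kappa> r by (simp add: abs_mult)
    qed
  qed (rule L2_scaleR[OF du])
  also have "\<dots> = \<kappa> * (2 * r) * l2n M ?du" using \<kappa> r by (subst l2n_scaleR) (simp add: abs_mult)
  finally have "4 * rad\<^sup>2 * l2n M (\<lambda>x. K x * (u x)\<^sup>2 - K x * (u' x)\<^sup>2) \<le> 4 * rad\<^sup>2 * (\<kappa> * (2 * r) * l2n M ?du)"
    by (intro mult_left_mono) auto
  with poisson_L2_bound[OF poisson_diff[OF \<phi>(1) \<phi>'(1)]]
  have d\<phi>_le: "l2n M ?d\<phi> \<le> 4 * rad\<^sup>2 * (\<kappa> * (2 * r) * l2n M ?du)" by (rule order_trans)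
  have "l2n M (\<lambda>x. rhs u \<phi> x - rhs u' \<phi>' x) \<le> l2n M (\<lambda>x. a *\<^sub>R norm (?du x) + (\<kappa> * r) *\<^sub>R norm (?d\<phi> x))"
  proof (rule l2n_mono_AE)
    show "(\<lambda>x. rhs u \<phi> x - rhs u' \<phi>' x) \<in> borel_measurable M"
      using L2_diff[OF poisson_L2(1)[OF \<phi>(2)] poisson_L2(1)[OF \<phi>'(2)]] by (simp add: L2_def)
    show "AE x in M. norm (rhs u \<phi> x - rhs u' \<phi>' x) \<le> norm (a *\<^sub>R norm (?du x) + (\<kappa> * r) *\<^sub>R norm (?d\<phi> x))"
      using b K_bound phi_bound[OF u \<phi>(1)]
    proof eventually_elim
      case (elim x)
      have "\<bar>odd_powr p (u x) - odd_powr p (u' x)\<bar> \<le> p * r powr (p - 1) * \<bar>?du x\<bar>"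
        by (rule odd_powr_lipschitz[OF p elim(1,2)])
      moreover have "\<bar>K x * \<phi> x * ?du x\<bar> \<le> \<kappa> * (Cinf * (\<kappa> * r\<^sup>2)) * \<bar>?du x\<bar>"
        unfolding abs_mult using elim \<kappa> by (intro mult_right_mono mult_mono) auto
      moreover have "\<bar>K x * u' x * ?d\<phi> x\<bar> \<le> \<kappa> * r * \<bar>?d\<phi> x\<bar>"
        unfolding abs_mult using elim \<kappa> by (intro mult_right_mono mult_mono) auto
      \<comment> \<open>The Maxwell term is split so that the factors \<phi> and u' carry the sup
        bounds, while each product contains just one difference.\<close>
      moreover have "rhs u \<phi> x - rhs u' \<phi>' x =
          (odd_powr p (u x) - odd_powr p (u' x)) - K x * \<phi> x * ?du x - K x * u' x * ?d\<phi> x"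
        by (simp add: rhs_def algebra_simps)
      ultimately have "\<bar>rhs u \<phi> x - rhs u' \<phi>' x\<bar> \<le> a * \<bar>?du x\<bar> + \<kappa> * r * \<bar>?d\<phi> x\<bar>"
        unfolding a_def distrib_right by linarith
      then show ?case by simp
    qed
  qed (intro L2_add L2_scaleR L2_norm du d\<phi>)
  also have "\<dots> \<le> l2n M (\<lambda>x. a *\<^sub>R norm (?du x)) + l2n M (\<lambda>x. (\<kappa> * r) *\<^sub>R norm (?d\<phi> x))"
    by (intro l2n_triangle L2_scaleR L2_norm du d\<phi>)
  also have "\<dots> = a * l2n M ?du + \<kappa> * r * l2n M ?d\<phi>"
    unfolding l2n_scaleR l2n_norm using a \<kappa> r by simp
  also have "\<dots> \<le> a * l2n M ?du + \<kappa> * r * (4 * rad\<^sup>2 * (\<kappa> * (2 * r) * l2n M ?du))"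
    using d\<phi>_le \<kappa> r by (intro add_left_mono mult_left_mono) auto
  finally have "4 * rad\<^sup>2 * l2n M (\<lambda>x. rhs u \<phi> x - rhs u' \<phi>' x) \<le>
      4 * rad\<^sup>2 * (a * l2n M ?du + \<kappa> * r * (4 * rad\<^sup>2 * (\<kappa> * (2 * r) * l2n M ?du)))"
    by (intro mult_left_mono) auto
  with poisson_L2_bound[OF poisson_diff[OF \<phi>(2) \<phi>'(2)]]
  have "l2n M (\<lambda>x. w x - w' x) \<le> 4 * rad\<^sup>2 * (a * l2n M ?du + \<kappa> * r * (4 * rad\<^sup>2 * (\<kappa> * (2 * r) * l2n M ?du)))"
    by (rule order_trans)
  also have "\<dots> = (4 * rad\<^sup>2 * (a + \<kappa> * r * (4 * rad\<^sup>2 * (\<kappa> * (2 * r))))) * l2n M ?du"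
    by (simp add: algebra_simps)
  also have "\<dots> \<le> (1 / 2) * l2n M ?du"
    using contraction unfolding a_def by (intro mult_right_mono) auto
  finally show ?thesis by simp
qed

text \<open>Banach's iteration carried out directly: solutions are determined only almost
  everywhere, so the map is a choice function and the fixed point property is obtained almost
  everywhere.\<close>

lemma fixed_point_exists:
  obtains u \<phi> where "admissible u" "poisson (\<lambda>x. K x * (u x)\<^sup>2) \<phi>" "poisson (rhs u \<phi>) u"
proof -
  define G where "G = (\<lambda>u. SOME w. step u w \<and> admissible w)"
  have G: "step u (G u)" "admissible (G u)" if "admissible u" for u
    using someI_ex[OF step_exists[OF that]] by (auto simp: G_def)
  define s where "s = (\<lambda>n. (G ^^ n) (\<lambda>x. 0))"
  have ad: "admissible (s n)" for n
  proof (induction n)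
    case 0 show ?case using r by (simp add: s_def admissible_def)
  next
    case (Suc n) then show ?case using G(2) by (simp add: s_def)
  qed
  have st: "step (s n) (s (Suc n))" for n using G(1)[OF ad[of n]] by (simp add: s_def)
  note sL = admissible_L2[OF ad]
  define d where "d = l2n M (\<lambda>x. s 1 x - s 0 x)"
  have d1: "l2n M (\<lambda>x. s (Suc n) x - s n x) \<le> d * (1 / 2) ^ n" for n
  proof (induction n)
    case (Suc n)
    then show ?case using step_contraction[OF ad ad st st, of "Suc n" n] by simp
  qed (simp add: d_def)
  \<comment> \<open>Partial sums of the geometric series of ratio 1/2; the explicit factor 1 - 2^-k
    lets the induction close.\<close>
  have dk: "l2n M (\<lambda>x. s (i + k) x - s i x) \<le> 2 * d * (1 / 2) ^ i * (1 - (1 / 2) ^ k)" for i k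
  proof (induction k)
    case (Suc k)
    have "l2n M (\<lambda>x. s (i + Suc k) x - s i x) \<le> l2n M (\<lambda>x. s (Suc (i + k)) x - s (i + k) x) + l2n M (\<lambda>x. s (i + k) x - s i x)"
      using l2n_triangle_diff[OF sL[of "i + Suc k"] sL[of "i + k"] sL[of i]] by simp
    also have "\<dots> \<le> d * (1 / 2) ^ (i + k) + 2 * d * (1 / 2) ^ i * (1 - (1 / 2) ^ k)"
      by (intro add_mono d1 Suc.IH)
    also have "\<dots> = 2 * d * (1 / 2) ^ i * (1 - (1 / 2) ^ Suc k)" by (simp add: power_add field_simps)
    finally show ?case .
  qed simp
  have d0: "0 \<le> d" by (simp add: d_def)
  have ge: "l2n M (\<lambda>x. s j x - s i x) \<le> 2 * d * (1 / 2) ^ i" if "i \<le> j" for i j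
  proof -
    have "l2n M (\<lambda>x. s j x - s i x) \<le> 2 * d * (1 / 2) ^ i * (1 - (1 / 2) ^ (j - i))" using dk[of i "j - i"] that by simp
    also have "\<dots> \<le> 2 * d * (1 / 2) ^ i" using d0 by (intro mult_left_le) auto
    finally show ?thesis .
  qed
  have "\<exists>N. \<forall>i\<ge>N. \<forall>j\<ge>N. l2n M (\<lambda>x. s i x - s j x) < e" if "e > 0" for e
  proof -
    have "(\<lambda>n. 4 * d * (1 / 2) ^ n) \<longlonglongrightarrow> 4 * d * 0"
      by (intro tendsto_mult tendsto_const LIMSEQ_power_zero) simp
    then have "eventually (\<lambda>n. 4 * d * (1 / 2) ^ n < e) sequentially" using that by (intro order_tendstoD(2)) auto
    then obtain N where N: "4 * d * (1 / 2) ^ N < e" by (auto simp: eventually_sequentially)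
    have "l2n M (\<lambda>x. s i x - s j x) < e" if "i \<ge> N" "j \<ge> N" for i j
      using l2n_triangle_diff[OF sL[of i] sL[of N] sL[of j]] ge[OF that(1)] ge[OF that(2)] N
      by (simp add: l2n_minus_commute[of M "s N"])
    then show ?thesis by blast
  qed
  from L2_complete[OF sL this] obtain u where u: "L2 M u" and lim: "(\<lambda>n. l2n M (\<lambda>x. s n x - u x)) \<longlonglongrightarrow> 0"
    by blast
  have [measurable]: "u \<in> borel_measurable M" using u by (simp add: L2_def)
  have "admissible u"
  proof -
    \<comment> \<open>The excess of |u| over r lies pointwise below |s n - u| because |s n| <= r, so
      its norm is 0: the ball is closed in L^2.\<close>
    let ?e = "\<lambda>x. max (\<bar>u x\<bar> - r) 0"
    have eb: "l2n M ?e \<le> l2n M (\<lambda>x. s n x - u x)" for n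
    proof (rule l2n_mono_AE[OF L2_diff[OF sL u]])
      have "AE x in M. \<bar>s n x\<bar> \<le> r" using ad[of n] by (simp add: admissible_def)
      then show "AE x in M. norm (?e x) \<le> norm (s n x - u x)" by eventually_elim auto
    qed measurable
    have "l2n M ?e \<le> 0" by (rule LIMSEQ_le_const[OF lim]) (use eb in blast)
    then have "l2n M ?e = 0" using l2n_nonneg[of M ?e] by linarith
    moreover have "L2 M ?e" by (rule L2_bound[OF u]) (use r in auto)
    ultimately have "AE x in M. ?e x = 0" by (simp add: l2n_eq_0_iff)
    then have "AE x in M. \<bar>u x\<bar> \<le> r" by eventually_elim (auto simp: max_def split: if_splits)
    then show ?thesis by (simp add: admissible_def)
  qed
  \<comment> \<open>One more step from the limit is compared with \<open>s (Suc n)\<close>: w and u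
    agree almost everywhere, so the equation for w becomes one for u.\<close>
  obtain w where w: "step u w" "admissible w" using step_exists[OF \<open>admissible u\<close>] by blast
  have "l2n M (\<lambda>x. w x - u x) \<le> l2n M (\<lambda>x. s n x - u x) / 2 + l2n M (\<lambda>x. s (Suc n) x - u x)" for n
    using l2n_triangle_diff[OF admissible_L2[OF w(2)] sL[of "Suc n"] u]
      step_contraction[OF \<open>admissible u\<close> ad[of n] w(1) st] by (simp add: l2n_minus_commute[of M u])
  moreover have "(\<lambda>n. l2n M (\<lambda>x. s n x - u x) / 2 + l2n M (\<lambda>x. s (Suc n) x - u x)) \<longlonglongrightarrow> 0 / 2 + 0"
    by (intro tendsto_add tendsto_divide tendsto_const lim LIMSEQ_Suc[OF lim]) simp
  ultimately have "l2n M (\<lambda>x. w x - u x) \<le> 0" by (intro LIMSEQ_le_const[where X="\<lambda>n. _ n"]) auto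
  then have "l2n M (\<lambda>x. w x - u x) = 0" using l2n_nonneg[of M "\<lambda>x. w x - u x"] by linarith
  then have wu: "AE x in M. w x - u x = 0" using l2n_eq_0_iff[OF L2_diff[OF admissible_L2[OF w(2)] u]] by simp
  obtain \<phi> where \<phi>: "poisson (\<lambda>x. K x * (u x)\<^sup>2) \<phi>" "poisson (rhs u \<phi>) w" using w by (auto simp: step_def)
  have "AE x in M. w x = u x" using wu by eventually_elim simp
  then have "poisson (rhs u \<phi>) u"
    using poisson_L2(1)[OF \<phi>(2)] by (intro poisson_cong_AE[OF \<phi>(2)]) (auto simp: L2_def)
  with \<phi>(1) \<open>admissible u\<close> show ?thesis using that by blast
qed

text \<open>The second conclusion prepares nontriviality. If u vanishes almost everywhere, testing
  its equation with u itself gives g = 0 almost everywhere, while the right-hand side reduces to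
  h.\<close>

lemma weak_solution_exists:
  obtains u \<phi> where "SM_weak_solution \<Omega> p K h u \<phi>" 
    "(AE x in M. u x = 0) \<Longrightarrow> \<forall>\<psi>. test_fun \<Omega> \<psi> \<longrightarrow> (\<integral>x. h x * \<psi> x \<partial>M) = 0"
proof -
  obtain u \<phi> where u: "admissible u" and \<phi>: "poisson (\<lambda>x. K x * (u x)\<^sup>2) \<phi>" and pu: "poisson (rhs u \<phi>) u"
    by (rule fixed_point_exists)
  obtain g where g: "H1g u g" "\<And>\<psi> k. H1g \<psi> k \<Longrightarrow> (\<integral>x. g x \<bullet> k x \<partial>M) = (\<integral>x. rhs u \<phi> x * \<psi> x \<partial>M)"
    using poissonE[OF pu] by blast
  obtain g' where g': "H1g \<phi> g'" "\<And>\<psi> k. H1g \<psi> k \<Longrightarrow> (\<integral>x. g' x \<bullet> k x \<partial>M) = (\<integral>x. K x * (u x)\<^sup>2 * \<psi> x \<partial>M)"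
    using poissonE[OF \<phi>] by blast
  have [measurable]: "\<phi> \<in> borel_measurable M" "u \<in> borel_measurable M" "h \<in> borel_measurable M"
    using poisson_L2(2)[OF \<phi>] u h(1) by (auto simp: L2_def admissible_def)
  have ub: "AE x in M. \<bar>u x\<bar> \<le> r" using u by (simp add: admissible_def)
  have "AE x in M. \<bar>\<bar>u x\<bar> powr (p + 1)\<bar> \<le> r powr (p + 1)"
    using ub by eventually_elim (use p in \<open>auto intro!: powr_mono2\<close>)
  then have "integrable M (\<lambda>x. \<bar>u x\<bar> powr (p + 1))"
    by (intro integrable_const_bound[of _ "r powr (p + 1)"]) auto
  then have "E_space \<Omega> p u"
    unfolding E_space_def in_Lp_def set_integrable_iff set_borel_measurable_iff
    using H1g_imp_H10[OF g(1)] by simp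
  moreover have "is_phi_u \<Omega> K u \<phi>"
    unfolding is_phi_u_def
  proof (intro conjI allI impI)
    show "H10 \<Omega> \<phi>" by (rule H1g_imp_H10[OF g'(1)])
    fix \<psi> assume "H10 \<Omega> \<psi>"
    then obtain k where k: "H1g \<psi> k" by (rule H10_imp_H1g)
    show "(LINT x:\<Omega>|lebesgue. wgrad \<Omega> \<phi> x \<bullet> wgrad \<Omega> \<psi> x) = (LINT x:\<Omega>|lebesgue. K x * (u x)\<^sup>2 * \<psi> x)"
      unfolding integral_wgrad[OF g'(1) k] set_integral_eq by (rule g'(2)[OF k])
  qed
  moreover have "(LINT x:\<Omega>|lebesgue. wgrad \<Omega> u x \<bullet> wgrad \<Omega> \<psi> x) + (LINT x:\<Omega>|lebesgue. K x * \<phi> x * u x * \<psi> x) =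
        (LINT x:\<Omega>|lebesgue. \<bar>u x\<bar> powr (p - 1) * u x * \<psi> x) + (LINT x:\<Omega>|lebesgue. h x * \<psi> x)"
    if "E_space \<Omega> p \<psi>" for \<psi>
  proof -
    from that obtain k where k: "H1g \<psi> k" using H10_imp_H1g by (auto simp: E_space_def)
    note \<psi> = H1g_L2(1)[OF k]
    have "AE x in M. norm (odd_powr p (u x)) \<le> r powr (p - 1) * r"
      using ub
    proof eventually_elim
      case (elim x)
      then show ?case using abs_odd_powr_le[OF p elim] mult_left_mono[OF elim, of "r powr (p - 1)"] by simp
    qed
    then have i1: "integrable M (\<lambda>x. odd_powr p (u x) * \<psi> x)"
      by (intro L2_mult_integrable[OF _ \<psi>] L2_bounded) auto
    have i2: "integrable M (\<lambda>x. h x * \<psi> x)" by (rule L2_mult_integrable[OF h(1) \<psi>])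
    have "AE x in M. norm (K x * \<phi> x * u x) \<le> \<kappa> * (Cinf * (\<kappa> * r\<^sup>2)) * r"
      using ub K_bound phi_bound[OF u \<phi>]
    proof eventually_elim
      case (elim x)
      then show ?case unfolding real_norm_def abs_mult using \<kappa> Cinf_pos by (intro mult_mono) auto
    qed
    then have i3: "integrable M (\<lambda>x. K x * \<phi> x * u x * \<psi> x)"
      by (intro L2_mult_integrable[OF _ \<psi>] L2_bounded) auto
    have "(\<integral>x. rhs u \<phi> x * \<psi> x \<partial>M) = (\<integral>x. odd_powr p (u x) * \<psi> x + h x * \<psi> x - K x * \<phi> x * u x * \<psi> x \<partial>M)"
      by (simp add: rhs_def algebra_simps)
    also have "\<dots> = (\<integral>x. odd_powr p (u x) * \<psi> x \<partial>M) + (\<integral>x. h x * \<psi> x \<partial>M) - (\<integral>x. K x * \<phi> x * u x * \<psi> x \<partial>M)"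
      using i1 i2 i3 by simp
    finally show ?thesis
      unfolding integral_wgrad[OF g(1) k] set_integral_eq using g(2)[OF k] by (simp add: odd_powr_def)
  qed
  ultimately have "SM_weak_solution \<Omega> p K h u \<phi>" unfolding SM_weak_solution_def by blast
  moreover have "(\<integral>x. h x * \<psi> x \<partial>M) = 0" if u0: "AE x in M. u x = 0" and \<psi>: "test_fun \<Omega> \<psi>" for \<psi>
  proof -
    have "(l2n M g)\<^sup>2 = (\<integral>x. rhs u \<phi> x * u x \<partial>M)"
      using g(2)[OF g(1)] unfolding l2n_sq power2_norm_eq_inner .
    also have "\<dots> = (\<integral>x. 0 \<partial>M)"
      using u0 poisson_L2(1)[OF pu] by (intro integral_cong_AE) (auto simp: L2_def elim!: eventually_mono)
    finally have "l2n M g = 0" by simp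
    then have "(\<integral>x. g x \<bullet> cgrad \<psi> x \<partial>M) = 0"
      using L2_Cauchy_Schwarz[OF H1g_L2(2)[OF g(1)] cgrad_L2[OF \<psi>]] by simp
    then have "0 = (\<integral>x. rhs u \<phi> x * \<psi> x \<partial>M)" using g(2)[OF H1g_test_fun[OF \<psi>]] by simp
    also have "\<dots> = (\<integral>x. h x * \<psi> x \<partial>M)"
      using u0 poisson_L2(1)[OF pu] \<psi>
      by (intro integral_cong_AE) (auto simp: L2_def rhs_def odd_powr_def elim!: eventually_mono)
    finally show ?thesis by simp
  qed
  ultimately show ?thesis using that by blast
qed

end

text \<open>Here a, b and c stand for \<open>Cinf\<close>, \<kappa> and
  \<open>4 * rad\<^sup>2\<close>. After division of the first inequality by r, every term on the
  left carries a positive power of r, by p > 1 also r^(p-1), so both hold near 0 from the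
  right.\<close>

lemma small_radius_exists:
  fixes a b c p :: real
  assumes p: "p > 1"
  shows "\<exists>r>0. a * (r powr (p - 1) * r + b * (a * (b * r\<^sup>2)) * r) \<le> r / 2 \<and>
     c * (p * r powr (p - 1) + b * (a * (b * r\<^sup>2)) + b * r * (c * (b * (2 * r)))) \<le> 1 / 2"
proof -
  have id: "((\<lambda>r::real. r) \<longlongrightarrow> 0) (at_right 0)" by (rule tendsto_ident_at)
  have pw: "((\<lambda>r::real. r powr (p - 1)) \<longlongrightarrow> 0) (at_right 0)"
  proof (rule tendsto_zero_powrI[OF id tendsto_const])
    show "eventually (\<lambda>r::real. 0 \<le> r) (at_right 0)"
      using eventually_at_right_less[of "0::real"] by (rule eventually_mono) simp
  qed (use p in simp)
  have "((\<lambda>r. a * (r powr (p - 1) + b * (a * (b * r\<^sup>2)))) \<longlongrightarrow> a * (0 + b * (a * (b * 0\<^sup>2)))) (at_right 0)"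
    by (intro tendsto_intros id pw)
  then have "eventually (\<lambda>r. a * (r powr (p - 1) + b * (a * (b * r\<^sup>2))) < 1 / 2) (at_right 0)"
    by (rule order_tendstoD(2)) simp
  moreover have "((\<lambda>r. c * (p * r powr (p - 1) + b * (a * (b * r\<^sup>2)) + b * r * (c * (b * (2 * r)))))
      \<longlongrightarrow> c * (p * 0 + b * (a * (b * 0\<^sup>2)) + b * 0 * (c * (b * (2 * 0))))) (at_right 0)"
    by (intro tendsto_intros id pw)
  then have "eventually (\<lambda>r. c * (p * r powr (p - 1) + b * (a * (b * r\<^sup>2)) + b * r * (c * (b * (2 * r)))) < 1 / 2) (at_right 0)"
    by (rule order_tendstoD(2)) simp
  ultimately have "eventually (\<lambda>r. r > 0 \<and> a * (r powr (p - 1) + b * (a * (b * r\<^sup>2))) < 1 / 2 \<and>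
     c * (p * r powr (p - 1) + b * (a * (b * r\<^sup>2)) + b * r * (c * (b * (2 * r)))) < 1 / 2) (at_right 0)"
    using eventually_at_right_less[of "0::real"] by eventually_elim simp
  then obtain r where r: "r > 0" "a * (r powr (p - 1) + b * (a * (b * r\<^sup>2))) < 1 / 2"
     "c * (p * r powr (p - 1) + b * (a * (b * r\<^sup>2)) + b * r * (c * (b * (2 * r)))) < 1 / 2"
    using eventually_happens'[OF trivial_limit_at_right_real] by blast
  have "a * (r powr (p - 1) * r + b * (a * (b * r\<^sup>2)) * r) = (a * (r powr (p - 1) + b * (a * (b * r\<^sup>2)))) * r"
    by (simp add: algebra_simps)
  also have "\<dots> \<le> (1 / 2) * r" using r by (intro mult_right_mono) auto
  finally show ?thesis using r by (intro exI[of _ r]) simp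
qed

section \<open>Nontriviality and conclusion\<close>

context bounded_open_set begin

text \<open>Take a bump that is positive on a box inside the set. If its pairing with the positive h
  vanished, the integrand would vanish almost everywhere and the box would be a null set.\<close>

lemma positive_not_orthogonal:
  assumes ne: "\<Omega> \<noteq> {}" and h: "L2 M h" "\<And>x. x \<in> \<Omega> \<Longrightarrow> h x > 0"
  shows "\<exists>\<psi>. test_fun \<Omega> \<psi> \<and> (\<integral>x. h x * \<psi> x \<partial>M) \<noteq> 0"
proof -
  obtain x where "x \<in> \<Omega>" using ne by blast
  then obtain a b where ab: "cbox a b \<subseteq> \<Omega>" "x \<in> box a b"
    using open_contains_cbox[OF open_\<Omega> \<open>x \<in> \<Omega>\<close>] by metis
  let ?\<psi> = "box_bump a b 0"
  have \<psi>: "test_fun \<Omega> ?\<psi>" by (rule test_fun_box_bump[OF ab(1)])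
  have i: "integrable M (\<lambda>x. h x * ?\<psi> x)" by (intro L2_mult_integrable h test_fun_L2 \<psi>)
  have "(\<integral>x. h x * ?\<psi> x \<partial>M) \<noteq> 0"
  proof
    assume "(\<integral>x. h x * ?\<psi> x \<partial>M) = 0"
    moreover have "AE x in M. 0 \<le> h x * ?\<psi> x"
      using h(2) box_bump_bounds(1) by (auto intro!: AE_I2 mult_nonneg_nonneg simp: space_restrict_space less_imp_le)
    ultimately have "AE x in M. h x * ?\<psi> x = 0" using integral_nonneg_eq_0_iff_AE[OF i] by simp
    then have "AE x in lebesgue. x \<in> \<Omega> \<longrightarrow> h x * ?\<psi> x = 0" by (simp add: AE_iff)
    then have "AE x in lebesgue. x \<notin> box a b"
    proof eventually_elim
      case (elim x)
      have "x \<in> \<Omega> \<and> h x * ?\<psi> x > 0" if "x \<in> box a b"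
        using that ab(1) box_subset_cbox[of a b] h(2)[of x] box_bump_pos[OF that, of 0] by auto
      with elim show ?case by force
    qed
    then have "negligible (box a b)" by (subst negligible_iff_null_sets, subst AE_iff_null_sets) auto
    then show False using open_not_negligible[OF open_box] ab(2) by blast
  qed
  with \<psi> show ?thesis by blast
qed

end

theorem theorem1p1:
  fixes \<Omega> :: "R3 set" and p :: real and K :: "R3 \<Rightarrow> real"
  assumes "smooth_bounded_domain \<Omega>"
    and "p > 1"
    and "in_Linf \<Omega> K" and "\<forall>x\<in>\<Omega>. K x \<ge> 0"
  shows "\<exists>m>0. \<forall>h :: R3 \<Rightarrow> real.
           in_Linf \<Omega> h \<and> (\<forall>x\<in>\<Omega>. h x > 0) \<and> Lp_norm \<Omega> 3 h \<le> m \<longrightarrow>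
           (\<exists>u \<phi>. SM_weak_solution \<Omega> p K h u \<phi> \<and> nontrivial_on \<Omega> u)"
proof -
  interpret bounded_open_set \<Omega>
    using assms(1) by unfold_locales (auto simp: smooth_bounded_domain_def)
  have ne: "\<Omega> \<noteq> {}" using assms(1) by (simp add: smooth_bounded_domain_def)
  obtain C where KM: "K \<in> borel_measurable M" and C: "AE x in M. \<bar>K x\<bar> \<le> C"
    using assms(3) by (auto simp: in_Linf_def set_borel_measurable_iff AE_iff)
  \<comment> \<open>The maximum with 1 supplies the positivity that the locale asks for.\<close>
  define \<kappa> where "\<kappa> = max C 1"
  have \<kappa>: "\<kappa> > 0" "AE x in M. \<bar>K x\<bar> \<le> \<kappa>" using C by (auto simp: \<kappa>_def elim!: eventually_mono)
  obtain r where r: "r > 0" "Cinf * (r powr (p - 1) * r + \<kappa> * (Cinf * (\<kappa> * r\<^sup>2)) * r) \<le> r / 2"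
     "4 * rad\<^sup>2 * (p * r powr (p - 1) + \<kappa> * (Cinf * (\<kappa> * r\<^sup>2)) + \<kappa> * r * (4 * rad\<^sup>2 * (\<kappa> * (2 * r)))) \<le> 1 / 2"
    using small_radius_exists[OF assms(2), of Cinf \<kappa> "4 * rad\<^sup>2"] by blast
  have Csup: "Csup > 0" using Cq_nonneg by (simp add: Csup_def)
  \<comment> \<open>Chosen before h: r and \<open>Csup\<close> depend on the domain, p and K
    only.\<close>
  define m where "m = r / (2 * Csup)"
  have m: "m > 0" "Csup * m \<le> r / 2" using r Csup by (auto simp: m_def)
  show ?thesis
  proof (intro exI[of _ m] conjI allI impI m(1))
    fix h :: "R3 \<Rightarrow> real"
    assume hyp: "in_Linf \<Omega> h \<and> (\<forall>x\<in>\<Omega>. h x > 0) \<and> Lp_norm \<Omega> 3 h \<le> m"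
    \<comment> \<open>D may be large; it gives square integrability of h and finiteness of the cubed
      integral, and does not enter m.\<close>
    obtain D where hM [measurable]: "h \<in> borel_measurable M" and D: "AE x in M. \<bar>h x\<bar> \<le> D"
      using hyp by (auto simp: in_Linf_def set_borel_measurable_iff AE_iff)
    have hL: "L2 M h" by (rule L2_bounded[of _ D]) (use D in auto)
    have h3: "integrable M (\<lambda>x. \<bar>h x\<bar> ^ 3)"
    proof (rule integrable_const_bound[of _ "D ^ 3"])
      show "AE x in M. norm (\<bar>h x\<bar> ^ 3) \<le> D ^ 3" using D by eventually_elim (simp add: power_mono)
    qed measurable
    have I: "(\<integral>x. \<bar>h x\<bar> ^ 3 \<partial>M) \<le> m ^ 3"
    proof -
      let ?I = "\<integral>x. \<bar>h x\<bar> ^ 3 \<partial>M"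
      have I0: "0 \<le> ?I" by simp
      have "?I powr (1 / 3) \<le> m"
        using hyp unfolding Lp_norm_def set_integral_eq by simp
      then have "(?I powr (1 / 3)) ^ 3 \<le> m ^ 3" by (intro power_mono) auto
      moreover have "(?I powr (1 / 3)) ^ 3 = ?I" 
        using I0 by (cases "?I = 0") (auto simp: powr_power)
      ultimately show ?thesis by simp
    qed
    interpret schroedinger_maxwell \<Omega> p \<kappa> r m K h
      by unfold_locales (use assms(2) KM \<kappa> hL h3 I m r in auto)
    obtain u \<phi> where u: "SM_weak_solution \<Omega> p K h u \<phi>"
      "(AE x in M. u x = 0) \<Longrightarrow> \<forall>\<psi>. test_fun \<Omega> \<psi> \<longrightarrow> (\<integral>x. h x * \<psi> x \<partial>M) = 0"
      by (rule weak_solution_exists) blast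
    moreover have "nontrivial_on \<Omega> u"
      unfolding nontrivial_on_def AE_iff using u(2) positive_not_orthogonal[OF ne hL] hyp by blast
    ultimately show "\<exists>u \<phi>. SM_weak_solution \<Omega> p K h u \<phi> \<and> nontrivial_on \<Omega> u" by blast
  qed
qed

end
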